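(* Let $\Omega\subset\mathbb{R}^n$ be a bounded domain with $C^2$ boundary, let $p>2$, and let $u_0\in C^2(\Omega)\cap L^\infty(\Omega)$. Let $\lambda_1>0$ and $\varphi_1$ be the first eigenvalue and the corresponding first eigenfunction of $-\triangle$ on $\Omega$ with homogeneous Dirichlet boundary conditions. Let $C_{\Omega,p}>0$ be a constant such that $$C_{\Omega,p}\Big|\int_\Omega v(x)\varphi_1(x)\,dx\Big|^p\le\int_\Omega|\nabla v(x)|^p\varphi_1(x)\,dx\qquad\text{for all } v\in W^{1,p}_0(\Omega)$$ (such a constant exists since $p>2$), and set $$K:=\Big(\frac{2\lambda_1}{C_{\Omega,p}}\Big)^{1/(p-1)}>0 .$$ If $$\int_\Omega u_0(x)\varphi_1(x)\,dx\ \ge\ K,$$ then any solution $u$ of $$u_t-\triangle u=|\nabla u|^p\ \text{ in }\Omega\times(0,T),\qquad u=0\ \text{ on }\partial\Omega,\qquad u(\cdot,0)=u_0\ \text{ in }\Omega,$$ develops a singularity in finite time, i.e. its maximal time of existence $T^*$ satisfies $T^*<\infty$.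
   Context: The first Dirichlet eigenfunction $\varphi_1$ of $-\triangle$ on $\Omega$ (eigenvalue $\lambda_1$, the smallest eigenvalue) is normalized in $L^2(\Omega)$ and chosen so that $\varphi_1>0$ in $\Omega$. A solution on $[0,T]$ is a function $u\in C^{1+\alpha}(\Omega\times[0,T])\cap C(\overline{\Omega}\times[0,T])$, for some $\alpha\in(0,1)$, satisfying the equation in $\Omega\times(0,T)$ (with $\triangle u$ understood in the sense of distributions if necessary), with $u\equiv0$ on $\partial\Omega$ and $u(\cdot,0)=u_0$. The maximal time of existence $T^*$ is the supremum of the times $T$ for which the solution exists on $[0,T]$. *)

theory Defs
  imports "HOL-Analysis.Analysis"
begin

section \<open>Classical derivatives and smoothness\<close>

text \<open>
  The derivatives below are total functions; they are meaningful where the argument is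
  differentiable (resp. twice differentiable). Functions "on" an open set are functions on the
  whole type of which only the values on that set are relevant.
\<close>

definition partial_deriv :: "'a::euclidean_space \<Rightarrow> ('a \<Rightarrow> real) \<Rightarrow> 'a \<Rightarrow> real" where
  "partial_deriv b f x = frechet_derivative f (at x) b"

definition grad :: "('a::euclidean_space \<Rightarrow> real) \<Rightarrow> 'a \<Rightarrow> 'a" where
  "grad f x = (\<Sum>b\<in>Basis. partial_deriv b f x *\<^sub>R b)"

definition laplacian :: "('a::euclidean_space \<Rightarrow> real) \<Rightarrow> 'a \<Rightarrow> real" where
  "laplacian f x = (\<Sum>b\<in>Basis. partial_deriv b (partial_deriv b f) x)"

text \<open>The class \<open>C\<^sup>k(S)\<close>, for open \<open>S\<close>.\<close>

primrec Ck_on :: "nat \<Rightarrow> 'a::euclidean_space set \<Rightarrow> ('a \<Rightarrow> real) \<Rightarrow> bool" where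
  "Ck_on 0 S f \<longleftrightarrow> continuous_on S f"
| "Ck_on (Suc k) S f \<longleftrightarrow>
     (\<forall>x\<in>S. f differentiable (at x)) \<and> (\<forall>b\<in>Basis. Ck_on k S (partial_deriv b f))"

text \<open>Test functions on an open set \<open>S\<close>, i.e. \<open>C\<^sub>c\<^sup>\<infinity>(S)\<close>, extended by zero.\<close>

definition test_function :: "'a::euclidean_space set \<Rightarrow> ('a \<Rightarrow> real) \<Rightarrow> bool" where
  "test_function S \<psi> \<longleftrightarrow>
     (\<forall>k. Ck_on k UNIV \<psi>) \<and>
     compact (closure {x. \<psi> x \<noteq> 0}) \<and> closure {x. \<psi> x \<noteq> 0} \<subseteq> S"

text \<open>
  \<open>C\<^sup>1\<^sup>+\<^sup>\<alpha>(S)\<close>: differentiable with gradient locally (on compact subsets of \<open>S\<close>) Hoelder continuous of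
  exponent \<open>\<alpha>\<close>. Derivatives are taken within \<open>S\<close>, so that one-sided time derivatives are used
  at the ends of a cylinder \<open>\<Omega> \<times> [0,T]\<close>.
\<close>

definition C1_holder_on :: "real \<Rightarrow> 'a::euclidean_space set \<Rightarrow> ('a \<Rightarrow> real) \<Rightarrow> bool" where
  "C1_holder_on \<alpha> S f \<longleftrightarrow>
     (\<exists>G. (\<forall>z\<in>S. (f has_derivative (\<lambda>h. G z \<bullet> h)) (at z within S)) \<and>
          (\<forall>K. compact K \<and> K \<subseteq> S \<longrightarrow>
             (\<exists>M. \<forall>z\<in>K. \<forall>w\<in>K. norm (G z - G w) \<le> M * dist z w powr \<alpha>)))"

section \<open>Domains\<close>

text \<open>
  Near each boundary point, and after choosing one coordinate axis \<open>e\<close> with its orientation, the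
  set is the region above the graph of a \<open>C\<^sup>2\<close> function \<open>\<gamma>\<close> of the other coordinates. Only the
  values of \<open>\<gamma>\<close> on the hyperplane orthogonal to \<open>e\<close> are used.
\<close>

definition C2_boundary :: "'a::euclidean_space set \<Rightarrow> bool" where
  "C2_boundary \<Omega> \<longleftrightarrow>
     (\<forall>x0\<in>frontier \<Omega>. \<exists>r>0. \<exists>e \<gamma>. (e \<in> Basis \<or> - e \<in> Basis) \<and> Ck_on 2 UNIV \<gamma> \<and>
        \<Omega> \<inter> ball x0 r = {x \<in> ball x0 r. x \<bullet> e > \<gamma> (x - (x \<bullet> e) *\<^sub>R e)})"

definition bounded_C2_domain :: "'a::euclidean_space set \<Rightarrow> bool" where
  "bounded_C2_domain \<Omega> \<longleftrightarrow>
     \<Omega> \<noteq> {} \<and> open \<Omega> \<and> connected \<Omega> \<and> bounded \<Omega> \<and> C2_boundary \<Omega>"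

section \<open>Lebesgue and Sobolev spaces\<close>

definition L_infinity :: "'a::euclidean_space set \<Rightarrow> ('a \<Rightarrow> real) \<Rightarrow> bool" where
  "L_infinity \<Omega> f \<longleftrightarrow>
     f \<in> borel_measurable (lebesgue_on \<Omega>) \<and> (\<exists>M. AE x in lebesgue_on \<Omega>. \<bar>f x\<bar> \<le> M)"

definition Lp :: "'a::euclidean_space set \<Rightarrow> real \<Rightarrow> ('a \<Rightarrow> 'b::euclidean_space) \<Rightarrow> bool" where
  "Lp \<Omega> p f \<longleftrightarrow>
     f \<in> borel_measurable (lebesgue_on \<Omega>) \<and> integrable (lebesgue_on \<Omega>) (\<lambda>x. norm (f x) powr p)"

definition weak_gradient :: "'a::euclidean_space set \<Rightarrow> ('a \<Rightarrow> real) \<Rightarrow> ('a \<Rightarrow> 'a) \<Rightarrow> bool" where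
  "weak_gradient \<Omega> v g \<longleftrightarrow>
     (\<forall>\<psi>. test_function \<Omega> \<psi> \<longrightarrow> (\<forall>b\<in>Basis.
        (\<integral>x. v x * partial_deriv b \<psi> x \<partial>(lebesgue_on \<Omega>)) =
        - (\<integral>x. (g x \<bullet> b) * \<psi> x \<partial>(lebesgue_on \<Omega>))))"

text \<open>
  \<open>sobolev \<Omega> p v g\<close>: \<open>v \<in> W\<^sup>1\<^sup>,\<^sup>p(\<Omega>)\<close> with weak gradient \<open>g\<close>. \<open>sobolev0 \<Omega> p v g\<close>: moreover
  \<open>v \<in> W\<^sub>0\<^sup>1\<^sup>,\<^sup>p(\<Omega>)\<close>, the closure of the test functions. The gradient, determined only almost
  everywhere, is carried as an explicit argument.
\<close>

definition sobolev :: "'a::euclidean_space set \<Rightarrow> real \<Rightarrow> ('a \<Rightarrow> real) \<Rightarrow> ('a \<Rightarrow> 'a) \<Rightarrow> bool" where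
  "sobolev \<Omega> p v g \<longleftrightarrow> Lp \<Omega> p v \<and> Lp \<Omega> p g \<and> weak_gradient \<Omega> v g"

definition sobolev0 :: "'a::euclidean_space set \<Rightarrow> real \<Rightarrow> ('a \<Rightarrow> real) \<Rightarrow> ('a \<Rightarrow> 'a) \<Rightarrow> bool" where
  "sobolev0 \<Omega> p v g \<longleftrightarrow> sobolev \<Omega> p v g \<and>
     (\<exists>\<psi>. (\<forall>k. test_function \<Omega> (\<psi> k)) \<and>
        (\<lambda>k. (\<integral>x. \<bar>\<psi> k x - v x\<bar> powr p \<partial>(lebesgue_on \<Omega>)) +
             (\<integral>x. norm (grad (\<psi> k) x - g x) powr p \<partial>(lebesgue_on \<Omega>)))
        \<longlonglongrightarrow> (0::real))"

section \<open>First Dirichlet eigenvalue\<close>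

definition dirichlet_eigenfunction ::
  "'a::euclidean_space set \<Rightarrow> real \<Rightarrow> ('a \<Rightarrow> real) \<Rightarrow> bool" where
  "dirichlet_eigenfunction \<Omega> \<mu> \<phi> \<longleftrightarrow>
     Ck_on 2 \<Omega> \<phi> \<and> continuous_on (closure \<Omega>) \<phi> \<and>
     (\<forall>x\<in>\<Omega>. - laplacian \<phi> x = \<mu> * \<phi> x) \<and> (\<forall>x\<in>frontier \<Omega>. \<phi> x = 0) \<and>
     (\<exists>x\<in>\<Omega>. \<phi> x \<noteq> 0)"

definition dirichlet_eigenvalue :: "'a::euclidean_space set \<Rightarrow> real \<Rightarrow> bool" where
  "dirichlet_eigenvalue \<Omega> \<mu> \<longleftrightarrow> (\<exists>\<phi>. dirichlet_eigenfunction \<Omega> \<mu> \<phi>)"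

definition first_dirichlet_eigenpair ::
  "'a::euclidean_space set \<Rightarrow> real \<Rightarrow> ('a \<Rightarrow> real) \<Rightarrow> bool" where
  "first_dirichlet_eigenpair \<Omega> lambda1 \<phi>1 \<longleftrightarrow>
     dirichlet_eigenfunction \<Omega> lambda1 \<phi>1 \<and>
     (\<forall>\<mu>. dirichlet_eigenvalue \<Omega> \<mu> \<longrightarrow> lambda1 \<le> \<mu>) \<and>
     (\<forall>x\<in>\<Omega>. \<phi>1 x > 0) \<and> (\<integral>x. (\<phi>1 x)\<^sup>2 \<partial>(lebesgue_on \<Omega>)) = 1"

section \<open>The viscous Hamilton-Jacobi equation\<close>

text \<open>
  \<open>u\<^sub>t - \<triangle>u = |\<nabla>u|\<^sup>p\<close> in \<open>\<Omega> \<times> (0,T)\<close>, where \<open>u\<^sub>t\<close> and \<open>\<nabla>u\<close> are classical and \<open>\<triangle>u\<close> is the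
  distributional (spatial) Laplacian.
\<close>

definition vhj_equation ::
  "'a::euclidean_space set \<Rightarrow> real \<Rightarrow> real \<Rightarrow> ('a \<times> real \<Rightarrow> real) \<Rightarrow> bool" where
  "vhj_equation \<Omega> p T u \<longleftrightarrow>
     (\<forall>\<psi>. test_function (\<Omega> \<times> {0<..<T}) \<psi> \<longrightarrow>
        (\<integral>(x, t). deriv (\<lambda>s. u (x, s)) t * \<psi> (x, t)
                 - u (x, t) * laplacian (\<lambda>y. \<psi> (y, t)) x \<partial>(lebesgue_on (\<Omega> \<times> {0<..<T}))) =
        (\<integral>(x, t). norm (grad (\<lambda>y. u (y, t)) x) powr p * \<psi> (x, t)
             \<partial>(lebesgue_on (\<Omega> \<times> {0<..<T}))))"

definition vhj_solution ::
  "'a::euclidean_space set \<Rightarrow> real \<Rightarrow> ('a \<Rightarrow> real) \<Rightarrow> real \<Rightarrow> ('a \<times> real \<Rightarrow> real) \<Rightarrow> bool" where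
  "vhj_solution \<Omega> p u0 T u \<longleftrightarrow>
     (\<exists>\<alpha>\<in>{0<..<1}. C1_holder_on \<alpha> (\<Omega> \<times> {0..T}) u) \<and>
     continuous_on (closure \<Omega> \<times> {0..T}) u \<and>
     vhj_equation \<Omega> p T u \<and>
     (\<forall>x\<in>frontier \<Omega>. \<forall>t\<in>{0..T}. u (x, t) = 0) \<and>
     (\<forall>x\<in>\<Omega>. u (x, 0) = u0 x)"

text \<open>
  The supremum is taken over all solutions with initial datum \<open>u0\<close>, so it bounds the existence
  time of each of them without presupposing uniqueness. It is \<open>-\<infinity>\<close> when there is no solution.
\<close>

definition maximal_existence_time ::
  "'a::euclidean_space set \<Rightarrow> real \<Rightarrow> ('a \<Rightarrow> real) \<Rightarrow> ereal" where
  "maximal_existence_time \<Omega> p u0 = (SUP T\<in>{T. T > 0 \<and> (\<exists>u. vhj_solution \<Omega> p u0 T u)}. ereal T)"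

end

theory Submission
  imports Defs
begin

text \<open>
  Kaplan's eigenfunction method. Formally \<open>z(t) = \<integral> u(x,t) \<phi>(x) dx\<close> satisfies
  \<open>z' = - \<lambda> z + \<integral> |\<nabla>u|\<^sup>p \<phi> \<ge> C |z|\<^sup>p - \<lambda> z\<close>, so that \<open>z(0) \<ge> K\<close> forces \<open>z' \<ge> (C/2) z\<^sup>p\<close> and hence a
  bound \<open>T \<le> 2 K\<^sup>1\<^sup>-\<^sup>p / ((p - 1) C)\<close> that does not depend on \<open>u\<close>.

  Nothing is known about \<open>\<nabla>u\<close> up to the boundary, so \<open>\<phi>\<close> is replaced by \<open>h(\<phi>)\<close>, where \<open>h\<close> is
  convex, vanishes below \<open>d\<close> and equals \<open>s - 2 d\<close> above \<open>3 d\<close>. This creates the term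
  \<open>\<integral> u h''(\<phi>) |\<nabla>\<phi>|\<^sup>2\<close>; it is small because \<open>u\<close> is uniformly small where \<open>\<phi> < 3 d\<close>, while
  \<open>\<integral> h''(\<phi>) |\<nabla>\<phi>|\<^sup>2 = \<lambda> \<integral> h'(\<phi>) \<phi>\<close> stays bounded. For the same reason the Poincare type
  inequality is applied not to \<open>u\<close> but to a soft thresholding of \<open>u\<close>, which is \<open>C\<^sup>1\<close> with compact
  support. Both steps are error terms that vanish uniformly in time, and no regularity of the
  boundary is needed.
\<close>

section \<open>Compactly supported differentiable functions\<close>

text \<open>The weight h(\<phi>) is only C^2, whereas the equation is tested against smooth
  functions and the Laplacian of u is a distribution. The way round is to move one spatial
  derivative onto u: the resulting form contains only first derivatives of the test function, and it
  extends by mollification to C^1 functions of compact support. Multiplying such a function of x by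
  a bump in t that shrinks to a point yields an identity at every single time, and there the
  derivative can be moved back onto h(\<phi>), which is smooth enough to take it.

  The moment z is a uniform limit of the moments with weight h(\<phi>), and only these have
  derivatives. The differential inequality for z is therefore kept in integrated form, and
  separation of variables is carried out for a C^1 function that lies below z.

  The number K solves C K^(p-1) = 2 \<lambda>. Above it \<lambda> z is at most half of C z^p, and
  the other half drives the growth.\<close>

definition C1c :: "'b::euclidean_space set \<Rightarrow> ('b \<Rightarrow> real) \<Rightarrow> ('b \<Rightarrow> 'b) \<Rightarrow> bool" where
  "C1c K f g \<longleftrightarrow> compact K \<and> (\<forall>x. (f has_derivative (\<lambda>h. g x \<bullet> h)) (at x)) \<and>
     continuous_on UNIV g \<and> (\<forall>x. x \<notin> K \<longrightarrow> f x = 0 \<and> g x = 0)"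

lemma partial_deriv_eq:
  assumes "(f has_derivative (\<lambda>h. g \<bullet> h)) (at x)"
  shows "partial_deriv b f x = g \<bullet> b"
  unfolding partial_deriv_def using frechet_derivative_at[OF assms] by metis

lemma grad_eq:
  assumes "(f has_derivative (\<lambda>h. g \<bullet> h)) (at x)"
  shows "grad f x = g"
  unfolding grad_def partial_deriv_eq[OF assms] by (rule euclidean_representation)

lemma grad_inner_Basis: "b \<in> Basis \<Longrightarrow> grad f x \<bullet> b = partial_deriv b f x"
  by (simp add: grad_def)

lemma has_derivative_grad:
  assumes "f differentiable (at x)"
  shows "(f has_derivative (\<lambda>h. grad f x \<bullet> h)) (at x)"
proof -
  let ?D = "frechet_derivative f (at x)"
  have D: "(f has_derivative ?D) (at x)"
    using assms by (simp add: frechet_derivative_works)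
  interpret D: linear ?D using has_derivative_linear[OF D] .
  have "?D h = grad f x \<bullet> h" for h
  proof -
    have "?D h = ?D (\<Sum>b\<in>Basis. (h \<bullet> b) *\<^sub>R b)" by (simp add: euclidean_representation)
    also have "\<dots> = (\<Sum>b\<in>Basis. (h \<bullet> b) * ?D b)" by (simp add: D.sum D.scale)
    also have "\<dots> = grad f x \<bullet> h"
      by (simp add: grad_def partial_deriv_def inner_sum_left mult.commute inner_commute[of h])
    finally show ?thesis .
  qed
  then have "?D = (\<lambda>h. grad f x \<bullet> h)" by blast
  with D show ?thesis by simp
qed

lemma uniformly_continuous_on_compact_support:
  fixes g :: "'b::euclidean_space \<Rightarrow> 'c::real_normed_vector"
  assumes "continuous_on UNIV g" "compact K" "\<And>x. x \<notin> K \<Longrightarrow> g x = 0"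
  shows "uniformly_continuous_on UNIV g"
  unfolding uniformly_continuous_on_def
proof (intro allI impI)
  fix e :: real assume e: "e > 0"
  obtain R where R: "\<And>x. x \<in> K \<Longrightarrow> norm x \<le> R"
    using compact_imp_bounded[OF assms(2)] unfolding bounded_iff by blast
  have "uniformly_continuous_on (cball 0 (R + 1)) g"
    using assms(1) continuous_on_subset by (intro compact_uniformly_continuous) auto
  then obtain d where d: "d > 0" "\<And>x y. x \<in> cball 0 (R+1) \<Longrightarrow> y \<in> cball 0 (R+1) \<Longrightarrow> dist y x < d \<Longrightarrow> dist (g y) (g x) < e"
    unfolding uniformly_continuous_on_def using e by blast
  \<comment> \<open>The larger ball leaves a margin of 1: if two points at distance below 1 are not
    both in it, then both lie outside \<open>K\<close>, where \<open>g\<close> vanishes.\<close>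
  show "\<exists>d>0. \<forall>x\<in>UNIV. \<forall>x'\<in>UNIV. dist x' x < d \<longrightarrow> dist (g x') (g x) < e"
  proof (intro exI[of _ "min d 1"] conjI ballI impI)
    fix x y :: 'b assume "dist y x < min d 1"
    then have xy: "dist x y < min d 1" by (simp add: dist_commute)
    show "dist (g y) (g x) < e"
    proof (cases "x \<in> cball 0 (R+1) \<and> y \<in> cball 0 (R+1)")
      case True then show ?thesis using d xy by (auto simp: dist_commute)
    next
      case False
      have "norm x \<le> norm y + dist x y" "norm y \<le> norm x + dist x y"
        by (metis add.commute dist_norm norm_triangle_sub, metis add.commute dist_norm norm_triangle_sub dist_commute)
      then have "norm x > R" "norm y > R" using xy False by auto
      then have "g x = 0" "g y = 0" using R assms(3) by force+
      then show ?thesis using e by simp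
    qed
  qed (use d in auto)
qed

text \<open>The mean value inequality for \<open>f\<close> minus its linear part at
  \<open>x\<close>: the gradient of the difference is \<open>g y - g x\<close>, which is small
  uniformly in \<open>x\<close>. This uniform first order expansion is what allows limits to be
  taken under integrals.\<close>

lemma C1c_uniform:
  assumes "C1c K f g" "e > 0"
  obtains d where "d > 0" "\<And>x h. norm h < d \<Longrightarrow> \<bar>f (x + h) - f x - g x \<bullet> h\<bar> \<le> e * norm h"
proof -
  have c: "continuous_on UNIV g" "compact K" "\<And>x. x \<notin> K \<Longrightarrow> g x = 0"
    and D: "\<And>x. (f has_derivative (\<lambda>h. g x \<bullet> h)) (at x)"
    using assms(1) unfolding C1c_def by auto
  have "uniformly_continuous_on UNIV g"
    by (rule uniformly_continuous_on_compact_support[OF c])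
  then obtain d where d: "d > 0" "\<And>x y. dist x y < d \<Longrightarrow> dist (g x) (g y) < e"
    unfolding uniformly_continuous_on_def using assms(2) by (metis UNIV_I)
  show thesis
  proof (rule that[OF d(1)])
    fix x h :: 'a assume h: "norm h < d"
    define F where "F y = f y - g x \<bullet> y" for y
    have "norm (F (x + h) - F x) \<le> e * norm (x + h - x)"
    proof (rule differentiable_bound[where S = "ball x d" and f' = "\<lambda>y h. (g y - g x) \<bullet> h"])
      show "(F has_derivative (\<lambda>h. (g y - g x) \<bullet> h)) (at y within ball x d)" for y
        unfolding F_def
        by (rule has_derivative_eq_rhs, rule has_derivative_diff, rule has_derivative_at_withinI[OF D],
            (rule derivative_intros)+) (simp add: inner_diff_left)
      show "onorm (\<lambda>h. (g y - g x) \<bullet> h) \<le> e" if "y \<in> ball x d" for y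
      proof (rule onorm_le)
        fix h
        have "norm (g y - g x) \<le> e" using d(2)[of y x] that by (simp add: dist_norm norm_minus_commute less_imp_le)
        then show "norm ((g y - g x) \<bullet> h) \<le> e * norm h"
          using Cauchy_Schwarz_ineq2[of "g y - g x" h] mult_right_mono[of "norm (g y - g x)" e "norm h"] by simp
      qed
    qed (use h d in \<open>auto simp: dist_norm\<close>)
    then show "\<bar>f (x + h) - f x - g x \<bullet> h\<bar> \<le> e * norm h"
      by (simp add: F_def inner_add_right algebra_simps)
  qed
qed

lemma C1c_continuous: "C1c K f g \<Longrightarrow> continuous_on UNIV f"
  unfolding C1c_def by (meson continuous_at_imp_continuous_on has_derivative_continuous)

section \<open>Integrals of compactly supported functions\<close>

lemma integrable_compact_support:
  fixes f :: "'b::euclidean_space \<Rightarrow> 'c::euclidean_space"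
  assumes "continuous_on UNIV f" "compact K" "\<And>x. x \<notin> K \<Longrightarrow> f x = 0"
  shows "integrable lborel f"
proof -
  have "integrable lborel (\<lambda>x. indicator K x *\<^sub>R f x)"
    by (rule borel_integrable_compact) (use assms continuous_on_subset[of UNIV f K] in auto)
  also have "(\<lambda>x. indicator K x *\<^sub>R f x) = f" using assms(3) by (auto simp: indicator_def)
  finally show ?thesis .
qed

lemma integral_translate:
  fixes f :: "'b::euclidean_space \<Rightarrow> real"
  assumes [measurable]: "f \<in> borel_measurable borel"
  shows "(\<integral>y. f (a + y) \<partial>lborel) = (\<integral>y. f y \<partial>lborel)"
proof -
  have "(\<integral>y. f y \<partial>lborel) = (\<integral>y. f y \<partial>distr lborel borel ((+) a))"
    by (simp add: lborel_distr_plus)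
  also have "\<dots> = (\<integral>y. f (a + y) \<partial>lborel)" by (rule integral_distr) auto
  finally show ?thesis by simp
qed

lemma integral_reflect_euclidean:
  fixes f :: "'b::euclidean_space \<Rightarrow> real"
  assumes [measurable]: "f \<in> borel_measurable borel"
  shows "(\<integral>y. f (x - y) \<partial>lborel) = (\<integral>y. f y \<partial>lborel)"
proof -
  have "(\<integral>y. f y \<partial>lborel) = (\<integral>y. f y \<partial>density (distr lborel borel (\<lambda>y. x + (-1) *\<^sub>R y)) (\<lambda>_. ennreal (\<bar>-1\<bar>^DIM('b))))"
    by (subst lborel_affine[of "-1::real" x, symmetric]) auto
  also have "\<dots> = (\<integral>y. f (x - y) \<partial>lborel)"
    by (subst integral_density) (auto simp: integral_distr)
  finally show ?thesis by simp
qed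

text \<open>Translation invariance does the work: \<open>f (t *\<^sub>R b + x) - f x\<close>
  integrates to zero, and by \<open>C1c_uniform\<close> it differs from
  \<open>g x \<bullet> (t *\<^sub>R b)\<close> by at most \<open>e * t * norm b\<close>, on a ball
  of fixed volume \<open>V\<close>. Division by \<open>t\<close> bounds the integral by an
  arbitrarily small number.\<close>

lemma integral_partial_deriv_eq_0:
  assumes "C1c K f g"
  shows "(\<integral>x. g x \<bullet> b \<partial>lborel) = 0"
proof -
  have K: "compact K" and gc: "continuous_on UNIV g" and z: "\<And>x. x \<notin> K \<Longrightarrow> f x = 0" "\<And>x. x \<notin> K \<Longrightarrow> g x = 0"
    using assms unfolding C1c_def by auto
  have fc: "continuous_on UNIV f" by (rule C1c_continuous[OF assms])
  have [measurable]: "f \<in> borel_measurable borel" "g \<in> borel_measurable borel"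
    using fc gc by (auto intro: borel_measurable_continuous_onI)
  obtain R where R: "\<And>x. x \<in> K \<Longrightarrow> norm x \<le> R"
    using compact_imp_bounded[OF K] unfolding bounded_iff by blast
  define V where "V = measure lborel (cball (0::'a) (R+1))"
  have V: "V \<ge> 0" by (simp add: V_def)
  have if1: "integrable lborel f" by (rule integrable_compact_support[OF fc K z(1)])
  have ig: "integrable lborel g" by (rule integrable_compact_support[OF gc K z(2)])
  show ?thesis
  proof (cases "b = 0")
    case False
    let ?I = "\<integral>x. g x \<bullet> b \<partial>lborel"
    have "\<bar>?I\<bar> \<le> e * norm b * V" if e: "e > 0" for e
    proof -
      obtain d where d: "d > 0" "\<And>x h. norm h < d \<Longrightarrow> \<bar>f (x + h) - f x - g x \<bullet> h\<bar> \<le> e * norm h"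
        using C1c_uniform[OF assms e] by blast
      \<comment> \<open>The shift has length \<open>min d 1 / 2\<close>: below \<open>d\<close> for
        the expansion, and below 1 so that the shifted support stays in the ball of radius
        \<open>R+1\<close>.\<close>
      define t where "t = min d 1 / (2 * norm b)"
      have t: "t > 0" "norm (t *\<^sub>R b) < d" "norm (t *\<^sub>R b) < 1"
        using d False by (auto simp: t_def min_def)
      have if2: "integrable lborel (\<lambda>x. f (t *\<^sub>R b + x))"
      proof (rule integrable_compact_support[where K = "cball 0 (R+1)"])
        show "continuous_on UNIV (\<lambda>x. f (t *\<^sub>R b + x))"
          by (rule continuous_on_compose2[OF fc]) (auto intro!: continuous_intros)
        fix x :: 'a assume "x \<notin> cball 0 (R+1)"
        then have "norm (t *\<^sub>R b + x) > R" using t(3) norm_triangle_ineq2[of x "-(t *\<^sub>R b)"] by (simp add: add.commute)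
        then show "f (t *\<^sub>R b + x) = 0" using R z by force
      qed auto
      have "(\<integral>x. f (t *\<^sub>R b + x) - f x - g x \<bullet> (t *\<^sub>R b) \<partial>lborel) = - t * ?I"
        using if1 if2 ig by (simp add: integral_translate)
      moreover have "\<bar>\<integral>x. f (t *\<^sub>R b + x) - f x - g x \<bullet> (t *\<^sub>R b) \<partial>lborel\<bar> \<le> (\<integral>x. indicator (cball (0::'a) (R+1)) x * (e * norm (t *\<^sub>R b)) \<partial>lborel)"
      proof (rule integral_abs_bound_integral)
        show "integrable lborel (\<lambda>x. f (t *\<^sub>R b + x) - f x - g x \<bullet> (t *\<^sub>R b))"
          using if1 if2 ig by (intro Bochner_Integration.integrable_diff integrable_inner_left) auto
        show "integrable lborel (\<lambda>x. indicator (cball (0::'a) (R+1)) x * (e * norm (t *\<^sub>R b)))"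
          by (intro integrable_mult_left integrable_real_indicator emeasure_bounded_finite) auto
        fix x :: 'a
        show "\<bar>f (t *\<^sub>R b + x) - f x - g x \<bullet> (t *\<^sub>R b)\<bar> \<le> indicator (cball 0 (R+1)) x * (e * norm (t *\<^sub>R b))"
        proof (cases "x \<in> cball 0 (R+1)")
          case True then show ?thesis using d(2)[OF t(2), of x] by (simp add: add.commute)
        next
          case False
          then have "norm (t *\<^sub>R b + x) > R" "norm x > R" using t(3) norm_triangle_ineq2[of x "-(t *\<^sub>R b)"] by (simp_all add: add.commute)
          then have "x \<notin> K" "t *\<^sub>R b + x \<notin> K" using R by force+
          then show ?thesis using z e by simp
        qed
      qed
      moreover have "(\<integral>x. indicator (cball (0::'a) (R+1)) x * (e * norm (t *\<^sub>R b)) \<partial>lborel) = t * (e * norm b * V)"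
        unfolding V_def using t(1) by (subst integral_mult_left_zero) simp
      ultimately have "t * \<bar>?I\<bar> \<le> t * (e * norm b * V)"
        using t(1) by (simp only: abs_mult abs_minus_cancel abs_of_pos)
      then show ?thesis using t(1) by simp
    qed
    note bnd = this
    show ?thesis
    proof (rule ccontr)
      assume "?I \<noteq> 0"
      then have I: "\<bar>?I\<bar> > 0" by simp
      have "norm b * V + 1 > 0" using V by (smt (verit) mult_nonneg_nonneg norm_ge_zero)
      then have "\<bar>?I\<bar> * (norm b * V + 1) \<le> \<bar>?I\<bar> * (norm b * V)"
        using bnd[of "\<bar>?I\<bar> / (norm b * V + 1)"] I by (simp add: field_simps)
      then show False using I by simp
    qed
  qed simp
qed

section \<open>Mollifiers\<close>

text \<open>The functions \<open>s\<^sup>-\<^sup>j exp (-1/s)\<close>, extended by zero to \<open>s \<le> 0\<close>, span a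
  space that is closed under differentiation.\<close>

definition flat_exp :: "nat \<Rightarrow> real \<Rightarrow> real" where
  "flat_exp j s = (if s > 0 then (1 / s) ^ j * exp (- (1 / s)) else 0)"

lemma flat_exp_nonneg: "flat_exp j s \<ge> 0"
  by (simp add: flat_exp_def)

lemma tendsto_flat_exp_0: "(flat_exp j \<longlongrightarrow> 0) (at 0)"
proof -
  have "((\<lambda>s. (inverse s) ^ j / exp (inverse s)) \<longlongrightarrow> (0::real)) (at_right 0)"
    by (rule filterlim_compose[OF tendsto_power_div_exp_0 filterlim_inverse_at_top_right])
  then have "(flat_exp j \<longlongrightarrow> 0) (at_right 0)"
    by (rule Lim_transform_eventually)
      (auto simp: flat_exp_def eventually_at_right_field exp_minus field_simps intro!: exI[of _ 1])
  moreover have "(flat_exp j \<longlongrightarrow> 0) (at_left 0)"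
    by (rule Lim_transform_eventually[OF tendsto_const])
      (auto simp: flat_exp_def eventually_at_left_field intro!: exI[of _ "-1"])
  ultimately show ?thesis by (simp add: filterlim_split_at)
qed

lemma has_real_derivative_flat_exp:
  "(flat_exp j has_real_derivative (flat_exp (j + 2) s - j * flat_exp (j + 1) s)) (at s)"
proof (cases s "0::real" rule: linorder_cases)
  case less
  have "((\<lambda>_. 0) has_real_derivative 0) (at s)" by simp
  then have "(flat_exp j has_real_derivative 0) (at s)"
    by (rule has_field_derivative_transform_within_open[where S = "{..<0}"])
      (use less in \<open>auto simp: flat_exp_def\<close>)
  then show ?thesis using less by (simp add: flat_exp_def)
next
  case equal
  \<comment> \<open>At 0 the difference quotient of \<open>flat_exp j\<close> is
    \<open>flat_exp (Suc j)\<close>, whose limit is already known.\<close>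
  have "((\<lambda>h. (flat_exp j (0 + h) - flat_exp j 0) / h) \<longlongrightarrow> 0) (at 0)"
    by (rule Lim_transform_eventually[OF tendsto_flat_exp_0[of "Suc j"]])
      (auto simp: flat_exp_def)
  then show ?thesis using equal by (simp add: DERIV_def flat_exp_def)
next
  case greater
  have "((\<lambda>s. (1 / s) ^ j * exp (- (1 / s))) has_real_derivative
      (real j * (1 / s) ^ (j - 1) * (- (1 / s\<^sup>2))) * exp (- (1 / s)) + (1 / s) ^ j * (exp (- (1 / s)) * (1 / s\<^sup>2))) (at s)"
    using greater by (auto intro!: derivative_eq_intros simp: power2_eq_square)
  \<comment> \<open>For \<open>j = 0\<close> the exponent \<open>j - 1\<close> is truncated to 0,
    which is harmless because the factor \<open>real j\<close> vanishes.\<close>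
  also have "real j * (1 / s) ^ (j - 1) * (- (1 / s\<^sup>2)) = - (real j * (1 / s) ^ (j + 1))"
    by (cases j) (simp_all add: power2_eq_square)
  also have "- (real j * (1 / s) ^ (j + 1)) * exp (- (1 / s)) + (1 / s) ^ j * (exp (- (1 / s)) * (1 / s\<^sup>2))
      = flat_exp (j + 2) s - j * flat_exp (j + 1) s"
    using greater by (simp add: flat_exp_def power2_eq_square)
  finally have "((\<lambda>s. (1 / s) ^ j * exp (- (1 / s))) has_real_derivative
      (flat_exp (j + 2) s - j * flat_exp (j + 1) s)) (at s)" .
  then show ?thesis
    by (rule has_field_derivative_transform_within_open[where S = "{0<..}"])
      (use greater in \<open>auto simp: flat_exp_def\<close>)
qed

section \<open>Closure properties of the classes C^k\<close>

lemma Ck_on_const: "Ck_on k UNIV (\<lambda>x. c)"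
proof (induction k arbitrary: c)
  case (Suc k)
  have "partial_deriv b (\<lambda>x::'a. c) = (\<lambda>x. 0)" for b
    by (rule ext) (simp add: partial_deriv_def)
  then show ?case using Suc by simp
qed simp

lemma Ck_on_inner: "Ck_on k UNIV (\<lambda>x. x \<bullet> c)"
proof (cases k)
  case (Suc i)
  have "partial_deriv b (\<lambda>x::'a. x \<bullet> c) = (\<lambda>x. c \<bullet> b)" for b
    by (rule ext, rule partial_deriv_eq, rule has_derivative_eq_rhs, (rule derivative_intros)+)
      (simp add: inner_commute)
  then show ?thesis using Suc Ck_on_const by (auto intro!: derivative_intros)
qed (auto intro!: continuous_intros)

lemma Ck_on_Suc_imp: "Ck_on (Suc k) S f \<Longrightarrow> Ck_on k S f"
proof (induction k arbitrary: f)
  case 0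
  then show ?case
    by (auto intro!: continuous_at_imp_continuous_on differentiable_imp_continuous_within)
qed auto

lemma partial_deriv_add:
  assumes "f differentiable (at x)" "g differentiable (at x)"
  shows "partial_deriv b (\<lambda>x. f x + g x) x = partial_deriv b f x + partial_deriv b g x"
proof -
  have *: "((\<lambda>x. f x + g x) has_derivative (\<lambda>h. (grad f x + grad g x) \<bullet> h)) (at x)"
    using has_derivative_add[OF has_derivative_grad[OF assms(1)] has_derivative_grad[OF assms(2)]]
    by (simp add: inner_add_left)
  then show ?thesis
    using assms by (simp add: partial_deriv_eq[OF *] partial_deriv_eq[OF has_derivative_grad] inner_add_left)
qed

lemma partial_deriv_mult:
  assumes "f differentiable (at x)" "g differentiable (at x)"
  shows "partial_deriv b (\<lambda>x. f x * g x) x = f x * partial_deriv b g x + partial_deriv b f x * g x"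
proof -
  have *: "((\<lambda>x. f x * g x) has_derivative (\<lambda>h. (f x *\<^sub>R grad g x + g x *\<^sub>R grad f x) \<bullet> h)) (at x)"
    using has_derivative_mult[OF has_derivative_grad[OF assms(1)] has_derivative_grad[OF assms(2)]]
    by (simp add: inner_add_left mult.commute)
  then show ?thesis
    using assms by (simp add: partial_deriv_eq[OF *] partial_deriv_eq[OF has_derivative_grad] inner_add_left mult.commute)
qed

lemma Ck_on_add: "Ck_on k UNIV f \<Longrightarrow> Ck_on k UNIV g \<Longrightarrow> Ck_on k UNIV (\<lambda>x. f x + g x)"
proof (induction k arbitrary: f g)
  case (Suc k)
  have "partial_deriv b (\<lambda>x. f x + g x) = (\<lambda>x. partial_deriv b f x + partial_deriv b g x)" for b
    by (rule ext, rule partial_deriv_add) (use Suc.prems in auto)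
  then show ?case using Suc by auto
qed (auto intro!: continuous_intros)

lemma Ck_on_mult: "Ck_on k UNIV f \<Longrightarrow> Ck_on k UNIV g \<Longrightarrow> Ck_on k UNIV (\<lambda>x. f x * g x)"
proof (induction k arbitrary: f g)
  case (Suc k)
  have "partial_deriv b (\<lambda>x. f x * g x) = (\<lambda>x. f x * partial_deriv b g x + partial_deriv b f x * g x)" for b
    by (rule ext, rule partial_deriv_mult) (use Suc.prems in auto)
  moreover have "Ck_on k UNIV f" "Ck_on k UNIV g" using Suc.prems Ck_on_Suc_imp by blast+
  ultimately show ?case using Suc by (auto intro!: Ck_on_add)
qed (auto intro!: continuous_intros)

text \<open>The induction needs \<open>j\<close> free: each partial derivative is a linear function
  of \<open>x\<close> times a combination of \<open>flat_exp (j + 2)\<close> and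
  \<open>flat_exp (j + 1)\<close> at the same argument.\<close>

lemma Ck_on_flat_exp: "Ck_on k UNIV (\<lambda>x. flat_exp j (r - x \<bullet> x))"
proof (induction k arbitrary: j)
  case 0
  have "isCont (flat_exp j) s" for s
    using has_real_derivative_flat_exp DERIV_isCont by blast
  then have "continuous_on UNIV (flat_exp j)"
    by (simp add: continuous_at_imp_continuous_on)
  then show ?case
    by (auto intro!: continuous_intros intro: continuous_on_compose2)
next
  case (Suc k)
  have D: "((\<lambda>x. flat_exp j (r - x \<bullet> x)) has_derivative
     (\<lambda>h. ((-2 * (flat_exp (j + 2) (r - x \<bullet> x) - j * flat_exp (j + 1) (r - x \<bullet> x))) *\<^sub>R x) \<bullet> h)) (at x)" for x :: 'a
    by (rule has_derivative_eq_rhs,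
        rule has_derivative_compose[OF _ has_real_derivative_flat_exp[unfolded has_field_derivative_def]],
        (rule derivative_intros)+) (auto simp: inner_commute fun_eq_iff algebra_simps)
  have "partial_deriv b (\<lambda>x. flat_exp j (r - x \<bullet> x)) =
      (\<lambda>x. (-2 * (x \<bullet> b)) * (flat_exp (j + 2) (r - x \<bullet> x) + (- real j) * flat_exp (j + 1) (r - x \<bullet> x)))" for b :: 'a
    by (rule ext, subst partial_deriv_eq[OF D]) (simp add: algebra_simps)
  moreover have "Ck_on k UNIV (\<lambda>x. (-2 * (x \<bullet> b)) * (flat_exp (j + 2) (r - x \<bullet> x) + (- real j) * flat_exp (j + 1) (r - x \<bullet> x)))" for b :: 'a
    by (intro Ck_on_mult Ck_on_add Ck_on_const Ck_on_inner Suc.IH)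
  ultimately show ?case using D by (auto simp: differentiable_def)
qed

lemma Ck_on_continuous: "Ck_on k S f \<Longrightarrow> continuous_on S f"
  by (induction k) (auto simp: Ck_on_Suc_imp simp del: Ck_on.simps(2))

lemma exists_mollifier:
  assumes "r > 0"
  obtains \<rho> :: "'b::euclidean_space \<Rightarrow> real" where
    "\<And>k. Ck_on k UNIV \<rho>" "\<And>x. \<rho> x \<ge> 0" "\<And>x. norm x > r \<Longrightarrow> \<rho> x = 0"
    "(\<integral>x. \<rho> x \<partial>lborel) = 1"
proof -
  \<comment> \<open>The classical bump exp(-1/(r^2 - |x|^2)), positive exactly on the open ball of
    radius \<open>r\<close>.\<close>
  define f :: "'b \<Rightarrow> real" where "f x = flat_exp 0 (r\<^sup>2 - x \<bullet> x)" for x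
  have fC: "Ck_on k UNIV f" for k unfolding f_def by (rule Ck_on_flat_exp)
  have fc: "continuous_on UNIV f" using fC[of 0] by simp
  have f0: "f x \<ge> 0" for x by (simp add: f_def flat_exp_nonneg)
  have pos: "f x > 0 \<longleftrightarrow> norm x < r" for x
    using assms by (simp add: f_def flat_exp_def norm_lt_square)
  have fz: "f x = 0" if "norm x > r" for x
    using pos[of x] f0[of x] that by linarith
  have int: "integrable lborel f"
    by (rule integrable_compact_support[where K = "cball 0 r"]) (use fc fz in auto)
  \<comment> \<open>Otherwise \<open>f\<close> would vanish almost everywhere, and the ball on which
    it is positive would be a null set.\<close>
  have "(\<integral>x. f x \<partial>lborel) \<noteq> 0"
  proof
    assume "(\<integral>x. f x \<partial>lborel) = 0"
    then have "AE x in lborel. f x = 0"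
      using integral_nonneg_eq_0_iff_AE[OF int] f0 by auto
    then have "AE x in lborel. x \<notin> ball (0::'b) r" by (rule eventually_mono) (use pos in force)
    then have "emeasure lborel (ball (0::'b) r) = 0"
      by (subst (asm) AE_iff_measurable[OF _ refl]) (auto simp: ball_def)
    then have "measure lborel (ball (0::'b) r) = 0" by (simp add: measure_def)
    then show False using content_ball_pos[OF assms, of "0::'b"] by simp
  qed
  moreover have "(\<integral>x. f x \<partial>lborel) \<ge> 0" using f0 by simp
  ultimately have I: "(\<integral>x. f x \<partial>lborel) > 0" by linarith
  show thesis
  proof (rule that[of "\<lambda>x. (1 / (\<integral>x. f x \<partial>lborel)) * f x"])
    show "Ck_on k UNIV (\<lambda>x. (1 / (\<integral>x. f x \<partial>lborel)) * f x)" for k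
      by (intro Ck_on_mult Ck_on_const fC)
  qed (use I f0 fz in auto)
qed

section \<open>Convolution\<close>

definition conv :: "('b::euclidean_space \<Rightarrow> real) \<Rightarrow> ('b \<Rightarrow> real) \<Rightarrow> 'b \<Rightarrow> real" where
  "conv f h x = (\<integral>y. f (x - y) * h y \<partial>lborel)"

lemma conv_commute:
  fixes f h :: "'b::euclidean_space \<Rightarrow> real"
  assumes [measurable]: "f \<in> borel_measurable borel" "h \<in> borel_measurable borel"
  shows "conv f h = conv h f"
proof
  fix x :: 'b
  show "conv f h x = conv h f x"
    unfolding conv_def
    using integral_reflect_euclidean[of "\<lambda>y. f (x - y) * h y" x] by (simp add: mult.commute)
qed

lemma integrable_conv:
  fixes f h :: "'b::euclidean_space \<Rightarrow> real"
  assumes "continuous_on UNIV f" "continuous_on UNIV h" "compact L" "\<And>x. x \<notin> L \<Longrightarrow> h x = 0"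
  shows "integrable lborel (\<lambda>y. f (x - y) * h y)"
proof (rule integrable_compact_support[OF _ assms(3)])
  show "continuous_on UNIV (\<lambda>y. f (x - y) * h y)"
    by (intro continuous_intros continuous_on_compose2[OF assms(1)] continuous_on_subset[OF assms(2)]) auto
qed (use assms in auto)

text \<open>The derivative falls on the first factor: the expansion of \<open>C1c_uniform\<close>
  holds at all points \<open>x - w\<close> with one and the same \<open>d\<close>, so it may be
  multiplied by \<open>h w\<close> and integrated. The error is controlled by the integral
  \<open>N\<close> of \<open>\<bar>h\<bar>\<close>.\<close>

lemma has_derivative_conv:
  fixes f h :: "'b::euclidean_space \<Rightarrow> real"
  assumes f: "C1c K f g" and h: "continuous_on UNIV h" "compact L" "\<And>x. x \<notin> L \<Longrightarrow> h x = 0"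
  shows "(conv f h has_derivative (\<lambda>v. (\<Sum>b\<in>Basis. conv (\<lambda>x. g x \<bullet> b) h x *\<^sub>R b) \<bullet> v)) (at x)"
  unfolding has_derivative_at_alt
proof (intro conjI allI impI)
  let ?G = "\<Sum>b\<in>Basis. conv (\<lambda>x. g x \<bullet> b) h x *\<^sub>R b"
  have gc: "continuous_on UNIV g" using f unfolding C1c_def by auto
  note fc = C1c_continuous[OF f]
  have ih: "integrable lborel (\<lambda>y. \<bar>h y\<bar>)"
    by (rule integrable_compact_support[where K = L])
      (use h in \<open>auto intro!: continuous_intros\<close>)
  define N where "N = (\<integral>y. \<bar>h y\<bar> \<partial>lborel)"
  have N: "N \<ge> 0" by (simp add: N_def)
  have i1: "integrable lborel (\<lambda>y. f (z - y) * h y)" for z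
    by (rule integrable_conv[OF fc h])
  have i2: "integrable lborel (\<lambda>y. g (z - y) \<bullet> v * h y)" for z v
    by (rule integrable_conv[of "\<lambda>x. g x \<bullet> v", OF _ h]) (auto intro!: continuous_intros gc)
  have G: "?G \<bullet> v = (\<integral>y. g (x - y) \<bullet> v * h y \<partial>lborel)" for v
  proof -
    have "?G \<bullet> v = (\<Sum>b\<in>Basis. (\<integral>y. g (x - y) \<bullet> b * h y * (v \<bullet> b) \<partial>lborel))"
      by (simp add: inner_sum_left conv_def inner_commute[of v])
    also have "\<dots> = (\<integral>y. (\<Sum>b\<in>Basis. g (x - y) \<bullet> b * h y * (v \<bullet> b)) \<partial>lborel)"
      by (rule Bochner_Integration.integral_sum[symmetric]) (intro integrable_mult_left i2)
    also have "\<dots> = (\<integral>y. g (x - y) \<bullet> v * h y \<partial>lborel)"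
      by (simp add: euclidean_inner[of _ v] sum_distrib_left sum_distrib_right mult_ac)
    finally show ?thesis .
  qed
  fix e :: real assume e: "e > 0"
  define e' where "e' = e / (N + 1)"
  have e': "e' > 0" "e' * N \<le> e" using e N by (simp_all add: e'_def field_simps)
  show "\<exists>d>0. \<forall>y. norm (y - x) < d \<longrightarrow> norm (conv f h y - conv f h x - ?G \<bullet> (y - x)) \<le> e * norm (y - x)"
  proof -
    obtain d where d: "d > 0" "\<And>x h. norm h < d \<Longrightarrow> \<bar>f (x + h) - f x - g x \<bullet> h\<bar> \<le> e' * norm h"
      using C1c_uniform[OF f e'(1)] by blast
    show ?thesis
    proof (intro exI[of _ d] conjI allI impI)
      fix y :: 'b assume y: "norm (y - x) < d"
      have "conv f h y - conv f h x - ?G \<bullet> (y - x) =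
        (\<integral>w. f (y - w) * h w - f (x - w) * h w - g (x - w) \<bullet> (y - x) * h w \<partial>lborel)"
        unfolding G using i1 i2 by (simp add: conv_def)
      also have "\<bar>\<dots>\<bar> \<le> (\<integral>w. (e' * norm (y - x)) * \<bar>h w\<bar> \<partial>lborel)"
      proof (rule integral_abs_bound_integral)
        fix w
        have "f (y - w) * h w - f (x - w) * h w - g (x - w) \<bullet> (y - x) * h w =
           (f ((x - w) + (y - x)) - f (x - w) - g (x - w) \<bullet> (y - x)) * h w"
          by (simp add: algebra_simps)
        also have "\<bar>\<dots>\<bar> \<le> (e' * norm (y - x)) * \<bar>h w\<bar>"
          unfolding abs_mult by (intro mult_right_mono d(2) y) simp
        finally show "\<bar>f (y - w) * h w - f (x - w) * h w - g (x - w) \<bullet> (y - x) * h w\<bar> \<le> (e' * norm (y - x)) * \<bar>h w\<bar>" .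
      qed (use i1 i2 ih in \<open>auto intro!: Bochner_Integration.integrable_diff\<close>)
      also have "\<dots> = e' * N * norm (y - x)" by (simp add: N_def)
      finally show "norm (conv f h y - conv f h x - ?G \<bullet> (y - x)) \<le> e * norm (y - x)"
        using mult_right_mono[OF e'(2), of "norm (y - x)"] by simp
    qed (use d in simp)
  qed
qed (rule bounded_linear_inner_right)

lemma partial_deriv_conv:
  assumes "C1c K f g" "continuous_on UNIV h" "compact L" "\<And>x. x \<notin> L \<Longrightarrow> h x = 0" "b \<in> Basis"
  shows "partial_deriv b (conv f h) x = conv (\<lambda>x. g x \<bullet> b) h x"
  using partial_deriv_eq[OF has_derivative_conv[OF assms(1-4)], of b x] assms(5) by simp

lemma continuous_on_conv:
  fixes f h :: "'b::euclidean_space \<Rightarrow> real"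
  assumes f: "continuous_on UNIV f" "compact K" "\<And>x. x \<notin> K \<Longrightarrow> f x = 0"
    and h: "continuous_on UNIV h" "compact L" "\<And>x. x \<notin> L \<Longrightarrow> h x = 0"
  shows "continuous_on UNIV (conv f h)"
proof -
  have ih: "integrable lborel (\<lambda>y. \<bar>h y\<bar>)"
    by (rule integrable_compact_support[where K = L])
      (use h in \<open>auto intro!: continuous_intros\<close>)
  define N where "N = (\<integral>y. \<bar>h y\<bar> \<partial>lborel)"
  have N: "N \<ge> 0" by (simp add: N_def)
  note i1 = integrable_conv[OF f(1) h]
  have "\<exists>d>0. \<forall>y. dist y x < d \<longrightarrow> dist (conv f h y) (conv f h x) < e" if e: "e > 0" for e x
  proof -
    define e' where "e' = e / (N + 1)"
    have e': "e' > 0" "e' * N < e" using e N by (simp_all add: e'_def field_simps)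
    have "uniformly_continuous_on UNIV f"
      by (rule uniformly_continuous_on_compact_support[OF f])
    then obtain d where d: "d > 0" "\<And>x y. dist x y < d \<Longrightarrow> dist (f x) (f y) < e'"
      unfolding uniformly_continuous_on_def using e'(1) by (metis UNIV_I)
    show ?thesis
    proof (intro exI[of _ d] conjI allI impI)
      fix y assume y: "dist y x < d"
      have "conv f h y - conv f h x = (\<integral>w. f (y - w) * h w - f (x - w) * h w \<partial>lborel)"
        unfolding conv_def using i1 by simp
      also have "\<bar>\<dots>\<bar> \<le> (\<integral>w. e' * \<bar>h w\<bar> \<partial>lborel)"
      proof (rule integral_abs_bound_integral)
        fix w
        have "\<bar>f (y - w) - f (x - w)\<bar> \<le> e'"
          using d(2)[of "y - w" "x - w"] y by (simp add: dist_norm less_imp_le)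
        then show "\<bar>f (y - w) * h w - f (x - w) * h w\<bar> \<le> e' * \<bar>h w\<bar>"
          by (simp add: abs_mult mult_right_mono flip: left_diff_distrib)
      qed (use i1 ih in \<open>auto intro!: Bochner_Integration.integrable_diff\<close>)
      also have "\<dots> = e' * N" by (simp add: N_def)
      finally show "dist (conv f h y) (conv f h x) < e" using e'(2) by (simp add: dist_norm)
    qed (use d in simp)
  qed
  then show ?thesis unfolding continuous_on_iff by simp
qed

text \<open>All derivatives are put on \<open>f\<close>, and none on \<open>h\<close>. The induction
  runs over every smooth \<open>f\<close> supported in \<open>K\<close>, because
  \<open>partial_deriv b f\<close> takes the place of \<open>f\<close>.\<close>

lemma Ck_on_conv:
  fixes f h :: "'b::euclidean_space \<Rightarrow> real"
  assumes f: "\<And>k. Ck_on k UNIV f" "compact K" "\<And>x. x \<notin> K \<Longrightarrow> f x = 0"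
    and h: "continuous_on UNIV h" "compact L" "\<And>x. x \<notin> L \<Longrightarrow> h x = 0"
  shows "Ck_on k UNIV (conv f h)"
  using f
proof (induction k arbitrary: f)
  case 0
  show ?case using continuous_on_conv[OF _ 0(2,3) h] 0(1)[of 0] by simp
next
  case (Suc k)
  have d: "f differentiable (at x)" and c: "Ck_on k UNIV (partial_deriv b f)" if "b \<in> Basis" for x b k
    using Suc.prems(1)[of "Suc k"] that by auto
  have pz: "grad f x = 0" if "x \<notin> K" for x
  proof (rule grad_eq)
    show "(f has_derivative (\<lambda>h. 0 \<bullet> h)) (at x)"
      by (rule has_derivative_transform_within_open[where f = "\<lambda>_. 0" and s = "- K"])
        (use that Suc.prems(2,3) compact_imp_closed in auto)
  qed
  have gc: "continuous_on UNIV (grad f)"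
    unfolding grad_def using c[of _ 0] by (auto intro!: continuous_intros)
  have C: "C1c K f (grad f)"
    unfolding C1c_def using Suc.prems pz gc has_derivative_grad[OF d] nonempty_Basis by blast
  have "partial_deriv b (conv f h) = conv (partial_deriv b f) h" if "b \<in> Basis" for b
    using partial_deriv_conv[OF C h that] that by (simp add: fun_eq_iff grad_inner_Basis)
  moreover have "Ck_on k UNIV (conv (partial_deriv b f) h)" if "b \<in> Basis" for b
  proof (rule Suc.IH)
    show "partial_deriv b f x = 0" if "x \<notin> K" for x
      using pz[OF that] \<open>b \<in> Basis\<close> by (simp flip: grad_inner_Basis)
  qed (use c[OF that] Suc.prems(2) in auto)
  ultimately show ?case
    using has_derivative_conv[OF C h] by (auto simp: differentiable_def)
qed

text \<open>As \<open>\<rho>\<close> is nonnegative with integral one, the difference is the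
  \<open>\<rho>\<close>-average of \<open>f (x - y) - f x\<close> over
  \<open>norm y \<le> r\<close>.\<close>

lemma abs_conv_diff_le:
  fixes f \<rho> :: "'b::euclidean_space \<Rightarrow> real"
  assumes f: "continuous_on UNIV f"
    and \<rho>: "continuous_on UNIV \<rho>" "\<And>x. \<rho> x \<ge> 0" "\<And>x. norm x > r \<Longrightarrow> \<rho> x = 0" "(\<integral>x. \<rho> x \<partial>lborel) = 1"
    and le: "\<And>y. norm y \<le> r \<Longrightarrow> \<bar>f (x - y) - f x\<bar> \<le> e"
  shows "\<bar>conv f \<rho> x - f x\<bar> \<le> e"
proof -
  have \<rho>z: "\<rho> y = 0" if "y \<notin> cball 0 r" for y using that \<rho>(3) by auto
  have i\<rho>: "integrable lborel \<rho>"
    by (rule integrable_compact_support[where K = "cball 0 r"]) (use \<rho>(1) \<rho>z in auto)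
  note i = integrable_conv[OF f \<rho>(1) compact_cball[of 0 r] \<rho>z]
  have "conv f \<rho> x - f x = (\<integral>y. f (x - y) * \<rho> y - f x * \<rho> y \<partial>lborel)"
    unfolding conv_def using i i\<rho> \<rho>(4) by simp
  also have "\<bar>\<dots>\<bar> \<le> (\<integral>y. e * \<rho> y \<partial>lborel)"
  proof (rule integral_abs_bound_integral)
    fix y
    show "\<bar>f (x - y) * \<rho> y - f x * \<rho> y\<bar> \<le> e * \<rho> y"
    proof (cases "norm y \<le> r")
      case True
      then show ?thesis using le[of y] \<rho>(2)[of y]
        by (simp add: abs_mult mult_right_mono flip: left_diff_distrib)
    qed (use \<rho>(3) in simp)
  qed (use i i\<rho> in \<open>auto intro!: Bochner_Integration.integrable_diff\<close>)
  also have "\<dots> = e" using \<rho>(4) by simp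
  finally show ?thesis .
qed

text \<open>The factors of a convolution may be exchanged: derivatives on \<open>\<rho>\<close> show
  that it is smooth, derivatives on \<open>f\<close> show that its gradient is close to
  \<open>g\<close>. The set \<open>K'\<close> is fixed before \<open>e\<close>, so that uniform
  errors become errors of integrals over one compact set.\<close>

lemma mollification:
  fixes f :: "'b::euclidean_space \<Rightarrow> real"
  assumes f: "C1c K f g" and S: "open S" "K \<subseteq> S"
  obtains K' where "compact K'" "K \<subseteq> K'" "K' \<subseteq> S"
    "\<And>e. e > 0 \<Longrightarrow> \<exists>\<psi>. test_function S \<psi> \<and> (\<forall>x. x \<notin> K' \<longrightarrow> \<psi> x = 0) \<and>
       (\<forall>x. \<bar>\<psi> x - f x\<bar> \<le> e) \<and> (\<forall>x. norm (grad \<psi> x - g x) \<le> e) \<and> continuous_on UNIV (grad \<psi>) \<and>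
       (\<forall>x. (\<psi> has_derivative (\<lambda>h. grad \<psi> x \<bullet> h)) (at x))"
proof -
  have K: "compact K" and gc: "continuous_on UNIV g" and z: "\<And>x. x \<notin> K \<Longrightarrow> f x = 0" "\<And>x. x \<notin> K \<Longrightarrow> g x = 0"
    using f unfolding C1c_def by auto
  note fc = C1c_continuous[OF f]
  obtain R where R: "R > 0" "{x + y |x y. x \<in> K \<and> y \<in> cball 0 R} \<subseteq> S"
  proof -
    obtain R where "R > 0" "(\<Union>x\<in>K. cball x R) \<subseteq> S"
      using compact_subset_open_imp_cball_epsilon_subset[OF K S] by blast
    then show thesis by (intro that[of R]) (fastforce simp: subset_iff dist_norm)+
  qed
  define K' where "K' = {x + y |x y. x \<in> K \<and> y \<in> cball 0 R}"
  have K': "compact K'" unfolding K'_def by (intro compact_sums K compact_cball)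
  have KK': "K \<subseteq> K'" unfolding K'_def using R(1) by force
  have uf: "uniformly_continuous_on UNIV f"
    by (rule uniformly_continuous_on_compact_support[OF fc K z(1)])
  have ug: "uniformly_continuous_on UNIV g"
    by (rule uniformly_continuous_on_compact_support[OF gc K z(2)])
  have "\<exists>\<psi>. test_function S \<psi> \<and> (\<forall>x. x \<notin> K' \<longrightarrow> \<psi> x = 0) \<and>
       (\<forall>x. \<bar>\<psi> x - f x\<bar> \<le> e) \<and> (\<forall>x. norm (grad \<psi> x - g x) \<le> e) \<and> continuous_on UNIV (grad \<psi>) \<and>
       (\<forall>x. (\<psi> has_derivative (\<lambda>h. grad \<psi> x \<bullet> h)) (at x))"
    if e: "e > 0" for e
  proof -
    \<comment> \<open>The gradient is estimated coordinate by coordinate, and the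
      \<open>DIM('b)\<close> errors add up to \<open>e\<close>.\<close>
    define e' where "e' = e / DIM('b)"
    have e': "e' > 0" using e by (simp add: e'_def)
    obtain d1 where d1: "d1 > 0" "\<And>x y. dist x y < d1 \<Longrightarrow> dist (f x) (f y) < e"
      using uf e unfolding uniformly_continuous_on_def by (metis UNIV_I)
    obtain d2 where d2: "d2 > 0" "\<And>x y. dist x y < d2 \<Longrightarrow> dist (g x) (g y) < e'"
      using ug e' unfolding uniformly_continuous_on_def by (metis UNIV_I)
    define r where "r = Min {R, d1 / 2, d2 / 2}"
    have r: "r > 0" "r \<le> R" "r < d1" "r < d2" using R d1 d2 by (auto simp: r_def)
    obtain \<rho> :: "'b \<Rightarrow> real" where \<rho>: "\<And>k. Ck_on k UNIV \<rho>" "\<And>x. \<rho> x \<ge> 0" "\<And>x. norm x > r \<Longrightarrow> \<rho> x = 0"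
      "(\<integral>x. \<rho> x \<partial>lborel) = 1" using exists_mollifier[OF r(1)] by blast
    have \<rho>c: "continuous_on UNIV \<rho>" using \<rho>(1)[of 0] by simp
    have \<rho>z: "\<rho> y = 0" if "y \<notin> cball 0 r" for y using that \<rho>(3) by auto
    let ?\<psi> = "conv f \<rho>"
    have "?\<psi> = conv \<rho> f"
      by (rule conv_commute) (use fc \<rho>c in \<open>auto intro: borel_measurable_continuous_onI\<close>)
    then have Ck: "Ck_on k UNIV ?\<psi>" for k
      using Ck_on_conv[OF \<rho>(1) compact_cball[of 0 r] \<rho>z fc K z(1)] by simp
    have nz: "?\<psi> x = 0" if "x \<notin> K'" for x
    proof -
      have "f (x - y) * \<rho> y = 0" for y
      proof (cases "norm y \<le> r")
        case True
        then have "x - y \<notin> K"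
          using that r(2) unfolding K'_def by (force simp: algebra_simps)
        then show ?thesis using z by simp
      qed (use \<rho>(3) in simp)
      then have "(\<lambda>y. f (x - y) * \<rho> y) = (\<lambda>y. 0)" by (rule ext)
      then show ?thesis unfolding conv_def by (simp del: mult_eq_0_iff)
    qed
    have sub: "closure {x. ?\<psi> x \<noteq> 0} \<subseteq> K'"
      by (rule closure_minimal) (use nz compact_imp_closed[OF K'] in auto)
    have "compact (closure {x. ?\<psi> x \<noteq> 0})"
      unfolding compact_closure
      by (rule bounded_subset[OF compact_imp_bounded[OF K']]) (use nz in auto)
    moreover have "closure {x. ?\<psi> x \<noteq> 0} \<subseteq> S" using sub R(2) K'_def by blast
    ultimately have test: "test_function S ?\<psi>"
      unfolding test_function_def using Ck by blast
    note D = has_derivative_conv[OF f \<rho>c compact_cball[of 0 r] \<rho>z]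
    have D': "(?\<psi> has_derivative (\<lambda>h. grad ?\<psi> x \<bullet> h)) (at x)" for x
      by (rule has_derivative_grad) (use D in \<open>auto simp: differentiable_def\<close>)
    have gradc: "continuous_on UNIV (grad ?\<psi>)"
      unfolding grad_def using Ck[of 1] by (auto intro!: continuous_intros)
    have n1: "\<bar>?\<psi> x - f x\<bar> \<le> e" for x
    proof (rule abs_conv_diff_le[OF fc \<rho>c \<rho>(2-4)])
      fix y :: 'b assume "norm y \<le> r"
      then have "dist (x - y) x < d1" using r by (simp add: dist_norm)
      then show "\<bar>f (x - y) - f x\<bar> \<le> e" using d1(2) by (fastforce simp: dist_norm)
    qed
    have n2: "\<bar>(grad ?\<psi> x - g x) \<bullet> b\<bar> \<le> e'" if b: "b \<in> Basis" for x b
    proof -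
      have "\<bar>conv (\<lambda>x. g x \<bullet> b) \<rho> x - g x \<bullet> b\<bar> \<le> e'"
      proof (rule abs_conv_diff_le[OF _ \<rho>c \<rho>(2-4)])
        fix y :: 'b assume "norm y \<le> r"
        then have "dist (x - y) x < d2" using r by (simp add: dist_norm)
        then have "norm (g (x - y) - g x) < e'" using d2(2) by (fastforce simp: dist_norm)
        then show "\<bar>g (x - y) \<bullet> b - g x \<bullet> b\<bar> \<le> e'"
          using Basis_le_norm[OF b, of "g (x - y) - g x"] by (simp add: inner_diff_left)
      qed (auto intro!: continuous_intros gc)
      then show ?thesis
        using partial_deriv_conv[OF f \<rho>c compact_cball[of 0 r] \<rho>z b] b
        by (simp add: inner_diff_left grad_inner_Basis)
    qed
    have n3: "norm (grad ?\<psi> x - g x) \<le> e" for x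
    proof -
      have "norm (grad ?\<psi> x - g x) \<le> (\<Sum>b\<in>Basis. \<bar>(grad ?\<psi> x - g x) \<bullet> b\<bar>)" by (rule norm_le_l1)
      also have "\<dots> \<le> (\<Sum>b\<in>(Basis::'b set). e')" by (intro sum_mono n2)
      also have "\<dots> = e" by (simp add: e'_def)
      finally show ?thesis .
    qed
    show ?thesis using test nz n1 n3 D' gradc by blast
  qed
  moreover have "K' \<subseteq> S" using R(2) K'_def by blast
  ultimately show thesis using that[OF K' KK'] by blast
qed

section \<open>Extension by zero and test functions\<close>

lemma C1cD:
  assumes "C1c K f g"
  shows "compact K" "closed K" "(f has_derivative (\<lambda>h. g x \<bullet> h)) (at x)" "continuous_on UNIV g"
    "continuous_on UNIV f" "x \<notin> K \<Longrightarrow> f x = 0" "x \<notin> K \<Longrightarrow> g x = 0"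
  using assms C1c_continuous[OF assms] compact_imp_closed unfolding C1c_def by blast+

text \<open>Functions are total, with arbitrary values outside the set of interest. Cutting them off
  to zero lets all integrals be taken against \<open>lborel\<close> on the whole space, where
  translations are available.\<close>

definition ext :: "'a set \<Rightarrow> ('a \<Rightarrow> 'b::real_normed_vector) \<Rightarrow> 'a \<Rightarrow> 'b" where
  "ext S f x = (if x \<in> S then f x else 0)"

lemma ext_in [simp]: "x \<in> S \<Longrightarrow> ext S f x = f x"
  and ext_notin [simp]: "x \<notin> S \<Longrightarrow> ext S f x = 0"
  by (simp_all add: ext_def)

lemma ext_UNIV [simp]: "ext UNIV f = f"
  by (simp add: ext_def fun_eq_iff)

text \<open>\<open>S \<inter> X\<close> and \<open>X - K\<close> are relatively open and cover
  \<open>X\<close>, as \<open>K\<close> lies in \<open>S\<close>; on the first the extension is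
  \<open>f\<close>, on the second it is zero. The set \<open>X\<close> leaves room for restricting a
  further variable such as time.\<close>

lemma continuous_on_ext:
  assumes S: "open S" "closed K" "K \<subseteq> S" and f: "continuous_on (S \<inter> X) f"
    and z: "\<And>x. x \<in> S \<Longrightarrow> x \<in> X \<Longrightarrow> x \<notin> K \<Longrightarrow> f x = 0"
  shows "continuous_on X (ext S f)"
proof -
  have "continuous_on ((S \<inter> X) \<union> (X - K)) (ext S f)"
  proof (rule continuous_on_Un_local_open)
    have eq: "S \<inter> X \<union> (X - K) = X" using S(3) by auto
    show "openin (top_of_set (S \<inter> X \<union> (X - K))) (S \<inter> X)"
      unfolding eq using S(1) by (metis inf_commute openin_open_Int)
    show "openin (top_of_set (S \<inter> X \<union> (X - K))) (X - K)"
      unfolding eq using S(2) by (metis Diff_eq open_Compl openin_open_Int)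
    show "continuous_on (S \<inter> X) (ext S f)"
      using f by (rule continuous_on_eq) simp
    show "continuous_on (X - K) (ext S f)"
      by (rule continuous_on_eq[OF continuous_on_const[of _ 0]]) (use z in \<open>auto simp: ext_def\<close>)
  qed
  moreover have "S \<inter> X \<union> (X - K) = X" using S(3) by auto
  ultimately show ?thesis by simp
qed

lemma C1c_ext:
  fixes f :: "'b::euclidean_space \<Rightarrow> real"
  assumes S: "open S" "compact K" "K \<subseteq> S"
    and D: "\<And>x. x \<in> S \<Longrightarrow> (f has_derivative (\<lambda>h. g x \<bullet> h)) (at x)"
    and g: "continuous_on S g" and z: "\<And>x. x \<in> S \<Longrightarrow> x \<notin> K \<Longrightarrow> f x = 0"
  shows "C1c K (ext S f) (ext S g)"
proof -
  have cK: "closed K" using S(2) compact_imp_closed by blast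
  \<comment> \<open>Off \<open>K\<close> the function vanishes on an open set, and gradients are
    unique.\<close>
  have gz: "g x = 0" if "x \<in> S" "x \<notin> K" for x
  proof -
    have "(f has_derivative (\<lambda>h. 0 \<bullet> h)) (at x)"
      by (rule has_derivative_transform_within_open[where f = "\<lambda>_. 0" and s = "S - K"])
        (use that z S cK in \<open>auto intro: open_Diff\<close>)
    then show ?thesis using grad_eq[OF D[OF that(1)]] grad_eq by metis
  qed
  have gc: "continuous_on UNIV (ext S g)"
    by (rule continuous_on_ext[OF S(1) cK S(3)]) (use g gz in auto)
  have "(ext S f has_derivative (\<lambda>h. ext S g x \<bullet> h)) (at x)" for x
  proof (cases "x \<in> S")
    case True
    show ?thesis
      by (rule has_derivative_transform_within_open[where f = f and s = S]) (use True S D in auto)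
  next
    case False
    show ?thesis
      by (rule has_derivative_transform_within_open[where f = "\<lambda>_. 0" and s = "- K"])
        (use False S cK z in \<open>auto simp: ext_def\<close>)
  qed
  then show ?thesis unfolding C1c_def using S gc z gz by (auto simp: ext_def)
qed

text \<open>Localises integration by parts: \<open>f\<close> is known on \<open>S\<close> only, but
  its product with a compactly supported \<open>h\<close> is an admissible argument of
  \<open>integral_partial_deriv_eq_0\<close> on the whole space.\<close>

lemma C1c_mult_ext:
  fixes f :: "'b::euclidean_space \<Rightarrow> real"
  assumes S: "open S" "K \<subseteq> S" and h: "C1c K h h'"
    and D: "\<And>x. x \<in> S \<Longrightarrow> (f has_derivative (\<lambda>v. f' x \<bullet> v)) (at x)"
    and f': "continuous_on S f'"
  shows "C1c K (ext S (\<lambda>x. f x * h x)) (ext S (\<lambda>x. f x *\<^sub>R h' x + h x *\<^sub>R f' x))"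
proof (rule C1c_ext[OF S(1) _ S(2)])
  note hD = C1cD(3)[OF h]
  show "((\<lambda>x. f x * h x) has_derivative (\<lambda>v. (f x *\<^sub>R h' x + h x *\<^sub>R f' x) \<bullet> v)) (at x)" if "x \<in> S" for x
    using has_derivative_mult[OF D[OF that] hD] by (simp add: inner_add_left mult.commute)
  have "continuous_on S f"
    using D by (meson continuous_at_imp_continuous_on has_derivative_continuous)
  then show "continuous_on S (\<lambda>x. f x *\<^sub>R h' x + h x *\<^sub>R f' x)"
    using C1cD(4,5)[OF h] f'
    by (intro continuous_intros) (auto elim: continuous_on_subset)
qed (simp_all add: C1cD[OF h])

lemma test_function_C1c:
  assumes "test_function S \<psi>"
  shows "C1c (closure {x. \<psi> x \<noteq> 0}) \<psi> (grad \<psi>)"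
proof -
  have Ck: "Ck_on k UNIV \<psi>" and K: "compact (closure {x. \<psi> x \<noteq> 0})" for k
    using assms unfolding test_function_def by auto
  have "C1c (closure {x. \<psi> x \<noteq> 0}) (ext UNIV \<psi>) (ext UNIV (grad \<psi>))"
  proof (rule C1c_ext[OF _ K])
    show "(\<psi> has_derivative (\<lambda>h. grad \<psi> x \<bullet> h)) (at x)" for x
      by (rule has_derivative_grad) (use Ck[of 1] in auto)
    show "continuous_on UNIV (grad \<psi>)"
      unfolding grad_def using Ck[of 1] by (auto intro!: continuous_intros)
    show "\<psi> x = 0" if "x \<notin> closure {x. \<psi> x \<noteq> 0}" for x
      using that closure_subset[of "{x. \<psi> x \<noteq> 0}"] by auto
  qed auto
  then show ?thesis by simp
qed

lemma integral_lebesgue_on: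
  fixes f :: "'b::euclidean_space \<Rightarrow> real"
  assumes "S \<in> sets borel" "ext S f \<in> borel_measurable borel"
  shows "(\<integral>x. f x \<partial>lebesgue_on S) = (\<integral>x. ext S f x \<partial>lborel)"
proof -
  have "(\<integral>x. f x \<partial>lebesgue_on S) = (\<integral>x. indicator S x *\<^sub>R f x \<partial>lebesgue)"
    by (rule integral_restrict_space) (use assms(1) in auto)
  also have "(\<lambda>x. indicator S x *\<^sub>R f x) = ext S f" by (auto simp: ext_def indicator_def)
  also have "(\<integral>x. ext S f x \<partial>lebesgue) = (\<integral>x. ext S f x \<partial>lborel)"
    by (rule integral_completion) (use assms(2) in simp)
  finally show ?thesis .
qed

lemma integrable_lebesgue_on:
  fixes f :: "'b::euclidean_space \<Rightarrow> real"
  assumes "S \<in> sets borel" "integrable lborel (ext S f)"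
  shows "integrable (lebesgue_on S) f"
proof -
  have "(\<lambda>x. indicator S x *\<^sub>R f x) = ext S f" by (auto simp: ext_def indicator_def)
  moreover have "integrable lebesgue (ext S f)"
    using assms(2) by (simp add: integrable_completion borel_measurable_integrable)
  ultimately show ?thesis
    using assms(1) by (subst integrable_restrict_space) auto
qed

text \<open>Replacing \<open>f\<close> by a mollification costs at most \<open>e\<close> times the
  integral \<open>M\<close> of \<open>\<bar>a z\<bar> + norm (B z)\<close> over the fixed compact
  \<open>K'\<close>. The coefficients may be unbounded towards the frontier of \<open>S\<close>,
  which is why all approximations have to live on one \<open>K'\<close>.\<close>

lemma integral_ext_C1c_limit:
  fixes a :: "'b::euclidean_space \<Rightarrow> real" and B :: "'b \<Rightarrow> 'b"
  assumes S: "open S" and a: "continuous_on S a" and B: "continuous_on S B"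
    and test: "\<And>\<psi>. test_function S \<psi> \<Longrightarrow> (\<integral>z. ext S (\<lambda>z. a z * \<psi> z + B z \<bullet> grad \<psi> z) z \<partial>lborel) = 0"
    and f: "C1c K f g" "K \<subseteq> S"
  shows "(\<integral>z. ext S (\<lambda>z. a z * f z + B z \<bullet> g z) z \<partial>lborel) = 0"
proof -
  obtain K' where K': "compact K'" "K \<subseteq> K'" "K' \<subseteq> S"
    and \<psi>: "\<And>e. e > 0 \<Longrightarrow> \<exists>\<psi>. test_function S \<psi> \<and> (\<forall>x. x \<notin> K' \<longrightarrow> \<psi> x = 0) \<and>
       (\<forall>x. \<bar>\<psi> x - f x\<bar> \<le> e) \<and> (\<forall>x. norm (grad \<psi> x - g x) \<le> e) \<and> continuous_on UNIV (grad \<psi>) \<and>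
       (\<forall>x. (\<psi> has_derivative (\<lambda>h. grad \<psi> x \<bullet> h)) (at x))"
    by (rule mollification[OF f(1) S f(2)]) blast
  have cK': "closed K'" using K'(1) compact_imp_closed by blast
  have "continuous_on K' (\<lambda>z. \<bar>a z\<bar> + norm (B z))"
    using a B K'(3) by (intro continuous_intros) (auto elim: continuous_on_subset)
  then have iM: "integrable lborel (\<lambda>z. indicator K' z *\<^sub>R (\<bar>a z\<bar> + norm (B z)))"
    by (rule borel_integrable_compact[OF K'(1)])
  define M where "M = (\<integral>z. indicator K' z *\<^sub>R (\<bar>a z\<bar> + norm (B z)) \<partial>lborel)"
  have M: "M \<ge> 0" by (simp add: M_def)
  have int: "integrable lborel (ext S (\<lambda>z. a z * h z + B z \<bullet> h' z))"
    if h: "continuous_on UNIV h" "continuous_on UNIV h'" and z: "\<And>z. z \<notin> K' \<Longrightarrow> h z = 0 \<and> h' z = 0"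
    for h :: "'b \<Rightarrow> real" and h'
  proof (rule integrable_compact_support[OF _ K'(1)])
    show "continuous_on UNIV (ext S (\<lambda>z. a z * h z + B z \<bullet> h' z))"
    proof (rule continuous_on_ext[OF S cK' K'(3)])
      show "continuous_on (S \<inter> UNIV) (\<lambda>z. a z * h z + B z \<bullet> h' z)"
        using a B h by (intro continuous_intros) (auto elim: continuous_on_subset)
    qed (use z in auto)
  qed (use z in \<open>auto simp: ext_def\<close>)
  let ?I = "\<integral>z. ext S (\<lambda>z. a z * f z + B z \<bullet> g z) z \<partial>lborel"
  have bnd: "\<bar>?I\<bar> \<le> e * M" if e: "e > 0" for e
  proof -
    obtain \<psi> where \<psi>: "test_function S \<psi>" "\<And>x. x \<notin> K' \<Longrightarrow> \<psi> x = 0" "\<And>x. \<bar>\<psi> x - f x\<bar> \<le> e"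
      "\<And>x. norm (grad \<psi> x - g x) \<le> e" "continuous_on UNIV (grad \<psi>)"
      "\<And>x. (\<psi> has_derivative (\<lambda>h. grad \<psi> x \<bullet> h)) (at x)"
      using \<psi>[OF e] by blast
    have gz: "grad \<psi> x = 0" if "x \<notin> K'" for x
    proof (rule grad_eq)
      show "(\<psi> has_derivative (\<lambda>h. 0 \<bullet> h)) (at x)"
        by (rule has_derivative_transform_within_open[where f = "\<lambda>_. 0" and s = "- K'"])
          (use that \<psi>(2) cK' in auto)
    qed
    have c\<psi>: "continuous_on UNIV \<psi>" using C1c_continuous[OF test_function_C1c[OF \<psi>(1)]] .
    have i1: "integrable lborel (ext S (\<lambda>z. a z * \<psi> z + B z \<bullet> grad \<psi> z))"
      by (rule int) (use c\<psi> \<psi> gz in auto)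
    have i2: "integrable lborel (ext S (\<lambda>z. a z * f z + B z \<bullet> g z))"
      by (rule int) (use f C1c_continuous[OF f(1)] K' in \<open>auto simp: C1c_def\<close>)
    have "?I = (\<integral>z. ext S (\<lambda>z. a z * f z + B z \<bullet> g z) z - ext S (\<lambda>z. a z * \<psi> z + B z \<bullet> grad \<psi> z) z \<partial>lborel)"
      using test[OF \<psi>(1)] i1 i2 by simp
    also have "\<bar>\<dots>\<bar> \<le> (\<integral>z. e * (indicator K' z *\<^sub>R (\<bar>a z\<bar> + norm (B z))) \<partial>lborel)"
    proof (rule integral_abs_bound_integral)
      fix z
      show "\<bar>ext S (\<lambda>z. a z * f z + B z \<bullet> g z) z - ext S (\<lambda>z. a z * \<psi> z + B z \<bullet> grad \<psi> z) z\<bar>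
          \<le> e * (indicator K' z *\<^sub>R (\<bar>a z\<bar> + norm (B z)))"
      proof (cases "z \<in> K'")
        case True
        then have z: "z \<in> S" using K' by auto
        have "ext S (\<lambda>z. a z * f z + B z \<bullet> g z) z - ext S (\<lambda>z. a z * \<psi> z + B z \<bullet> grad \<psi> z) z
            = a z * (f z - \<psi> z) + B z \<bullet> (g z - grad \<psi> z)"
          using z by (simp add: algebra_simps inner_diff_right)
        also have "\<bar>\<dots>\<bar> \<le> \<bar>a z\<bar> * e + norm (B z) * e"
        proof (rule order_trans[OF abs_triangle_ineq add_mono])
          show "\<bar>a z * (f z - \<psi> z)\<bar> \<le> \<bar>a z\<bar> * e"
            unfolding abs_mult using \<psi>(3)[of z] by (intro mult_left_mono) (auto simp: abs_minus_commute)
          show "\<bar>B z \<bullet> (g z - grad \<psi> z)\<bar> \<le> norm (B z) * e"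
            using \<psi>(4)[of z] by (intro order_trans[OF Cauchy_Schwarz_ineq2] mult_left_mono) (auto simp: norm_minus_commute)
        qed
        finally show ?thesis using True by (simp add: algebra_simps)
      next
        case False
        then show ?thesis using \<psi>(2)[of z] gz[of z] f(1) K'(2) by (auto simp: ext_def C1c_def)
      qed
    qed (use i1 i2 iM in \<open>auto intro!: Bochner_Integration.integrable_diff\<close>)
    also have "\<dots> = e * M" by (simp add: M_def)
    finally show ?thesis .
  qed
  show ?thesis
  proof (rule ccontr)
    assume "?I \<noteq> 0"
    then have I: "\<bar>?I\<bar> > 0" by simp
    have "\<bar>?I\<bar> * (M + 1) \<le> \<bar>?I\<bar> * M"
      using bnd[of "\<bar>?I\<bar> / (M + 1)"] I M by (simp add: field_simps)
    then show False using I by (simp add: algebra_simps)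
  qed
qed

lemma continuous_on_norm_powr:
  assumes "continuous_on X h" "(p::real) > 0"
  shows "continuous_on X (\<lambda>x. norm (h x) powr p)"
  by (rule continuous_on_powr') (use assms in \<open>auto intro!: continuous_intros\<close>)

lemma integrable_ext_norm_powr:
  fixes h :: "'b::euclidean_space \<Rightarrow> 'c::euclidean_space"
  assumes "open S" "compact K" "K \<subseteq> S" "continuous_on UNIV h" "\<And>x. x \<notin> K \<Longrightarrow> h x = 0" "(p::real) > 0"
  shows "integrable lborel (ext S (\<lambda>x. norm (h x) powr p))"
proof (rule integrable_compact_support[OF continuous_on_ext[OF assms(1) _ assms(3)] assms(2)])
  show "continuous_on (S \<inter> UNIV) (\<lambda>x. norm (h x) powr p)"
    by (rule continuous_on_norm_powr[OF continuous_on_subset[OF assms(4)] assms(6)]) simp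
  show "closed K" using assms(2) compact_imp_closed by blast
qed (use assms(5,6) in \<open>auto simp: ext_def\<close>)

lemma Lp_compact_support:
  fixes h :: "'b::euclidean_space \<Rightarrow> 'c::euclidean_space"
  assumes "open S" "compact K" "K \<subseteq> S" "continuous_on UNIV h" "\<And>x. x \<notin> K \<Longrightarrow> h x = 0" "p > 0"
  shows "Lp S p h"
  unfolding Lp_def
proof
  have "h \<in> borel_measurable lborel"
    using borel_measurable_continuous_onI[OF assms(4)] by simp
  then have "h \<in> borel_measurable lebesgue" by (rule measurable_completion)
  then show "h \<in> borel_measurable (lebesgue_on S)" by (rule measurable_restrict_space1)
  show "integrable (lebesgue_on S) (\<lambda>x. norm (h x) powr p)"
    by (rule integrable_lebesgue_on[OF _ integrable_ext_norm_powr[OF assms]]) (use assms(1) in simp)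
qed

lemma integral_norm_powr_le:
  fixes h :: "'b::euclidean_space \<Rightarrow> 'c::euclidean_space"
  assumes S: "open S" "compact K" "K \<subseteq> S" "continuous_on UNIV h" "\<And>x. x \<notin> K \<Longrightarrow> h x = 0" "p > 0"
    and le: "\<And>x. norm (h x) \<le> e"
  shows "(\<integral>x. norm (h x) powr p \<partial>(lebesgue_on S)) \<le> e powr p * measure lborel K"
proof -
  note i = integrable_ext_norm_powr[OF S]
  have "(\<integral>x. norm (h x) powr p \<partial>(lebesgue_on S)) = (\<integral>x. ext S (\<lambda>x. norm (h x) powr p) x \<partial>lborel)"
    by (rule integral_lebesgue_on) (use S(1) borel_measurable_integrable[OF i] in simp_all)
  also have "\<dots> \<le> (\<integral>x. indicator K x * e powr p \<partial>lborel)"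
  proof (rule Bochner_Integration.integral_mono[OF i])
    show "integrable lborel (\<lambda>x. indicator K x * e powr p)"
      using S(2) by (intro integrable_mult_left integrable_real_indicator emeasure_bounded_finite compact_imp_bounded)
        (simp add: borel_compact)
    show "ext S (\<lambda>x. norm (h x) powr p) x \<le> indicator K x * e powr p" for x
    proof (cases "x \<in> K")
      case True
      then show ?thesis using S(3) le[of x] S(6) by (auto simp: ext_def intro!: powr_mono2)
    qed (use S(5) in \<open>simp add: ext_def\<close>)
  qed
  also have "\<dots> = e powr p * measure lborel K" by simp
  finally show ?thesis .
qed

text \<open>Makes the assumed Poincare type inequality applicable to C^1 functions of compact
  support. Mollifications with uniform error 1/(k+1) converge in the Sobolev norm, since all of them
  are supported in one compact \<open>K'\<close> of finite measure.\<close>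

lemma C1c_sobolev0:
  fixes f :: "'b::euclidean_space \<Rightarrow> real"
  assumes S: "open S" "K \<subseteq> S" and f: "C1c K f g" and p: "p > 1"
  shows "sobolev0 S p f g"
proof -
  have K: "compact K" and gc: "continuous_on UNIV g" and z: "\<And>x. x \<notin> K \<Longrightarrow> f x = 0" "\<And>x. x \<notin> K \<Longrightarrow> g x = 0"
    using C1cD[OF f] by blast+
  note fc = C1c_continuous[OF f]
  have Sb: "S \<in> sets borel" using S by auto
  have wg: "weak_gradient S f g"
    unfolding weak_gradient_def
  proof (intro allI impI ballI)
    fix \<psi> and b :: 'b assume \<psi>: "test_function S \<psi>" and b: "b \<in> Basis"
    note C = test_function_C1c[OF \<psi>]
    note \<psi>c = C1cD(4,5)[OF C]
    have "C1c K (ext UNIV (\<lambda>x. \<psi> x * f x)) (ext UNIV (\<lambda>x. \<psi> x *\<^sub>R g x + f x *\<^sub>R grad \<psi> x))"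
      by (rule C1c_mult_ext[OF open_UNIV subset_UNIV f C1cD(3)[OF C] C1cD(4)[OF C]])
    from integral_partial_deriv_eq_0[OF this, of b]
    have 0: "(\<integral>x. \<psi> x * (g x \<bullet> b) + f x * (grad \<psi> x \<bullet> b) \<partial>lborel) = 0"
      by (simp add: inner_add_left)
    have i1: "integrable lborel (\<lambda>x. \<psi> x * (g x \<bullet> b))"
      by (rule integrable_compact_support[OF _ K]) (use z \<psi>c gc in \<open>auto intro!: continuous_intros\<close>)
    have i2: "integrable lborel (\<lambda>x. f x * (grad \<psi> x \<bullet> b))"
      by (rule integrable_compact_support[OF _ K]) (use z \<psi>c fc in \<open>auto intro!: continuous_intros\<close>)
    have e1: "ext S (\<lambda>x. (g x \<bullet> b) * \<psi> x) = (\<lambda>x. \<psi> x * (g x \<bullet> b))"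
      using S(2) z by (fastforce simp: ext_def)
    have e2: "ext S (\<lambda>x. f x * partial_deriv b \<psi> x) = (\<lambda>x. f x * (grad \<psi> x \<bullet> b))"
      using S(2) z b by (fastforce simp: ext_def grad_inner_Basis)
    have "(\<integral>x. (g x \<bullet> b) * \<psi> x \<partial>(lebesgue_on S)) = (\<integral>x. \<psi> x * (g x \<bullet> b) \<partial>lborel)"
      using borel_measurable_integrable[OF i1] by (subst integral_lebesgue_on[OF Sb]) (simp_all add: e1)
    moreover have "(\<integral>x. f x * partial_deriv b \<psi> x \<partial>(lebesgue_on S)) = (\<integral>x. f x * (grad \<psi> x \<bullet> b) \<partial>lborel)"
      using borel_measurable_integrable[OF i2] by (subst integral_lebesgue_on[OF Sb]) (simp_all add: e2)
    ultimately show "(\<integral>x. f x * partial_deriv b \<psi> x \<partial>(lebesgue_on S)) = - (\<integral>x. (g x \<bullet> b) * \<psi> x \<partial>(lebesgue_on S))"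
      using 0 i1 i2 by simp
  qed
  obtain K' where K': "compact K'" "K \<subseteq> K'" "K' \<subseteq> S"
    and ex: "\<And>e. e > 0 \<Longrightarrow> \<exists>\<psi>. test_function S \<psi> \<and> (\<forall>x. x \<notin> K' \<longrightarrow> \<psi> x = 0) \<and>
       (\<forall>x. \<bar>\<psi> x - f x\<bar> \<le> e) \<and> (\<forall>x. norm (grad \<psi> x - g x) \<le> e) \<and> continuous_on UNIV (grad \<psi>) \<and>
       (\<forall>x. (\<psi> has_derivative (\<lambda>h. grad \<psi> x \<bullet> h)) (at x))"
    by (rule mollification[OF f S]) blast
  have cK': "closed K'" using K'(1) compact_imp_closed by blast
  define V where "V = measure lborel K'"
  define ee where "ee k = inverse (real (Suc k))" for k
  have ee: "ee k > 0" for k by (simp add: ee_def)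
  obtain \<psi> where \<psi>: "\<And>k. test_function S (\<psi> k)" "\<And>k x. x \<notin> K' \<Longrightarrow> \<psi> k x = 0"
    "\<And>k x. \<bar>\<psi> k x - f x\<bar> \<le> ee k" "\<And>k x. norm (grad (\<psi> k) x - g x) \<le> ee k" "\<And>k. continuous_on UNIV (grad (\<psi> k))"
  proof -
    have "\<forall>k. \<exists>\<psi>. test_function S \<psi> \<and> (\<forall>x. x \<notin> K' \<longrightarrow> \<psi> x = 0) \<and>
       (\<forall>x. \<bar>\<psi> x - f x\<bar> \<le> ee k) \<and> (\<forall>x. norm (grad \<psi> x - g x) \<le> ee k) \<and> continuous_on UNIV (grad \<psi>)"
      using ex[OF ee] by blast
    from choice[OF this] show thesis using that by blast
  qed
  have gz: "grad (\<psi> k) x = 0" if "x \<notin> K'" for x k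
  proof (rule grad_eq)
    show "(\<psi> k has_derivative (\<lambda>h. 0 \<bullet> h)) (at x)"
      by (rule has_derivative_transform_within_open[where f = "\<lambda>_. 0" and s = "- K'"])
        (use that \<psi>(2) cK' in auto)
  qed
  have \<psi>c: "continuous_on UNIV (\<psi> k)" for k using C1c_continuous[OF test_function_C1c[OF \<psi>(1)]] .
  have s1: "(\<integral>x. \<bar>\<psi> k x - f x\<bar> powr p \<partial>(lebesgue_on S)) \<le> ee k powr p * V" for k
    unfolding real_norm_def[symmetric] V_def
  proof (rule integral_norm_powr_le[OF S(1) K'(1,3)])
    show "\<psi> k x - f x = 0" if "x \<notin> K'" for x using that \<psi>(2) z(1) K'(2) by auto
  qed (use \<psi>(3) \<psi>c fc p in \<open>auto intro!: continuous_intros\<close>)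
  have s2: "(\<integral>x. norm (grad (\<psi> k) x - g x) powr p \<partial>(lebesgue_on S)) \<le> ee k powr p * V" for k
    unfolding V_def
  proof (rule integral_norm_powr_le[OF S(1) K'(1,3)])
    show "grad (\<psi> k) x - g x = 0" if "x \<notin> K'" for x using that gz z(2) K'(2) by auto
  qed (use \<psi>(4,5) gc p in \<open>auto intro!: continuous_intros\<close>)
  have "ee \<longlonglongrightarrow> 0" unfolding ee_def by (rule LIMSEQ_inverse_real_of_nat)
  then have "(\<lambda>k. ee k powr p) \<longlonglongrightarrow> 0"
    using tendsto_zero_powrI[of ee sequentially "\<lambda>_. p" p] p less_imp_le[OF ee] by simp
  then have "(\<lambda>k. 2 * (ee k powr p * V)) \<longlonglongrightarrow> 0"
    by (intro tendsto_mult_right_zero tendsto_mult_left_zero)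
  then have "(\<lambda>k. (\<integral>x. \<bar>\<psi> k x - f x\<bar> powr p \<partial>(lebesgue_on S)) +
             (\<integral>x. norm (grad (\<psi> k) x - g x) powr p \<partial>(lebesgue_on S))) \<longlonglongrightarrow> 0"
  proof (rule tendsto_sandwich[rotated -1])
    show "\<forall>\<^sub>F k in sequentially. (\<integral>x. \<bar>\<psi> k x - f x\<bar> powr p \<partial>(lebesgue_on S)) +
             (\<integral>x. norm (grad (\<psi> k) x - g x) powr p \<partial>(lebesgue_on S)) \<le> 2 * (ee k powr p * V)"
      using add_mono[OF s1 s2] by (intro always_eventually allI) (simp only: mult_2)
  qed auto
  then show ?thesis
    unfolding sobolev0_def sobolev_def using p wg \<psi>(1)
      Lp_compact_support[OF S(1) K S(2) fc z(1)] Lp_compact_support[OF S(1) K S(2) gc z(2)] by auto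
qed

section \<open>The equation in weak form\<close>

lemma Ck_on_2D:
  assumes "Ck_on 2 S f"
  shows "x \<in> S \<Longrightarrow> f differentiable (at x)"
    and "b \<in> Basis \<Longrightarrow> x \<in> S \<Longrightarrow> partial_deriv b f differentiable (at x)"
    and "b \<in> Basis \<Longrightarrow> c \<in> Basis \<Longrightarrow> continuous_on S (partial_deriv c (partial_deriv b f))"
    and "b \<in> Basis \<Longrightarrow> continuous_on S (partial_deriv b f)"
    and "continuous_on S f"
    and "continuous_on S (grad f)"
proof -
  have *: "Ck_on (Suc (Suc 0)) S f" using assms by (simp only: numeral_2_eq_2)
  show 1: "x \<in> S \<Longrightarrow> f differentiable (at x)"
    "b \<in> Basis \<Longrightarrow> x \<in> S \<Longrightarrow> partial_deriv b f differentiable (at x)"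
    "b \<in> Basis \<Longrightarrow> c \<in> Basis \<Longrightarrow> continuous_on S (partial_deriv c (partial_deriv b f))" for x b c
    using * unfolding Ck_on.simps by blast+
  show 2: "continuous_on S (partial_deriv b f)" if "b \<in> Basis" for b
    using Ck_on_continuous[of 1 S "partial_deriv b f"] * that by (simp only: Ck_on.simps One_nat_def) blast
  show "continuous_on S f" using Ck_on_continuous[OF assms] .
  show "continuous_on S (grad f)"
    unfolding grad_def by (intro continuous_intros 2)
qed

section \<open>Slices in space and time\<close>

lemma has_derivative_slice_fst:
  fixes f :: "'a::euclidean_space \<times> real \<Rightarrow> real"
  assumes "(f has_derivative (\<lambda>h. g \<bullet> h)) (at (x, t))"
  shows "((\<lambda>y. f (y, t)) has_derivative (\<lambda>h. fst g \<bullet> h)) (at x)"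
proof -
  have "((\<lambda>y. f (y, t)) has_derivative (\<lambda>h. g \<bullet> (h, 0))) (at x)"
    by (rule has_derivative_compose[of "\<lambda>y. (y, t)" "\<lambda>h. (h, 0)" x UNIV f "\<lambda>h. g \<bullet> h"])
      (auto intro!: derivative_eq_intros assms)
  then show ?thesis by (simp add: inner_prod_def)
qed

lemma has_derivative_slice_snd:
  fixes f :: "'a::euclidean_space \<times> real \<Rightarrow> real"
  assumes "(f has_derivative (\<lambda>h. g \<bullet> h)) (at (x, t))"
  shows "((\<lambda>s. f (x, s)) has_real_derivative snd g) (at t)"
proof -
  have "((\<lambda>s. f (x, s)) has_derivative (\<lambda>h. g \<bullet> (0, h))) (at t)"
    by (rule has_derivative_compose[of "\<lambda>s. (x, s)" "\<lambda>h. (0, h)" t UNIV f "\<lambda>h. g \<bullet> h"])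
      (auto intro!: derivative_eq_intros assms)
  then show ?thesis by (simp add: inner_prod_def has_field_derivative_def)
qed

text \<open>Expresses the slicewise Laplacian of the weak formulation by derivatives on the product
  space in the directions \<open>(b, 0)\<close>, so that integration by parts can be done in space
  and time at once.\<close>

lemma laplacian_slice:
  fixes \<psi> :: "'a::euclidean_space \<times> real \<Rightarrow> real"
  assumes "Ck_on 2 UNIV \<psi>"
  shows "laplacian (\<lambda>y. \<psi> (y, t)) x = (\<Sum>b\<in>Basis. partial_deriv (b, 0) (partial_deriv (b, 0) \<psi>) (x, t))"
proof -
  have slice: "partial_deriv b (\<lambda>y. f (y, t)) = (\<lambda>y. partial_deriv (b, 0) f (y, t))"
    if "\<And>z. f differentiable (at z)" for f :: "'a \<times> real \<Rightarrow> real" and b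
  proof
    fix y
    note D = has_derivative_grad[OF that, of "(y, t)"]
    show "partial_deriv b (\<lambda>y. f (y, t)) y = partial_deriv (b, 0) f (y, t)"
      using partial_deriv_eq[OF has_derivative_slice_fst[OF D], of b] partial_deriv_eq[OF D, of "(b, 0)"]
      by (simp add: inner_prod_def)
  qed
  have d1: "\<psi> differentiable (at z)" for z using Ck_on_2D(1)[OF assms] by blast
  have d2: "partial_deriv (b, 0) \<psi> differentiable (at z)" if "b \<in> Basis" for z and b :: 'a
    using Ck_on_2D(2)[OF assms] that by (simp add: Basis_prod_def)
  show ?thesis
    unfolding laplacian_def by (intro sum.cong refl) (simp add: slice[OF d1] slice[OF d2])
qed

section \<open>Integrals with a time parameter\<close>

lemma integral_lborel_eq_cbox:
  fixes f :: "'b::euclidean_space \<Rightarrow> real"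
  assumes "integrable lborel f" "\<And>x. x \<notin> cbox a b \<Longrightarrow> f x = 0"
  shows "(\<integral>x. f x \<partial>lborel) = integral (cbox a b) f"
proof -
  have "(\<lambda>x. if x \<in> cbox a b then f x else 0) = f" using assms(2) by auto
  then show ?thesis
    using integral_lborel[OF assms(1)] integral_restrict_UNIV[of "cbox a b" f] by simp
qed

text \<open>One compact \<open>K\<close> contains the spatial supports for all times, which makes
  the extension by zero jointly continuous. In the first claim the pair is turned round, because
  results on integrals with a parameter expect the parameter first.\<close>

lemma ext_slice_param:
  fixes f :: "'a::euclidean_space \<Rightarrow> real \<Rightarrow> real"
  assumes S: "open S" "compact K" "K \<subseteq> S" and f: "continuous_on (S \<times> I) (\<lambda>(x, t). f x t)"
    and z: "\<And>x t. x \<in> S \<Longrightarrow> t \<in> I \<Longrightarrow> x \<notin> K \<Longrightarrow> f x t = 0"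
  shows "continuous_on (I \<times> X) (\<lambda>(t, x). ext S (\<lambda>x. f x t) x)"
    and "t \<in> I \<Longrightarrow> continuous_on UNIV (ext S (\<lambda>x. f x t))"
    and "t \<in> I \<Longrightarrow> integrable lborel (ext S (\<lambda>x. f x t))"
proof -
  have cK: "closed K" using S(2) compact_imp_closed by blast
  have "continuous_on (UNIV \<times> I) (ext (S \<times> UNIV) (\<lambda>(x, t). f x t))"
  proof (rule continuous_on_ext[where K = "K \<times> UNIV"])
    show "continuous_on (S \<times> UNIV \<inter> UNIV \<times> I) (\<lambda>(x, t). f x t)"
      using f by (rule continuous_on_subset) auto
  qed (use S cK z in \<open>auto intro: open_Times closed_Times\<close>)
  then have c: "continuous_on (UNIV \<times> I) (\<lambda>z. ext S (\<lambda>x. f x (snd z)) (fst z))"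
    by (rule continuous_on_eq) (auto simp: ext_def)
  have "continuous_on (I \<times> X) (\<lambda>w. ext S (\<lambda>x. f x (snd (snd w, fst w))) (fst (snd w, fst w)))"
    by (rule continuous_on_compose2[OF c]) (auto intro!: continuous_intros)
  then show "continuous_on (I \<times> X) (\<lambda>(t, x). ext S (\<lambda>x. f x t) x)"
    by (simp add: case_prod_beta)
  show 1: "continuous_on UNIV (ext S (\<lambda>x. f x t))" if "t \<in> I"
  proof -
    have "continuous_on UNIV (\<lambda>y. ext S (\<lambda>x. f x (snd (y, t))) (fst (y, t)))"
      by (rule continuous_on_compose2[OF c]) (auto intro!: continuous_intros that)
    then show ?thesis by simp
  qed
  show "integrable lborel (ext S (\<lambda>x. f x t))" if "t \<in> I"
    by (rule integrable_compact_support[OF 1[OF that] S(2)]) (use z that in \<open>auto simp: ext_def\<close>)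
qed

lemma integral_ext_param:
  fixes f :: "'a::euclidean_space \<Rightarrow> real \<Rightarrow> real"
  assumes S: "open S" "compact K" "K \<subseteq> S" and f: "continuous_on (S \<times> I) (\<lambda>(x, t). f x t)"
    and z: "\<And>x t. x \<in> S \<Longrightarrow> t \<in> I \<Longrightarrow> x \<notin> K \<Longrightarrow> f x t = 0"
    and ab: "K \<subseteq> cbox a b" and t: "t \<in> I"
  shows "(\<integral>x. ext S (\<lambda>x. f x t) x \<partial>lborel) = integral (cbox a b) (ext S (\<lambda>x. f x t))"
  by (rule integral_lborel_eq_cbox[OF ext_slice_param(3)[OF S f z t]])
    (use ab z t in \<open>auto simp: ext_def\<close>)

lemma continuous_on_integral_ext:
  fixes f :: "'a::euclidean_space \<Rightarrow> real \<Rightarrow> real"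
  assumes S: "open S" "compact K" "K \<subseteq> S" and f: "continuous_on (S \<times> I) (\<lambda>(x, t). f x t)"
    and z: "\<And>x t. x \<in> S \<Longrightarrow> t \<in> I \<Longrightarrow> x \<notin> K \<Longrightarrow> f x t = 0"
  shows "continuous_on I (\<lambda>t. \<integral>x. ext S (\<lambda>x. f x t) x \<partial>lborel)"
proof -
  obtain a where ab: "K \<subseteq> cbox (- a) a"
    using bounded_subset_cbox_symmetric[OF compact_imp_bounded[OF S(2)]] by blast
  note eq = integral_ext_param[OF assms ab]
  have "continuous_on I (\<lambda>t. integral (cbox (- a) a) (ext S (\<lambda>x. f x t)))"
    by (rule integral_continuous_on_param) (rule ext_slice_param(1)[OF assms])
  then show ?thesis by (rule continuous_on_eq) (simp add: eq)
qed

lemma has_real_derivative_integral_ext: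
  fixes f f' :: "'a::euclidean_space \<Rightarrow> real \<Rightarrow> real"
  assumes S: "open S" "compact K" "K \<subseteq> S" and I: "open I" "convex I" "t \<in> I"
    and f: "continuous_on (S \<times> I) (\<lambda>(x, t). f x t)"
    and f': "continuous_on (S \<times> I) (\<lambda>(x, t). f' x t)"
    and D: "\<And>x t. x \<in> S \<Longrightarrow> t \<in> I \<Longrightarrow> (f x has_real_derivative f' x t) (at t)"
    and z: "\<And>x t. x \<in> S \<Longrightarrow> t \<in> I \<Longrightarrow> x \<notin> K \<Longrightarrow> f x t = 0"
  shows "((\<lambda>t. \<integral>x. ext S (\<lambda>x. f x t) x \<partial>lborel) has_real_derivative (\<integral>x. ext S (\<lambda>x. f' x t) x \<partial>lborel)) (at t)"
proof -
  \<comment> \<open>For fixed \<open>x\<close> outside \<open>K\<close> the function of time is zero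
    on the open set \<open>I\<close>, hence so is its derivative.\<close>
  have z': "f' x t = 0" if "x \<in> S" "t \<in> I" "x \<notin> K" for x t
  proof -
    have "(f x has_real_derivative 0) (at t)"
      by (rule has_field_derivative_transform_within_open[where f = "\<lambda>_. 0" and S = I])
        (use that z I in auto)
    then show ?thesis using D[OF that(1,2)] DERIV_unique by blast
  qed
  obtain a b where ab: "K \<subseteq> cbox a b"
    using bounded_subset_cbox_symmetric[OF compact_imp_bounded[OF S(2)]] by blast
  note eq = integral_ext_param[OF S f z ab]
  note eq' = integral_ext_param[OF S f' z' ab I(3)]
  have "((\<lambda>t. integral (cbox a b) (ext S (\<lambda>x. f x t))) has_real_derivative integral (cbox a b) (ext S (\<lambda>x. f' x t))) (at t within I)"
  proof (rule leibniz_rule_field_derivative[OF _ _ _ I(3,2)])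
    show "((\<lambda>s. ext S (\<lambda>x. f x s) x) has_real_derivative ext S (\<lambda>x. f' x s) x) (at s within I)"
      if "s \<in> I" for s x
      using D[OF _ that] by (cases "x \<in> S") (auto intro: has_field_derivative_at_within)
    show "ext S (\<lambda>x. f x s) integrable_on cbox a b" if "s \<in> I" for s
      using ext_slice_param(2)[OF S f z that] continuous_on_subset by (intro integrable_continuous) blast
    show "continuous_on (I \<times> cbox a b) (\<lambda>(s, x). ext S (\<lambda>x. f' x s) x)"
      by (rule ext_slice_param(1)[OF S f' z'])
  qed
  then have "((\<lambda>t. integral (cbox a b) (ext S (\<lambda>x. f x t))) has_real_derivative (\<integral>x. ext S (\<lambda>x. f' x t) x \<partial>lborel)) (at t)"
    using at_within_open[OF I(3,1)] eq' by simp
  then show ?thesis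
    by (rule has_field_derivative_transform_within_open[OF _ I(1,3)]) (simp add: eq)
qed

text \<open>Interior information only. \<open>G\<close> is the gradient in space and time:
  \<open>fst (G z)\<close> is the spatial gradient and \<open>snd (G z)\<close> the time derivative
  of \<open>u\<close>.\<close>

locale vhj_solution_interior =
  fixes \<Omega> :: "'a::euclidean_space set" and p T :: real
    and u :: "'a \<times> real \<Rightarrow> real" and G :: "'a \<times> real \<Rightarrow> 'a \<times> real"
  assumes open_\<Omega>: "open \<Omega>" and p_gt_1: "p > 1"
    and has_derivative_u: "z \<in> \<Omega> \<times> {0<..<T} \<Longrightarrow> (u has_derivative (\<lambda>h. G z \<bullet> h)) (at z)"
    and continuous_G: "continuous_on (\<Omega> \<times> {0<..<T}) G"
    and equation: "vhj_equation \<Omega> p T u"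
begin

abbreviation "Q \<equiv> \<Omega> \<times> {0<..<T}"

lemma open_Q: "open Q"
  using open_\<Omega> by (simp add: open_Times)

lemma continuous_u: "continuous_on Q u"
  by (intro continuous_at_imp_continuous_on ballI has_derivative_continuous[OF has_derivative_u])

lemma continuous_grad_powr: "continuous_on Q (\<lambda>z. norm (fst (G z)) powr p)"
  by (rule continuous_on_norm_powr) (use continuous_G p_gt_1 in \<open>auto intro!: continuous_intros\<close>)

text \<open>Integration by parts in the directions \<open>(b, 0)\<close> trades the Laplacian of
  \<open>\<psi>\<close> for its gradient paired with that of \<open>u\<close>. The zero in
  \<open>(fst (G z), 0)\<close> reflects that the time derivative sits on \<open>u\<close> from the
  start. What remains involves first derivatives of \<open>\<psi>\<close> only, and this is the form
  that survives the passage to C^1 functions.\<close>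

lemma weak_form_test_function:
  assumes \<psi>: "test_function Q \<psi>"
  shows "(\<integral>z. ext Q (\<lambda>z. (snd (G z) - norm (fst (G z)) powr p) * \<psi> z + (fst (G z), 0) \<bullet> grad \<psi> z) z \<partial>lborel) = 0"
proof -
  have Ck: "Ck_on k UNIV \<psi>" for k using \<psi> by (auto simp: test_function_def)
  define K where "K = closure {x. \<psi> x \<noteq> 0}"
  have K: "K \<subseteq> Q" using \<psi> unfolding test_function_def K_def by blast
  note C = C1cD[OF test_function_C1c[OF \<psi>, folded K_def]]
  define L where "L z = (\<Sum>b\<in>Basis. partial_deriv (b, 0) (partial_deriv (b, 0) \<psi>) z)" for z
  have bb: "(b, 0) \<in> Basis" if "b \<in> Basis" for b :: 'a using that by (simp add: Basis_prod_def)
  have Pd: "C1c K (partial_deriv (b, 0) \<psi>) (grad (partial_deriv (b, 0) \<psi>))" if b: "b \<in> Basis" for b :: 'a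
  proof -
    have "C1c K (ext UNIV (partial_deriv (b, 0) \<psi>)) (ext UNIV (grad (partial_deriv (b, 0) \<psi>)))"
    proof (rule C1c_ext[OF open_UNIV C(1) subset_UNIV])
      show "(partial_deriv (b, 0) \<psi> has_derivative (\<lambda>h. grad (partial_deriv (b, 0) \<psi>) x \<bullet> h)) (at x)" for x
        by (rule has_derivative_grad[OF Ck_on_2D(2)[OF Ck bb[OF b] UNIV_I]])
      show "continuous_on UNIV (grad (partial_deriv (b, 0) \<psi>))"
        unfolding grad_def by (intro continuous_intros Ck_on_2D(3)[OF Ck bb[OF b]])
      show "partial_deriv (b, 0) \<psi> x = 0" if "x \<notin> K" for x
        using C(7)[OF that] grad_inner_Basis[OF bb[OF b], of \<psi> x] by simp
    qed
    then show ?thesis by simp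
  qed
  have Lc: "continuous_on UNIV L"
    unfolding L_def by (intro continuous_intros Ck_on_2D(3)[OF Ck bb bb])
  have Lz: "L z = 0" if "z \<notin> K" for z
    unfolding L_def
  proof (rule sum.neutral, rule ballI)
    fix b :: 'a assume b: "b \<in> Basis"
    show "partial_deriv (b, 0) (partial_deriv (b, 0) \<psi>) z = 0"
      using grad_inner_Basis[OF bb[OF b], of "partial_deriv (b, 0) \<psi>" z] C1cD(7)[OF Pd[OF b] that] by simp
  qed
  have int: "integrable lborel (ext Q h)" if "continuous_on Q h" "\<And>z. z \<in> Q \<Longrightarrow> z \<notin> K \<Longrightarrow> h z = 0" for h :: "'a \<times> real \<Rightarrow> real"
    by (rule integrable_compact_support[OF continuous_on_ext[OF open_Q C(2) K] C(1)])
      (use that K in \<open>auto simp: ext_def\<close>)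
  have \<psi>c: "continuous_on Q \<psi>" "continuous_on Q (grad \<psi>)" "continuous_on Q L"
    using C(4,5) Lc continuous_on_subset by blast+
  have i1: "integrable lborel (ext Q (\<lambda>z. snd (G z) * \<psi> z))"
    by (rule int) (use \<psi>c C(6,7) continuous_G in \<open>auto intro!: continuous_intros\<close>)
  have i2: "integrable lborel (ext Q (\<lambda>z. u z * L z))"
    by (rule int) (use \<psi>c Lz continuous_u in \<open>auto intro!: continuous_intros\<close>)
  have i3: "integrable lborel (ext Q (\<lambda>z. norm (fst (G z)) powr p * \<psi> z))"
    by (rule int) (use \<psi>c C(6) continuous_grad_powr in \<open>auto intro!: continuous_intros\<close>)
  have i4: "integrable lborel (ext Q (\<lambda>z. (fst (G z), 0) \<bullet> grad \<psi> z))"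
    by (rule int) (use \<psi>c C(6,7) continuous_G in \<open>auto intro!: continuous_intros\<close>)
  \<comment> \<open>Inside the open cylinder the slice derivatives that occur in the equation are
    the components of \<open>G\<close>.\<close>
  have dt: "deriv (\<lambda>s. u (x, s)) t = snd (G (x, t))" and dx: "grad (\<lambda>y. u (y, t)) x = fst (G (x, t))"
    if "(x, t) \<in> Q" for x t
    using DERIV_imp_deriv[OF has_derivative_slice_snd[OF has_derivative_u[OF that]]]
      grad_eq[OF has_derivative_slice_fst[OF has_derivative_u[OF that]]] by blast+
  have "(\<integral>(x, t). deriv (\<lambda>s. u (x, s)) t * \<psi> (x, t) - u (x, t) * laplacian (\<lambda>y. \<psi> (y, t)) x \<partial>(lebesgue_on Q))
     = (\<integral>z. snd (G z) * \<psi> z - u z * L z \<partial>(lebesgue_on Q))"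
    by (rule Bochner_Integration.integral_cong) (auto simp: dt L_def laplacian_slice[OF Ck])
  also have "\<dots> = (\<integral>z. ext Q (\<lambda>z. snd (G z) * \<psi> z) z - ext Q (\<lambda>z. u z * L z) z \<partial>lborel)"
  proof -
    have "ext Q (\<lambda>z. snd (G z) * \<psi> z - u z * L z) = (\<lambda>z. ext Q (\<lambda>z. snd (G z) * \<psi> z) z - ext Q (\<lambda>z. u z * L z) z)"
      by (auto simp: ext_def)
    then show ?thesis
      using open_Q borel_measurable_integrable[OF i1] borel_measurable_integrable[OF i2]
      by (subst integral_lebesgue_on) simp_all
  qed
  finally have lhs: "(\<integral>(x, t). deriv (\<lambda>s. u (x, s)) t * \<psi> (x, t) - u (x, t) * laplacian (\<lambda>y. \<psi> (y, t)) x \<partial>(lebesgue_on Q))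
     = (\<integral>z. ext Q (\<lambda>z. snd (G z) * \<psi> z) z \<partial>lborel) - (\<integral>z. ext Q (\<lambda>z. u z * L z) z \<partial>lborel)"
    using i1 i2 by simp
  have "(\<integral>(x, t). norm (grad (\<lambda>y. u (y, t)) x) powr p * \<psi> (x, t) \<partial>(lebesgue_on Q))
     = (\<integral>z. norm (fst (G z)) powr p * \<psi> z \<partial>(lebesgue_on Q))"
    by (rule Bochner_Integration.integral_cong) (auto simp: dx)
  also have "\<dots> = (\<integral>z. ext Q (\<lambda>z. norm (fst (G z)) powr p * \<psi> z) z \<partial>lborel)"
    by (rule integral_lebesgue_on) (use open_Q borel_measurable_integrable[OF i3] in simp_all)
  finally have rhs: "(\<integral>(x, t). norm (grad (\<lambda>y. u (y, t)) x) powr p * \<psi> (x, t) \<partial>(lebesgue_on Q)) = \<dots>" .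
  have parts: "(\<integral>z. ext Q (\<lambda>z. u z * L z) z \<partial>lborel) = - (\<integral>z. ext Q (\<lambda>z. (fst (G z), 0) \<bullet> grad \<psi> z) z \<partial>lborel)"
  proof -
    have i5: "integrable lborel (ext Q (\<lambda>z. u z * partial_deriv (b, 0) (partial_deriv (b, 0) \<psi>) z))"
      and i6: "integrable lborel (ext Q (\<lambda>z. partial_deriv (b, 0) \<psi> z * (fst (G z) \<bullet> b)))"
      and eq0: "(\<integral>z. ext Q (\<lambda>z. u z * partial_deriv (b, 0) (partial_deriv (b, 0) \<psi>) z) z \<partial>lborel)
          + (\<integral>z. ext Q (\<lambda>z. partial_deriv (b, 0) \<psi> z * (fst (G z) \<bullet> b)) z \<partial>lborel) = 0"
      if b: "b \<in> Basis" for b :: 'a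
    proof -
      note P = C1cD[OF Pd[OF b]]
      have pc: "continuous_on Q (partial_deriv (b, 0) \<psi>)"
          "continuous_on Q (partial_deriv (b, 0) (partial_deriv (b, 0) \<psi>))"
        using P(5) Ck_on_2D(3)[OF Ck bb[OF b] bb[OF b]] continuous_on_subset by blast+
      show i5: "integrable lborel (ext Q (\<lambda>z. u z * partial_deriv (b, 0) (partial_deriv (b, 0) \<psi>) z))"
      proof (rule int)
        show "u z * partial_deriv (b, 0) (partial_deriv (b, 0) \<psi>) z = 0" if "z \<notin> K" for z
          using grad_inner_Basis[OF bb[OF b], of "partial_deriv (b, 0) \<psi>" z] P(7)[OF that] by simp
      qed (use pc continuous_u in \<open>auto intro!: continuous_intros\<close>)
      show i6: "integrable lborel (ext Q (\<lambda>z. partial_deriv (b, 0) \<psi> z * (fst (G z) \<bullet> b)))"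
        by (rule int) (use pc continuous_G P(6) in \<open>auto intro!: continuous_intros\<close>)
      \<comment> \<open>The divergence identity in direction \<open>(b, 0)\<close> for the product
        of \<open>u\<close> and \<open>partial_deriv (b, 0) \<psi>\<close>.\<close>
      have "(\<integral>z. ext Q (\<lambda>x. u x *\<^sub>R grad (partial_deriv (b, 0) \<psi>) x + partial_deriv (b, 0) \<psi> x *\<^sub>R G x) z \<bullet> (b, 0) \<partial>lborel) = 0"
        by (rule integral_partial_deriv_eq_0[OF C1c_mult_ext[OF open_Q K Pd[OF b] has_derivative_u continuous_G]])
      also have "(\<lambda>z. ext Q (\<lambda>x. u x *\<^sub>R grad (partial_deriv (b, 0) \<psi>) x + partial_deriv (b, 0) \<psi> x *\<^sub>R G x) z \<bullet> (b, 0))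
        = (\<lambda>z. ext Q (\<lambda>z. u z * partial_deriv (b, 0) (partial_deriv (b, 0) \<psi>) z) z + ext Q (\<lambda>z. partial_deriv (b, 0) \<psi> z * (fst (G z) \<bullet> b)) z)"
        using grad_inner_Basis[OF bb[OF b], of "partial_deriv (b, 0) \<psi>"]
        by (simp add: ext_def fun_eq_iff inner_add_left inner_prod_def[of "G _"])
      finally show "(\<integral>z. ext Q (\<lambda>z. u z * partial_deriv (b, 0) (partial_deriv (b, 0) \<psi>) z) z \<partial>lborel)
          + (\<integral>z. ext Q (\<lambda>z. partial_deriv (b, 0) \<psi> z * (fst (G z) \<bullet> b)) z \<partial>lborel) = 0"
        using i5 i6 by simp
    qed
    have e1: "ext Q (\<lambda>z. u z * L z) = (\<lambda>z. \<Sum>b\<in>Basis. ext Q (\<lambda>z. u z * partial_deriv (b, 0) (partial_deriv (b, 0) \<psi>) z) z)"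
      by (auto simp: ext_def L_def fun_eq_iff sum_distrib_left)
    have e2: "ext Q (\<lambda>z. (fst (G z), 0) \<bullet> grad \<psi> z) = (\<lambda>z. \<Sum>b\<in>Basis. ext Q (\<lambda>z. partial_deriv (b, 0) \<psi> z * (fst (G z) \<bullet> b)) z)"
    proof -
      have "(fst (G z), 0) \<bullet> grad \<psi> z = (\<Sum>b\<in>Basis. partial_deriv (b, 0) \<psi> z * (fst (G z) \<bullet> b))" for z
      proof -
        have "(fst (G z), 0) \<bullet> grad \<psi> z = (\<Sum>b\<in>Basis. (fst (G z) \<bullet> b) * (fst (grad \<psi> z) \<bullet> b))"
          by (simp add: inner_prod_def) (rule euclidean_inner)
        also have "\<dots> = (\<Sum>b\<in>Basis. partial_deriv (b, 0) \<psi> z * (fst (G z) \<bullet> b))"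
        proof (rule sum.cong[OF refl])
          fix b :: 'a assume "b \<in> Basis"
          from grad_inner_Basis[OF bb[OF this], of \<psi> z]
          show "(fst (G z) \<bullet> b) * (fst (grad \<psi> z) \<bullet> b) = partial_deriv (b, 0) \<psi> z * (fst (G z) \<bullet> b)"
            by (simp add: inner_prod_def)
        qed
        finally show ?thesis .
      qed
      then show ?thesis by (auto simp: ext_def fun_eq_iff)
    qed
    have "(\<integral>z. ext Q (\<lambda>z. u z * L z) z \<partial>lborel) + (\<integral>z. ext Q (\<lambda>z. (fst (G z), 0) \<bullet> grad \<psi> z) z \<partial>lborel)
      = (\<Sum>b\<in>Basis. (\<integral>z. ext Q (\<lambda>z. u z * partial_deriv (b, 0) (partial_deriv (b, 0) \<psi>) z) z \<partial>lborel)
          + (\<integral>z. ext Q (\<lambda>z. partial_deriv (b, 0) \<psi> z * (fst (G z) \<bullet> b)) z \<partial>lborel))"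
      unfolding e1 e2 using i5 i6 by (simp add: Bochner_Integration.integral_sum sum.distrib)
    also have "\<dots> = 0" using eq0 by (intro sum.neutral) blast
    finally show ?thesis by simp
  qed
  have "(\<integral>z. ext Q (\<lambda>z. (snd (G z) - norm (fst (G z)) powr p) * \<psi> z + (fst (G z), 0) \<bullet> grad \<psi> z) z \<partial>lborel)
    = (\<integral>z. ext Q (\<lambda>z. snd (G z) * \<psi> z) z - ext Q (\<lambda>z. norm (fst (G z)) powr p * \<psi> z) z + ext Q (\<lambda>z. (fst (G z), 0) \<bullet> grad \<psi> z) z \<partial>lborel)"
    by (rule Bochner_Integration.integral_cong) (auto simp: ext_def algebra_simps)
  also have "\<dots> = (\<integral>z. ext Q (\<lambda>z. snd (G z) * \<psi> z) z \<partial>lborel) - (\<integral>z. ext Q (\<lambda>z. norm (fst (G z)) powr p * \<psi> z) z \<partial>lborel)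
      + (\<integral>z. ext Q (\<lambda>z. (fst (G z), 0) \<bullet> grad \<psi> z) z \<partial>lborel)"
    using i1 i3 i4 by simp
  also have "\<dots> = 0"
    using equation[unfolded vhj_equation_def, rule_format, OF \<psi>, unfolded lhs rhs] parts by linarith
  finally show ?thesis .
qed

lemma weak_form:
  assumes "C1c K f g" "K \<subseteq> Q"
  shows "(\<integral>z. ext Q (\<lambda>z. (snd (G z) - norm (fst (G z)) powr p) * f z + (fst (G z), 0) \<bullet> g z) z \<partial>lborel) = 0"
proof (rule integral_ext_C1c_limit[OF open_Q _ _ weak_form_test_function assms])
  show "continuous_on Q (\<lambda>z. snd (G z) - norm (fst (G z)) powr p)"
    by (intro continuous_intros continuous_G continuous_grad_powr)
  show "continuous_on Q (\<lambda>z. (fst (G z), 0::real))"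
    by (intro continuous_intros continuous_G)
qed

text \<open>Test with \<open>\<eta> (fst z) * h (snd z)\<close>, where \<open>h\<close> is a bump of
  integral one around \<open>t\<close>. The derivative of \<open>h\<close> meets the zero time
  component and drops out, so by Fubini the average of the continuous function \<open>F\<close>
  against \<open>h\<close> vanishes; shrinking the bump gives \<open>F t = 0\<close>.\<close>

lemma pointwise_identity:
  assumes \<eta>: "C1c K \<eta> \<eta>'" "K \<subseteq> \<Omega>" and t: "t \<in> {0<..<T}"
  shows "(\<integral>x. ext \<Omega> (\<lambda>x. (snd (G (x, t)) - norm (fst (G (x, t))) powr p) * \<eta> x + fst (G (x, t)) \<bullet> \<eta>' x) x \<partial>lborel) = 0"
proof -
  note C = C1cD[OF \<eta>(1)]
  define \<Phi> where "\<Phi> x t = (snd (G (x, t)) - norm (fst (G (x, t))) powr p) * \<eta> x + fst (G (x, t)) \<bullet> \<eta>' x" for x t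
  define F where "F s = (\<integral>x. ext \<Omega> (\<lambda>x. \<Phi> x s) x \<partial>lborel)" for s
  have \<eta>c: "continuous_on Q (\<lambda>z. \<eta> (fst z))" "continuous_on Q (\<lambda>z. \<eta>' (fst z))"
    by (rule continuous_on_compose2[OF C(5)] continuous_on_compose2[OF C(4)]; auto intro!: continuous_intros)+
  have \<Phi>c: "continuous_on Q (\<lambda>(x, t). \<Phi> x t)"
    unfolding \<Phi>_def case_prod_beta prod.collapse
    by (intro continuous_intros continuous_G continuous_grad_powr \<eta>c)
  have \<Phi>z: "\<Phi> x s = 0" if "x \<notin> K" for x s
    using C(6,7)[OF that] by (simp add: \<Phi>_def)
  have Fc: "continuous_on {0<..<T} F"
    unfolding F_def by (rule continuous_on_integral_ext[OF open_\<Omega> C(1) \<eta>(2) \<Phi>c \<Phi>z])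
  have "\<bar>F t\<bar> \<le> e" if e: "e > 0" for e
  proof -
    obtain d where d: "d > 0" "\<And>s. s \<in> {0<..<T} \<Longrightarrow> dist s t < d \<Longrightarrow> dist (F s) (F t) < e"
      using Fc t e unfolding continuous_on_iff by blast
    obtain d' where d': "d' > 0" "cball t d' \<subseteq> {0<..<T}"
      using open_greaterThanLessThan[of 0 T] t unfolding open_contains_cball by blast
    define r where "r = min (d / 2) d'"
    have r: "r > 0" "r < d" "r \<le> d'" using d(1) d'(1) by (auto simp: r_def)
    have rT: "cball t r \<subseteq> {0<..<T}" using d'(2) r(3) by (meson subset_cball subset_trans)
    have rF: "\<bar>F s - F t\<bar> \<le> e" if "s \<in> cball t r" for s
      using d(2)[of s] that rT r(2) by (force simp: dist_norm abs_minus_commute)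
    obtain \<rho> :: "real \<Rightarrow> real" where \<rho>: "\<And>k. Ck_on k UNIV \<rho>" "\<And>x. \<rho> x \<ge> 0" "\<And>x. norm x > r \<Longrightarrow> \<rho> x = 0"
      "(\<integral>x. \<rho> x \<partial>lborel) = 1" using exists_mollifier[OF r(1)] by blast
    define h where "h s = \<rho> (s - t)" for s
    define h' where "h' s = grad \<rho> (s - t)" for s
    have hz: "h s = 0" if "s \<notin> cball t r" for s using \<rho>(3)[of "s - t"] that by (auto simp: h_def dist_real_def)
    have hD: "(h has_derivative (\<lambda>v. h' s \<bullet> v)) (at s)" for s
    proof -
      have "((\<lambda>s. \<rho> (s - t)) has_derivative (\<lambda>v. grad \<rho> (s - t) \<bullet> v)) (at s)"
      proof (rule has_derivative_compose[of "\<lambda>s. s - t" "\<lambda>v. v" s UNIV \<rho> "\<lambda>v. grad \<rho> (s - t) \<bullet> v"])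
        show "(\<rho> has_derivative (\<lambda>v. grad \<rho> (s - t) \<bullet> v)) (at (s - t))"
          by (rule has_derivative_grad[OF Ck_on_2D(1)[OF \<rho>(1) UNIV_I]])
      qed (auto intro!: derivative_eq_intros)
      then show ?thesis unfolding h_def h'_def .
    qed
    have hc: "continuous_on UNIV h" "continuous_on UNIV h'"
      unfolding h_def h'_def
      by (rule continuous_on_compose2[OF Ck_on_2D(5)[OF \<rho>(1)]] continuous_on_compose2[OF Ck_on_2D(6)[OF \<rho>(1)]];
          auto intro!: continuous_intros)+
    have h'z: "h' s = 0" if "s \<notin> cball t r" for s
    proof -
      have "(h has_derivative (\<lambda>v. 0 \<bullet> v)) (at s)"
        by (rule has_derivative_transform_within_open[where f = "\<lambda>_. 0" and s = "- cball t r"])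
          (use that hz in auto)
      then show ?thesis using grad_eq hD by metis
    qed
    have h_int: "integrable lborel h" by (rule integrable_compact_support[OF hc(1) compact_cball hz])
    have h1: "(\<integral>s. h s \<partial>lborel) = 1"
      using integral_translate[of \<rho> "- t"] \<rho>(4) borel_measurable_continuous_onI[OF Ck_on_2D(5)[OF \<rho>(1)]]
      by (simp add: h_def)
    define f where "f z = \<eta> (fst z) * h (snd z)" for z
    define g where "g z = (h (snd z) *\<^sub>R \<eta>' (fst z), \<eta> (fst z) * h' (snd z))" for z
    have Q': "K \<times> cball t r \<subseteq> Q" using \<eta>(2) rT by blast
    have "C1c (K \<times> cball t r) f g"
      unfolding C1c_def
    proof (intro conjI allI impI)
      show "compact (K \<times> cball t r)" by (intro compact_Times C compact_cball)
      fix z :: "'a \<times> real"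
      have 1: "((\<lambda>z. \<eta> (fst z)) has_derivative (\<lambda>v. \<eta>' (fst z) \<bullet> fst v)) (at z)"
        by (rule has_derivative_compose[OF _ C(3)]) (auto intro!: derivative_eq_intros)
      have 2: "((\<lambda>z. h (snd z)) has_derivative (\<lambda>v. h' (snd z) \<bullet> snd v)) (at z)"
        by (rule has_derivative_compose[OF _ hD]) (auto intro!: derivative_eq_intros)
      show "(f has_derivative (\<lambda>v. g z \<bullet> v)) (at z)"
        using has_derivative_mult[OF 1 2] unfolding f_def
        by (rule has_derivative_eq_rhs) (auto simp: g_def inner_prod_def fun_eq_iff algebra_simps)
      show "f z = 0" if "z \<notin> K \<times> cball t r"
        using that C(6) hz by (cases z) (auto simp: f_def)
      show "g z = 0" if "z \<notin> K \<times> cball t r"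
        using that C(6,7) hz h'z by (cases z) (auto simp: g_def zero_prod_def)
    next
      show "continuous_on UNIV g"
        unfolding g_def
        by (intro continuous_intros continuous_on_compose2[OF C(5)] continuous_on_compose2[OF C(4)]
            continuous_on_compose2[OF hc(1)] continuous_on_compose2[OF hc(2)]) auto
    qed
    from weak_form[OF this Q']
    have W: "(\<integral>z. ext Q (\<lambda>z. (snd (G z) - norm (fst (G z)) powr p) * f z + (fst (G z), 0) \<bullet> g z) z \<partial>lborel) = 0" .
    define H where "H z = h (snd z) * ext \<Omega> (\<lambda>x. \<Phi> x (snd z)) (fst z)" for z
    have HQ: "ext Q (\<lambda>z. (snd (G z) - norm (fst (G z)) powr p) * f z + (fst (G z), 0) \<bullet> g z) = H"
    proof
      fix z
      show "ext Q (\<lambda>z. (snd (G z) - norm (fst (G z)) powr p) * f z + (fst (G z), 0) \<bullet> g z) z = H z"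
      proof (cases "z \<in> Q")
        case True
        then show ?thesis
          by (cases z) (simp add: H_def f_def g_def \<Phi>_def inner_prod_def algebra_simps)
      next
        case False
        then have "fst z \<notin> \<Omega> \<or> snd z \<notin> cball t r" using rT by (cases z) auto
        then show ?thesis using False hz by (auto simp: H_def)
      qed
    qed
    have H_int: "integrable lborel H"
    proof (rule integrable_compact_support[where K = "K \<times> cball t r"])
      have "continuous_on Q (\<lambda>z. (snd (G z) - norm (fst (G z)) powr p) * f z + (fst (G z), 0) \<bullet> g z)"
        using \<open>C1c (K \<times> cball t r) f g\<close>[THEN C1cD(5)] \<open>C1c (K \<times> cball t r) f g\<close>[THEN C1cD(4)]
        by (intro continuous_intros continuous_G continuous_grad_powr) (auto elim: continuous_on_subset)
      then show "continuous_on UNIV H"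
        unfolding HQ[symmetric]
        by (intro continuous_on_ext[OF open_Q C1cD(2)[OF \<open>C1c (K \<times> cball t r) f g\<close>] Q'])
          (use C1cD(6,7)[OF \<open>C1c (K \<times> cball t r) f g\<close>] in auto)
      show "H z = 0" if "z \<notin> K \<times> cball t r" for z
        using that \<Phi>z hz by (cases z) (auto simp: H_def ext_def)
    qed (intro compact_Times C compact_cball)
    have HF: "(\<integral>x. H (x, s) \<partial>lborel) = h s * F s" for s
      by (simp add: H_def F_def)
    have H_int': "integrable (lborel \<Otimes>\<^sub>M lborel) H" using H_int by (simp add: lborel_prod)
    have hF_int: "integrable lborel (\<lambda>s. h s * F s)"
      using lborel_pair.integrable_snd[of "\<lambda>x s. H (x, s)"] H_int' by (simp add: HF)
    have hF_0: "(\<integral>s. h s * F s \<partial>lborel) = 0"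
      using lborel_pair.integral_snd[of "\<lambda>x s. H (x, s)"] H_int' W by (simp add: HF HQ lborel_prod)
    have "F t = (\<integral>s. h s * F t - h s * F s \<partial>lborel)"
      using h_int h1 hF_int hF_0 by simp
    also have "\<bar>\<dots>\<bar> \<le> (\<integral>s. e * h s \<partial>lborel)"
    proof (rule integral_abs_bound_integral)
      show "\<bar>h s * F t - h s * F s\<bar> \<le> e * h s" for s
      proof (cases "s \<in> cball t r")
        case True
        have "h s \<ge> 0" using \<rho>(2) by (simp add: h_def)
        then have "h s * \<bar>F s - F t\<bar> \<le> h s * e" using rF[OF True] by (intro mult_left_mono)
        moreover have "\<bar>h s * F t - h s * F s\<bar> = h s * \<bar>F s - F t\<bar>"
          using \<open>h s \<ge> 0\<close> by (simp add: abs_mult abs_minus_commute flip: right_diff_distrib)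
        ultimately show ?thesis by (simp add: mult.commute)
      qed (simp add: hz)
    qed (use h_int hF_int in auto)
    also have "\<dots> = e" using h1 by simp
    finally show ?thesis .
  qed
  then have "F t = 0" by (metis abs_le_zero_iff field_le_epsilon add_0)
  then show ?thesis by (simp add: F_def \<Phi>_def)
qed

text \<open>\<open>H b\<close> is the gradient of the component
  \<open>\<eta>' x \<bullet> b\<close>, so the sum over \<open>b\<close> is the Laplacian of
  \<open>\<eta>\<close>. The time derivative is taken under the integral,
  \<open>pointwise_identity\<close> turns it into gradient terms, and integration by parts moves the
  remaining derivative from \<open>u\<close> to \<open>\<eta>\<close>.\<close>

lemma has_derivative_weighted_integral:
  assumes \<eta>: "C1c K \<eta> \<eta>'" "K \<subseteq> \<Omega>" and t: "t \<in> {0<..<T}"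
    and H: "\<And>b. b \<in> Basis \<Longrightarrow> C1c K (\<lambda>x. \<eta>' x \<bullet> b) (H b)"
  shows "((\<lambda>t. \<integral>x. ext \<Omega> (\<lambda>x. u (x, t) * \<eta> x) x \<partial>lborel) has_real_derivative
    (\<integral>x. ext \<Omega> (\<lambda>x. u (x, t) * (\<Sum>b\<in>Basis. H b x \<bullet> b)) x \<partial>lborel) +
    (\<integral>x. ext \<Omega> (\<lambda>x. norm (fst (G (x, t))) powr p * \<eta> x) x \<partial>lborel)) (at t)"
proof -
  note C = C1cD[OF \<eta>(1)]
  have slice: "continuous_on \<Omega> (\<lambda>x. f (x, t))" if "continuous_on Q f" for f :: "'a \<times> real \<Rightarrow> 'c::topological_space"
    by (rule continuous_on_compose2[OF that]) (use t in \<open>auto intro!: continuous_intros\<close>)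
  note gc = slice[OF continuous_G] and uc = slice[OF continuous_u] and pc = slice[OF continuous_grad_powr]
  have int: "integrable lborel (ext \<Omega> h)" if "continuous_on \<Omega> h" "\<And>x. x \<notin> K \<Longrightarrow> h x = 0" for h :: "'a \<Rightarrow> real"
    by (rule integrable_compact_support[OF continuous_on_ext[OF open_\<Omega> C(2) \<eta>(2)] C(1)])
      (use that in \<open>auto simp: ext_def\<close>)
  have \<eta>c: "continuous_on \<Omega> \<eta>" "continuous_on \<Omega> \<eta>'" using C(4,5) continuous_on_subset by blast+
  have i1: "integrable lborel (ext \<Omega> (\<lambda>x. snd (G (x, t)) * \<eta> x))"
    by (rule int) (use C(6) in \<open>auto intro!: continuous_intros gc \<eta>c\<close>)
  have i2: "integrable lborel (ext \<Omega> (\<lambda>x. norm (fst (G (x, t))) powr p * \<eta> x))"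
    by (rule int) (use C(6) in \<open>auto intro!: continuous_intros pc \<eta>c\<close>)
  have i3: "integrable lborel (ext \<Omega> (\<lambda>x. fst (G (x, t)) \<bullet> \<eta>' x))"
    by (rule int) (use C(7) in \<open>auto intro!: continuous_intros gc \<eta>c\<close>)
  have D: "((\<lambda>t. \<integral>x. ext \<Omega> (\<lambda>x. u (x, t) * \<eta> x) x \<partial>lborel) has_real_derivative
     (\<integral>x. ext \<Omega> (\<lambda>x. snd (G (x, t)) * \<eta> x) x \<partial>lborel)) (at t)"
  proof (rule has_real_derivative_integral_ext[OF open_\<Omega> C(1) \<eta>(2) _ _ t])
    have c1: "continuous_on Q (\<lambda>z. \<eta> (fst z))"
      by (rule continuous_on_compose2[OF C(5)]) (auto intro!: continuous_intros)
    show "continuous_on Q (\<lambda>(x, t). u (x, t) * \<eta> x)" "continuous_on Q (\<lambda>(x, t). snd (G (x, t)) * \<eta> x)"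
      unfolding case_prod_beta prod.collapse by (intro continuous_intros continuous_u continuous_G c1)+
    show "((\<lambda>s. u (x, s) * \<eta> x) has_real_derivative snd (G (x, s)) * \<eta> x) (at s)"
      if "x \<in> \<Omega>" "s \<in> {0<..<T}" for x s
      by (intro DERIV_cmult_right has_derivative_slice_snd has_derivative_u) (use that in auto)
  qed (use C(6) in auto)
  have "(\<integral>x. ext \<Omega> (\<lambda>x. snd (G (x, t)) * \<eta> x) x - ext \<Omega> (\<lambda>x. norm (fst (G (x, t))) powr p * \<eta> x) x
      + ext \<Omega> (\<lambda>x. fst (G (x, t)) \<bullet> \<eta>' x) x \<partial>lborel) = 0"
    using pointwise_identity[OF \<eta> t]
    by (rule trans[rotated]) (rule Bochner_Integration.integral_cong, auto simp: ext_def algebra_simps)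
  then have 1: "(\<integral>x. ext \<Omega> (\<lambda>x. snd (G (x, t)) * \<eta> x) x \<partial>lborel) =
     (\<integral>x. ext \<Omega> (\<lambda>x. norm (fst (G (x, t))) powr p * \<eta> x) x \<partial>lborel) - (\<integral>x. ext \<Omega> (\<lambda>x. fst (G (x, t)) \<bullet> \<eta>' x) x \<partial>lborel)"
    using i1 i2 i3 by simp
  have ib: "integrable lborel (ext \<Omega> (\<lambda>x. u (x, t) * (H b x \<bullet> b)))"
    and ib': "integrable lborel (ext \<Omega> (\<lambda>x. (fst (G (x, t)) \<bullet> b) * (\<eta>' x \<bullet> b)))"
    and eq0: "(\<integral>x. ext \<Omega> (\<lambda>x. u (x, t) * (H b x \<bullet> b)) x \<partial>lborel) + (\<integral>x. ext \<Omega> (\<lambda>x. (fst (G (x, t)) \<bullet> b) * (\<eta>' x \<bullet> b)) x \<partial>lborel) = 0"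
    if b: "b \<in> Basis" for b
  proof -
    note Cb = C1cD[OF H[OF b]]
    have Hc: "continuous_on \<Omega> (H b)" using Cb(4) continuous_on_subset by blast
    show ib: "integrable lborel (ext \<Omega> (\<lambda>x. u (x, t) * (H b x \<bullet> b)))"
      by (rule int) (use Cb(7) in \<open>auto intro!: continuous_intros uc Hc\<close>)
    show ib': "integrable lborel (ext \<Omega> (\<lambda>x. (fst (G (x, t)) \<bullet> b) * (\<eta>' x \<bullet> b)))"
      by (rule int) (use C(7) in \<open>auto intro!: continuous_intros gc \<eta>c\<close>)
    have "(\<integral>x. ext \<Omega> (\<lambda>x. u (x, t) *\<^sub>R H b x + (\<eta>' x \<bullet> b) *\<^sub>R fst (G (x, t))) x \<bullet> b \<partial>lborel) = 0"
    proof (rule integral_partial_deriv_eq_0[OF C1c_mult_ext[OF open_\<Omega> \<eta>(2) H[OF b]]])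
      show "((\<lambda>x. u (x, t)) has_derivative (\<lambda>v. fst (G (x, t)) \<bullet> v)) (at x)" if "x \<in> \<Omega>" for x
        by (intro has_derivative_slice_fst has_derivative_u) (use that t in auto)
      show "continuous_on \<Omega> (\<lambda>x. fst (G (x, t)))" by (intro continuous_intros gc)
    qed
    also have "(\<lambda>x. ext \<Omega> (\<lambda>x. u (x, t) *\<^sub>R H b x + (\<eta>' x \<bullet> b) *\<^sub>R fst (G (x, t))) x \<bullet> b) =
      (\<lambda>x. ext \<Omega> (\<lambda>x. u (x, t) * (H b x \<bullet> b)) x + ext \<Omega> (\<lambda>x. (fst (G (x, t)) \<bullet> b) * (\<eta>' x \<bullet> b)) x)"
      by (auto simp: ext_def fun_eq_iff inner_add_left mult.commute)
    finally show "(\<integral>x. ext \<Omega> (\<lambda>x. u (x, t) * (H b x \<bullet> b)) x \<partial>lborel) + (\<integral>x. ext \<Omega> (\<lambda>x. (fst (G (x, t)) \<bullet> b) * (\<eta>' x \<bullet> b)) x \<partial>lborel) = 0"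
      using ib ib' by simp
  qed
  have e1: "ext \<Omega> (\<lambda>x. u (x, t) * (\<Sum>b\<in>Basis. H b x \<bullet> b)) = (\<lambda>x. \<Sum>b\<in>Basis. ext \<Omega> (\<lambda>x. u (x, t) * (H b x \<bullet> b)) x)"
    by (auto simp: ext_def fun_eq_iff sum_distrib_left)
  have e2: "ext \<Omega> (\<lambda>x. fst (G (x, t)) \<bullet> \<eta>' x) = (\<lambda>x. \<Sum>b\<in>Basis. ext \<Omega> (\<lambda>x. (fst (G (x, t)) \<bullet> b) * (\<eta>' x \<bullet> b)) x)"
  proof
    fix x
    show "ext \<Omega> (\<lambda>x. fst (G (x, t)) \<bullet> \<eta>' x) x = (\<Sum>b\<in>Basis. ext \<Omega> (\<lambda>x. (fst (G (x, t)) \<bullet> b) * (\<eta>' x \<bullet> b)) x)"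
      unfolding ext_def by (simp, rule impI, rule euclidean_inner)
  qed
  have "(\<integral>x. ext \<Omega> (\<lambda>x. u (x, t) * (\<Sum>b\<in>Basis. H b x \<bullet> b)) x \<partial>lborel) + (\<integral>x. ext \<Omega> (\<lambda>x. fst (G (x, t)) \<bullet> \<eta>' x) x \<partial>lborel)
    = (\<Sum>b\<in>Basis. (\<integral>x. ext \<Omega> (\<lambda>x. u (x, t) * (H b x \<bullet> b)) x \<partial>lborel) + (\<integral>x. ext \<Omega> (\<lambda>x. (fst (G (x, t)) \<bullet> b) * (\<eta>' x \<bullet> b)) x \<partial>lborel))"
    unfolding e1 e2 using ib ib' by (simp add: Bochner_Integration.integral_sum sum.distrib)
  also have "\<dots> = 0" using eq0 by (intro sum.neutral) blast
  finally have "(\<integral>x. ext \<Omega> (\<lambda>x. snd (G (x, t)) * \<eta> x) x \<partial>lborel) =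
    (\<integral>x. ext \<Omega> (\<lambda>x. u (x, t) * (\<Sum>b\<in>Basis. H b x \<bullet> b)) x \<partial>lborel) +
    (\<integral>x. ext \<Omega> (\<lambda>x. norm (fst (G (x, t))) powr p * \<eta> x) x \<partial>lborel)"
    using 1 by linarith
  then show ?thesis using D by simp
qed

end

section \<open>Cut-off functions\<close>

text \<open>The exponent is at least 2, so at 0 the difference quotient is bounded by
  \<open>\<bar>h\<bar> ^ (Suc n)\<close> and tends to zero.\<close>

lemma has_real_derivative_max_power:
  "((\<lambda>x. (max 0 x) ^ (Suc (Suc n))) has_real_derivative real (Suc (Suc n)) * (max 0 x) ^ (Suc n)) (at x)"
proof (cases x "0::real" rule: linorder_cases)
  case less
  have "((\<lambda>x. (max 0 x) ^ (Suc (Suc n))) has_real_derivative 0) (at x)"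
    by (rule has_field_derivative_transform_within_open[where f = "\<lambda>_. 0" and S = "{..<0}"]) (use less in auto)
  then show ?thesis using less by simp
next
  case equal
  have "((\<lambda>h. \<bar>h\<bar> ^ (Suc n)) \<longlongrightarrow> 0) (at (0::real))"
    by (rule tendsto_eq_intros refl)+ simp
  then have "((\<lambda>h. ((max 0 (0 + h)) ^ (Suc (Suc n)) - (max 0 0) ^ (Suc (Suc n))) / h) \<longlongrightarrow> 0) (at (0::real))"
  proof (rule Lim_null_comparison[rotated], intro always_eventually allI)
    fix h :: real
    show "norm (((max 0 (0 + h)) ^ (Suc (Suc n)) - (max 0 0) ^ (Suc (Suc n))) / h) \<le> \<bar>h\<bar> ^ (Suc n)"
    proof (cases "h > 0")
      case False
      then have "max 0 (0 + h) = 0" by simp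
      then show ?thesis by (simp del: power_Suc)
    qed (simp add: max_def)
  qed
  then show ?thesis using equal by (simp add: DERIV_def)
next
  case greater
  have "((\<lambda>x. (max 0 x) ^ (Suc (Suc n))) has_real_derivative real (Suc (Suc n)) * x ^ (Suc n)) (at x)"
  proof (rule has_field_derivative_transform_within_open[where f = "\<lambda>x. x ^ (Suc (Suc n))" and S = "{0<..}"])
    show "((\<lambda>x. x ^ (Suc (Suc n))) has_real_derivative real (Suc (Suc n)) * x ^ (Suc n)) (at x)"
      by (rule derivative_eq_intros refl)+ simp
  qed (use greater in auto)
  then show ?thesis using greater by simp
qed

text \<open>A \<open>C\<^sup>2\<close> convex function whose second derivative is the hat function on \<open>[0,2]\<close>, rescaled so
  that \<open>cutoff d\<close> vanishes below \<open>d\<close> and equals \<open>s - 2 d\<close> above \<open>3 d\<close>.\<close>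

definition spline :: "real \<Rightarrow> real" where
  "spline s = ((max 0 s) ^ 3 - 2 * (max 0 (s - 1)) ^ 3 + (max 0 (s - 2)) ^ 3) / 6"

definition spline' :: "real \<Rightarrow> real" where
  "spline' s = ((max 0 s) ^ 2 - 2 * (max 0 (s - 1)) ^ 2 + (max 0 (s - 2)) ^ 2) / 2"

definition spline'' :: "real \<Rightarrow> real" where
  "spline'' s = max 0 s - 2 * max 0 (s - 1) + max 0 (s - 2)"

lemma has_real_derivative_spline:
  "(spline has_real_derivative spline' s) (at s)" "(spline' has_real_derivative spline'' s) (at s)"
proof -
  have i: "((\<lambda>s. s - c) has_real_derivative 1) (at s)" for c s :: real
    by (auto intro!: derivative_eq_intros)
  have 3: "((\<lambda>s. (max 0 (s - c)) ^ 3) has_real_derivative 3 * (max 0 (s - c)) ^ 2) (at s)" for c s :: real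
    using DERIV_chain2[where g = "\<lambda>s. s - c", OF has_real_derivative_max_power[of 1 "s - c"] i]
    by (simp add: eval_nat_numeral)
  have 2: "((\<lambda>s. (max 0 (s - c)) ^ 2) has_real_derivative 2 * max 0 (s - c)) (at s)" for c s :: real
    using DERIV_chain2[where g = "\<lambda>s. s - c", OF has_real_derivative_max_power[of 0 "s - c"] i]
    by (simp add: eval_nat_numeral)
  show "(spline has_real_derivative spline' s) (at s)"
    unfolding spline_def[abs_def] spline'_def
    using DERIV_cdivide[OF DERIV_add[OF DERIV_diff[OF 3[where c = 0, unfolded diff_0_right] DERIV_cmult[OF 3[where c = 1]]] 3[where c = 2]], where c = 6]
    by (rule DERIV_cong) simp
  show "(spline' has_real_derivative spline'' s) (at s)"
    unfolding spline'_def[abs_def] spline''_def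
    using DERIV_cdivide[OF DERIV_add[OF DERIV_diff[OF 2[where c = 0, unfolded diff_0_right] DERIV_cmult[OF 2[where c = 1]]] 2[where c = 2]], where c = 2]
    by (rule DERIV_cong) simp
qed

lemma spline_bounds:
  "spline s \<ge> 0" "spline s \<ge> s - 1" "s \<ge> -1 \<Longrightarrow> spline s \<le> s + 1"
  "spline' s \<ge> 0" "spline' s \<le> 1" "spline'' s \<ge> 0"
  "s \<le> 0 \<Longrightarrow> spline s = 0" "s \<le> 0 \<Longrightarrow> spline' s = 0" "s \<le> 0 \<Longrightarrow> spline'' s = 0"
  "s \<ge> 2 \<Longrightarrow> spline s = s - 1" "s \<ge> 2 \<Longrightarrow> spline' s = 1" "s \<ge> 2 \<Longrightarrow> spline'' s = 0"
proof -
  have A: "spline s = 0" "spline' s = 0" "spline'' s = 0" if "s \<le> 0"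
    using that by (simp_all add: spline_def spline'_def spline''_def)
  have B: "spline s = s ^ 3 / 6" "spline' s = s\<^sup>2 / 2" "spline'' s = s" if "0 \<le> s" "s \<le> 1"
    using that by (simp_all add: spline_def spline'_def spline''_def)
  \<comment> \<open>Expanded about the knot 2, which makes the comparison with the line
    \<open>s - 1\<close> visible.\<close>
  have C: "spline s = s - 1 + (2 - s) ^ 3 / 6" "spline' s = 1 - (2 - s)\<^sup>2 / 2" "spline'' s = 2 - s" if "1 \<le> s" "s \<le> 2"
    using that by (simp_all add: spline_def spline'_def spline''_def power3_eq_cube power2_eq_square field_simps)
  have D: "spline s = s - 1" "spline' s = 1" "spline'' s = 0" if "s \<ge> 2"
    using that by (simp_all add: spline_def spline'_def spline''_def power3_eq_cube power2_eq_square field_simps)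
  consider "s \<le> 0" | "0 \<le> s" "s \<le> 1" | "1 \<le> s" "s \<le> 2" | "s \<ge> 2" by linarith
  then have "spline s \<ge> 0 \<and> spline s \<ge> s - 1 \<and> (s \<ge> -1 \<longrightarrow> spline s \<le> s + 1) \<and>
     spline' s \<ge> 0 \<and> spline' s \<le> 1 \<and> spline'' s \<ge> 0"
  proof cases
    case 2
    have "s ^ 3 \<le> 1" "s\<^sup>2 \<le> 1" "s ^ 3 \<ge> 0" "s\<^sup>2 \<ge> 0" using 2 by (auto simp: power_le_one)
    then show ?thesis unfolding B[OF 2] using 2 by (intro conjI impI; linarith)
  next
    case 3
    have "(2 - s) ^ 3 \<le> 1" "(2 - s)\<^sup>2 \<le> 1" "(2 - s) ^ 3 \<ge> 0" "(2 - s)\<^sup>2 \<ge> 0" using 3 by (auto simp: power_le_one)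
    then show ?thesis unfolding C[OF 3] using 3 by (intro conjI impI; linarith)
  qed (use A D in auto)
  then show "spline s \<ge> 0" "spline s \<ge> s - 1" "s \<ge> -1 \<Longrightarrow> spline s \<le> s + 1"
    "spline' s \<ge> 0" "spline' s \<le> 1" "spline'' s \<ge> 0" by auto
  show "s \<le> 0 \<Longrightarrow> spline s = 0" "s \<le> 0 \<Longrightarrow> spline' s = 0" "s \<le> 0 \<Longrightarrow> spline'' s = 0"
    "s \<ge> 2 \<Longrightarrow> spline s = s - 1" "s \<ge> 2 \<Longrightarrow> spline' s = 1" "s \<ge> 2 \<Longrightarrow> spline'' s = 0"
    by (fact A D)+
qed

definition cutoff :: "real \<Rightarrow> real \<Rightarrow> real" where "cutoff d s = d * spline (s / d - 1)"
definition cutoff' :: "real \<Rightarrow> real \<Rightarrow> real" where "cutoff' d s = spline' (s / d - 1)"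
definition cutoff'' :: "real \<Rightarrow> real \<Rightarrow> real" where "cutoff'' d s = spline'' (s / d - 1) / d"

lemma has_real_derivative_cutoff:
  assumes "d > 0"
  shows "(cutoff d has_real_derivative cutoff' d s) (at s)" "(cutoff' d has_real_derivative cutoff'' d s) (at s)"
proof -
  have i: "((\<lambda>s. s / d - 1) has_real_derivative 1 / d) (at s)"
    using assms by (auto intro!: derivative_eq_intros)
  show "(cutoff d has_real_derivative cutoff' d s) (at s)"
    unfolding cutoff_def[abs_def] cutoff'_def
    using DERIV_cmult[OF DERIV_chain2[where g = "\<lambda>s. s / d - 1", OF has_real_derivative_spline(1) i], of d] assms by simp
  show "(cutoff' d has_real_derivative cutoff'' d s) (at s)"
    unfolding cutoff'_def[abs_def] cutoff''_def
    using DERIV_chain2[where g = "\<lambda>s. s / d - 1", OF has_real_derivative_spline(2) i] by simp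
qed

lemma continuous_cutoff'':
  "d > 0 \<Longrightarrow> continuous_on X (cutoff'' d)"
  unfolding cutoff''_def[abs_def] spline''_def 
  by (intro continuous_on_divide continuous_on_add continuous_on_diff continuous_on_mult
      continuous_on_max continuous_on_const continuous_on_id) simp_all

lemma cutoff_bounds:
  assumes "d > 0"
  shows "cutoff d s \<ge> 0" "cutoff d s \<ge> s - 2 * d" "s \<ge> 0 \<Longrightarrow> cutoff d s \<le> s"
    "cutoff' d s \<ge> 0" "cutoff' d s \<le> 1" "cutoff'' d s \<ge> 0"
    "s \<le> d \<Longrightarrow> cutoff d s = 0" "s \<le> d \<Longrightarrow> cutoff' d s = 0" "s \<le> d \<Longrightarrow> cutoff'' d s = 0"
    "s \<ge> 3 * d \<Longrightarrow> cutoff' d s = 1" "s \<ge> 3 * d \<Longrightarrow> cutoff'' d s = 0"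
proof -
  have "d * spline (s / d - 1) \<ge> d * (s / d - 1 - 1)"
    using assms spline_bounds(2)[of "s / d - 1"] by (intro mult_left_mono) auto
  moreover have "d * (s / d - 1 - 1) = s - 2 * d" using assms by (simp add: right_diff_distrib)
  ultimately show "cutoff d s \<ge> s - 2 * d" by (simp add: cutoff_def)
  show "cutoff d s \<le> s" if "s \<ge> 0"
  proof -
    have "d * spline (s / d - 1) \<le> d * (s / d - 1 + 1)"
      using assms that by (intro mult_left_mono spline_bounds(3)) auto
    then show ?thesis using assms by (simp add: cutoff_def)
  qed
  show "cutoff d s \<ge> 0" "cutoff' d s \<ge> 0" "cutoff' d s \<le> 1" "cutoff'' d s \<ge> 0"
    using assms by (simp_all add: cutoff_def cutoff'_def cutoff''_def spline_bounds)
  have "s / d - 1 \<le> 0" if "s \<le> d" using assms that by simp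
  then show "s \<le> d \<Longrightarrow> cutoff d s = 0" "s \<le> d \<Longrightarrow> cutoff' d s = 0" "s \<le> d \<Longrightarrow> cutoff'' d s = 0"
    by (simp_all add: cutoff_def cutoff'_def cutoff''_def spline_bounds)
  have "s / d - 1 \<ge> 2" if "s \<ge> 3 * d" using assms that by (simp add: field_simps)
  then show "s \<ge> 3 * d \<Longrightarrow> cutoff' d s = 1" "s \<ge> 3 * d \<Longrightarrow> cutoff'' d s = 0"
    by (simp_all add: cutoff'_def cutoff''_def spline_bounds)
qed

text \<open>An odd C^1 soft thresholding, made of two cut-offs with disjoint supports: it is zero
  for \<open>\<bar>s\<bar> \<le> e\<close>, and for \<open>\<bar>s\<bar> \<ge> 3 * e\<close> it
  moves \<open>s\<close> towards 0 by \<open>2 * e\<close>.\<close>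

definition shrink :: "real \<Rightarrow> real \<Rightarrow> real" where "shrink e s = cutoff e s - cutoff e (- s)"
definition shrink' :: "real \<Rightarrow> real \<Rightarrow> real" where "shrink' e s = cutoff' e s + cutoff' e (- s)"

lemma has_real_derivative_shrink:
  assumes "e > 0"
  shows "(shrink e has_real_derivative shrink' e s) (at s)"
proof -
  have "((\<lambda>s. cutoff e (- s)) has_real_derivative cutoff' e (- s) * (- 1)) (at s)"
    by (rule DERIV_chain2[OF has_real_derivative_cutoff(1)[OF assms]]) (auto intro!: derivative_eq_intros)
  from DERIV_diff[OF has_real_derivative_cutoff(1)[OF assms] this] show ?thesis
    unfolding shrink_def[abs_def] shrink'_def by simp
qed

lemma shrink_bounds:
  assumes "e > 0"
  shows "\<bar>s\<bar> \<le> e \<Longrightarrow> shrink e s = 0" "\<bar>s\<bar> \<le> e \<Longrightarrow> shrink' e s = 0"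
    "\<bar>shrink e s - s\<bar> \<le> 2 * e" "shrink' e s \<ge> 0" "shrink' e s \<le> 1"
proof -
  note B = cutoff_bounds[OF assms]
  show "\<bar>s\<bar> \<le> e \<Longrightarrow> shrink e s = 0" "\<bar>s\<bar> \<le> e \<Longrightarrow> shrink' e s = 0"
    using B(7,8)[of s] B(7,8)[of "- s"] by (auto simp: shrink_def shrink'_def)
  show "shrink' e s \<ge> 0" using B(4)[of s] B(4)[of "- s"] by (simp add: shrink'_def)
  show "\<bar>shrink e s - s\<bar> \<le> 2 * e"
    using B(2,3,7)[of s] B(2,3,7)[of "- s"] assms by (cases "s \<ge> 0") (auto simp: shrink_def)
  show "shrink' e s \<le> 1"
    using B(5,8)[of s] B(5,8)[of "- s"] assms by (cases "s \<ge> 0") (auto simp: shrink'_def)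
qed

lemma continuous_on_shrink':
  assumes "e > 0" "continuous_on X f"
  shows "continuous_on X (\<lambda>x. shrink' e (f x))"
proof -
  have "continuous_on UNIV (cutoff' e)"
    by (intro continuous_at_imp_continuous_on ballI DERIV_isCont[OF has_real_derivative_cutoff(2)[OF assms(1)]])
  then show ?thesis
    unfolding shrink'_def
    using continuous_on_add[OF continuous_on_compose2[OF _ assms(2)]
        continuous_on_compose2[OF _ continuous_on_minus[OF assms(2)]], of UNIV "cutoff' e" UNIV "cutoff' e"]
    by simp
qed

section \<open>The differential inequality\<close>

lemma has_real_derivative_integral:
  fixes f :: "real \<Rightarrow> real"
  assumes "continuous_on {0..T} f" "t \<in> {0<..<T}"
  shows "((\<lambda>t. integral {0..t} f) has_real_derivative f t) (at t)"
proof -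
  have "((\<lambda>t. integral {0..t} f) has_real_derivative f t) (at t within {0..T})"
    by (rule integral_has_real_derivative[OF assms(1)]) (use assms(2) in auto)
  then have "((\<lambda>t. integral {0..t} f) has_real_derivative f t) (at t within {0<..<T})"
    by (rule DERIV_subset) auto
  then show ?thesis using at_within_open[OF assms(2) open_greaterThanLessThan] by simp
qed

text \<open>One-sided limits at \<open>r\<close> and at \<open>s\<close>, each compared with the
  midpoint \<open>c\<close>, carry the inequality to the ends of the interval; derivatives in time
  are at hand strictly inside only.\<close>

lemma mono_if_mono_interior:
  fixes W :: "real \<Rightarrow> real"
  assumes W: "continuous_on {0..T} W"
    and m: "\<And>r s. 0 < r \<Longrightarrow> r \<le> s \<Longrightarrow> s < T \<Longrightarrow> W r \<le> W s"
    and "0 \<le> r" "r \<le> s" "s \<le> T"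
  shows "W r \<le> W s"
proof (cases "r = s")
  case False
  then have rs: "r < s" "0 \<le> r" "s \<le> T" using assms by auto
  define c where "c = (r + s) / 2"
  have c: "0 < c" "c < T" "r < c" "c < s" using rs by (auto simp: c_def)
  have Wrs: "continuous_on {r..s} W" using W rs by (auto intro: continuous_on_subset)
  have "W r \<le> W c"
  proof (rule tendsto_upperbound)
    have "(W \<longlongrightarrow> W r) (at r within {r..s})" using Wrs rs unfolding continuous_on_def by simp
    then show "(W \<longlongrightarrow> W r) (at_right r)" using rs by (simp add: at_within_Icc_at_right)
    show "\<forall>\<^sub>F x in at_right r. W x \<le> W c"
      unfolding eventually_at_right_field using rs c m by (intro exI[of _ c]) force
  qed simp
  also have "W c \<le> W s"
  proof (rule tendsto_lowerbound)
    have "(W \<longlongrightarrow> W s) (at s within {r..s})" using Wrs rs unfolding continuous_on_def by simp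
    then show "(W \<longlongrightarrow> W s) (at_left s)" using rs by (simp add: at_within_Icc_at_left)
    show "\<forall>\<^sub>F x in at_left s. W c \<le> W x"
      unfolding eventually_at_left_field using rs c m by (intro exI[of _ c]) force
  qed simp
  finally show ?thesis .
qed simp

text \<open>Since \<open>z\<close> is merely a uniform limit of differentiable functions, its
  derivative cannot be used. The monotonicity that z' \<ge> f(z) expresses survives the limit,
  because each \<open>w\<close> has it up to an error proportional to
  \<open>\<kappa>\<close>.\<close>

lemma approximate_differential_inequality:
  fixes z f :: "real \<Rightarrow> real"
  assumes z: "continuous_on {0..T} z" and f: "continuous_on UNIV f"
    and approx: "\<And>\<kappa>. \<kappa> > 0 \<Longrightarrow> \<exists>w. \<forall>t\<in>{0<..<T}. \<bar>w t - z t\<bar> \<le> \<kappa> \<and>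
      (\<exists>D. (w has_real_derivative D) (at t) \<and> D \<ge> f (z t) - \<kappa>)"
    and "0 \<le> r" "r \<le> s" "s \<le> T"
  shows "z r - integral {0..r} (\<lambda>t. f (z t)) \<le> z s - integral {0..s} (\<lambda>t. f (z t))"
proof -
  have fz: "continuous_on {0..T} (\<lambda>t. f (z t))"
    by (rule continuous_on_compose2[OF f z]) auto
  define W where "W t = z t - integral {0..t} (\<lambda>t. f (z t))" for t
  have "W r \<le> W s"
  proof (rule mono_if_mono_interior[OF _ _ assms(4-6)])
    show "continuous_on {0..T} W"
      unfolding W_def
      by (intro continuous_intros z indefinite_integral_continuous_1 integrable_continuous_interval fz)
    fix r s assume rs: "0 < r" "r \<le> s" "s < T"
    show "W r \<le> W s"
    proof (rule field_le_epsilon)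
      fix e :: real assume e: "e > 0"
      \<comment> \<open>Exchanging \<open>w\<close> for \<open>z\<close> at \<open>r\<close> and at
        \<open>s\<close> costs \<open>\<kappa>\<close> each, and the drift term costs at most
        \<open>\<kappa> * T\<close>.\<close>
      define \<kappa> where "\<kappa> = e / (2 + T)"
      have T: "T > 0" using rs by auto
      have \<kappa>: "\<kappa> > 0" "\<kappa> * (2 + T) = e" using e T by (auto simp: \<kappa>_def)
      obtain w where w: "\<And>t. t \<in> {0<..<T} \<Longrightarrow> \<bar>w t - z t\<bar> \<le> \<kappa>"
        "\<And>t. t \<in> {0<..<T} \<Longrightarrow> \<exists>D. (w has_real_derivative D) (at t) \<and> D \<ge> f (z t) - \<kappa>"
        using approx[OF \<kappa>(1)] by blast
      \<comment> \<open>The term \<open>\<kappa> * t\<close> offsets the defect in the inequality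
        for \<open>w\<close>, so that \<open>V\<close> has a nonnegative derivative.\<close>
      define V where "V t = w t - integral {0..t} (\<lambda>t. f (z t)) + \<kappa> * t" for t
      have "V r \<le> V s"
      proof (rule DERIV_nonneg_imp_nondecreasing[OF rs(2)])
        fix t assume "r \<le> t" "t \<le> s"
        then have t: "t \<in> {0<..<T}" using rs by auto
        obtain D where D: "(w has_real_derivative D) (at t)" "D \<ge> f (z t) - \<kappa>" using w(2)[OF t] by blast
        have "(V has_real_derivative D - f (z t) + \<kappa>) (at t)"
          unfolding V_def
          by (rule derivative_eq_intros D(1) has_real_derivative_integral[OF fz t] refl)+ simp
        then show "\<exists>y. (V has_real_derivative y) (at t) \<and> 0 \<le> y" using D(2) by force
      qed
      moreover have "\<kappa> * (s - r) \<le> \<kappa> * T" using \<kappa>(1) rs by (intro mult_left_mono) auto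
      ultimately show "W r \<le> W s + e"
        using w(1)[of r] w(1)[of s] rs \<kappa>(2) unfolding V_def W_def
        by (simp add: algebra_simps)
    qed
  qed
  then show ?thesis by (simp add: W_def)
qed

lemma integral_diff_Icc:
  fixes g :: "real \<Rightarrow> real"
  assumes "continuous_on {0..T} g" "0 \<le> r" "r \<le> s" "s \<le> T"
  shows "integral {0..s} g - integral {0..r} g = integral {r..s} g"
proof -
  have "g integrable_on {0..s}"
    by (rule integrable_continuous_interval) (rule continuous_on_subset[OF assms(1)], use assms in auto)
  then show ?thesis using Henstock_Kurzweil_Integration.integral_combine[of 0 r s g] assms by simp
qed

text \<open>Separation of variables, applied not to \<open>z\<close> but to the function
  \<open>y\<close> below it, which is differentiable with y' = (C/2) z^p \<ge> (C/2) y^p. Then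
  y^(1-p) starts at K^(1-p), decreases at least at the rate (p-1) C/2 and cannot become negative,
  which limits \<open>T\<close>.\<close>

lemma blow_up_time_bound:
  fixes z :: "real \<Rightarrow> real"
  assumes p: "p > 1" and C: "C > 0" and lam: "lam > 0" and K: "K = (2 * lam / C) powr (1 / (p - 1))"
    and z: "continuous_on {0..T} z" and z0: "z 0 \<ge> K" and T: "T > 0"
    and ineq: "\<And>r s. 0 \<le> r \<Longrightarrow> r \<le> s \<Longrightarrow> s \<le> T \<Longrightarrow>
      z r - integral {0..r} (\<lambda>t. C * \<bar>z t\<bar> powr p - lam * z t) \<le> z s - integral {0..s} (\<lambda>t. C * \<bar>z t\<bar> powr p - lam * z t)"
  shows "T \<le> 2 * K powr (1 - p) / ((p - 1) * C)"
proof -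
  have Kpos: "K > 0" using C lam by (simp add: K)
  \<comment> \<open>The constant \<open>K\<close> is made for this: from \<open>K\<close> on,
    \<open>lam * x\<close> is at most half of \<open>C * x powr p\<close>.\<close>
  have KC: "C * K powr (p - 1) = 2 * lam"
    using p C lam by (simp add: K powr_powr)
  define f where "f x = C * \<bar>x\<bar> powr p - lam * x" for x
  have f_ge: "f x \<ge> C / 2 * x powr p" "f x > 0" if "x \<ge> K" for x
  proof -
    have x: "x > 0" using that Kpos by simp
    have "2 * lam \<le> C * x powr (p - 1)"
      using KC C p Kpos that by (metis diff_gt_0_iff_gt less_imp_le mult_left_mono powr_mono2)
    then have "2 * lam * x \<le> C * x powr (p - 1) * x" using x by simp
    moreover have "x powr (p - 1) * x = x powr p" using x by (simp add: powr_diff)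
    ultimately have *: "2 * lam * x \<le> C * x powr p" by (simp add: mult.assoc)
    then show "f x \<ge> C / 2 * x powr p" using x by (simp add: f_def)
    have "C * x powr p > 0" using C x by simp
    moreover have "lam * x > 0" using lam x by simp
    ultimately show "f x > 0" using * x unfolding f_def by simp
  qed
  have fc: "continuous_on UNIV f"
    unfolding f_def by (intro continuous_intros continuous_on_powr') (use p in auto)
  have fzc: "continuous_on {0..T} (\<lambda>t. f (z t))" by (rule continuous_on_compose2[OF fc z]) auto
  have step: "z r + integral {r..s} (\<lambda>t. f (z t)) \<le> z s" if "0 \<le> r" "r \<le> s" "s \<le> T" for r s
    using ineq[OF that] integral_diff_Icc[OF fzc that] by (simp add: f_def)
  \<comment> \<open>At the last time \<open>r\<close> up to \<open>t\<close> with
    \<open>z r \<ge> K\<close>, the value \<open>f (z r)\<close> is strictly positive, even if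
    \<open>z r = K\<close>. So the integrand stays nonnegative a little longer, and \<open>r\<close>
    was not the last such time.\<close>
  have zK: "z t \<ge> K" if t: "t \<in> {0..T}" for t
  proof (rule ccontr)
    assume neg: "\<not> z t \<ge> K"
    define S where "S = {0..t} \<inter> z -` {K..}"
    have zt: "continuous_on {0..t} z" using z t by (auto intro: continuous_on_subset)
    have "closed S" unfolding S_def
      by (rule continuous_closed_preimage[OF zt]) auto
    moreover have "0 \<in> S" using z0 t by (auto simp: S_def)
    moreover have bdd: "bdd_above S" unfolding S_def by (intro bdd_above_Int1) simp
    ultimately have "Sup S \<in> S" by (intro closed_contains_Sup) auto
    define r where "r = Sup S"
    have r: "0 \<le> r" "r \<le> t" "z r \<ge> K" using \<open>Sup S \<in> S\<close> by (auto simp: S_def r_def)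
    have rt: "r < t" using r neg by (cases "r = t") auto
    have fpos: "f (z r) > 0" using f_ge(2)[OF r(3)] .
    obtain d where d: "d > 0" "\<And>s. s \<in> {0..T} \<Longrightarrow> dist s r < d \<Longrightarrow> dist (f (z s)) (f (z r)) < f (z r)"
      using fzc fpos r t unfolding continuous_on_iff by (metis atLeastAtMost_iff order_trans)
    define s where "s = min t (r + d / 2)"
    have s: "r < s" "s \<le> t" "s < r + d" using rt d(1) by (auto simp: s_def)
    have "integral {r..s} (\<lambda>t. f (z t)) \<ge> 0"
    proof (rule integral_nonneg)
      show "(\<lambda>t. f (z t)) integrable_on {r..s}"
        by (rule integrable_continuous_interval) (rule continuous_on_subset[OF fzc], use r s t in auto)
      fix x assume "x \<in> {r..s}"
      then have "dist (f (z x)) (f (z r)) < f (z r)"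
        using r s t by (intro d(2)) (auto simp: dist_real_def)
      then show "0 \<le> f (z x)" by (auto simp: dist_real_def)
    qed
    then have "z s \<ge> K" using step[of r s] r s t by auto
    then have "s \<in> S" using r s by (auto simp: S_def)
    then have "s \<le> r" unfolding r_def by (rule cSup_upper[OF _ bdd])
    then show False using s by simp
  qed
  define g where "g t = C / 2 * (z t) powr p" for t
  have gc: "continuous_on {0..T} g"
    unfolding g_def using zK Kpos by (intro continuous_intros continuous_on_powr z) force
  define y where "y t = K + integral {0..t} g" for t
  have yc: "continuous_on {0..T} y"
    unfolding y_def by (intro continuous_intros indefinite_integral_continuous_1 integrable_continuous_interval gc)
  have yD: "(y has_real_derivative g t) (at t)" if "t \<in> {0<..<T}" for t
    unfolding y_def by (rule derivative_eq_intros has_real_derivative_integral[OF gc that] refl)+ simp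
  have g0: "g t \<ge> 0" if "t \<in> {0..T}" for t using C by (simp add: g_def)
  have int: "h integrable_on {0..t}" if "continuous_on {0..T} h" "t \<in> {0..T}" for h :: "real \<Rightarrow> real" and t
    by (rule integrable_continuous_interval) (rule continuous_on_subset[OF that(1)], use that in auto)
  have yK: "y t \<ge> K" if "t \<in> {0..T}" for t
    unfolding y_def using integral_nonneg[OF int[OF gc that]] g0 that by auto
  have yz: "y t \<le> z t" if t: "t \<in> {0..T}" for t
  proof -
    have "integral {0..t} g \<le> integral {0..t} (\<lambda>t. f (z t))"
      by (rule integral_le[OF int[OF gc t] int[OF fzc t]]) (use t zK f_ge in \<open>auto simp: g_def\<close>)
    then show ?thesis using step[of 0 t] z0 t by (auto simp: y_def)
  qed
  \<comment> \<open>\<open>v\<close> would be constant if y' = (C/2) y^p held exactly; the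
    inequality makes it nonincreasing.\<close>
  define v where "v t = (y t) powr (1 - p) + (p - 1) * (C / 2) * t" for t
  have "v T \<le> v 0"
  proof (rule DERIV_nonpos_imp_decreasing_open[of 0 T v])
    show "0 \<le> T" using T by simp
    show "continuous_on {0..T} v"
      unfolding v_def using yK Kpos by (intro continuous_intros continuous_on_powr yc) force
    fix t assume "0 < t" "t < T"
    then have t: "t \<in> {0<..<T}" "t \<in> {0..T}" by auto
    have y: "y t > 0" using yK[OF t(2)] Kpos by simp
    have "((\<lambda>t. (y t) powr (1 - p)) has_real_derivative (1 - p) * (y t) powr (1 - p - 1) * g t) (at t)"
      by (rule DERIV_cong[OF DERIV_fun_powr[OF yD[OF t(1)] y]]) simp
    moreover have "((\<lambda>t. (p - 1) * (C / 2) * t) has_real_derivative (p - 1) * (C / 2)) (at t)"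
      using DERIV_cmult_Id by blast
    ultimately have "(v has_real_derivative (1 - p) * (y t) powr (1 - p - 1) * g t + (p - 1) * (C / 2)) (at t)"
      unfolding v_def by (rule DERIV_add)
    moreover have "(1 - p) * (y t) powr (1 - p - 1) * g t + (p - 1) * (C / 2) \<le> 0"
    proof -
      have "(y t) powr p \<le> (z t) powr p" using y yz[OF t(2)] p by (intro powr_mono2) auto
      then have "(y t) powr (- p) * (y t) powr p \<le> (y t) powr (- p) * (z t) powr p"
        by (intro mult_left_mono) auto
      then have 1: "1 \<le> (y t) powr (- p) * (z t) powr p" using y by (simp flip: powr_add)
      have "(p - 1) * (C / 2) * 1 \<le> (p - 1) * (C / 2) * ((y t) powr (- p) * (z t) powr p)"
        using 1 p C by (intro mult_left_mono) auto
      then show ?thesis by (simp add: g_def algebra_simps)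
    qed
    ultimately show "\<exists>y. (v has_real_derivative y) (at t) \<and> y \<le> 0" by blast
  qed
  moreover have "v 0 = K powr (1 - p)" by (simp add: v_def y_def)
  moreover have "v T \<ge> (p - 1) * (C / 2) * T" by (simp add: v_def)
  ultimately have "(p - 1) * (C / 2) * T \<le> K powr (1 - p)" by linarith
  then show ?thesis using p C by (simp add: field_simps)
qed

section \<open>Testing with the eigenfunction\<close>

text \<open>Up to the frontier the information on \<open>u\<close> and \<open>\<phi>\<close> is
  continuity with zero boundary values; derivatives are available inside only. This is why both
  functions get truncated.\<close>

locale vhj_eigenfunction_test = vhj_solution_interior +
  fixes \<phi> :: "'a::euclidean_space \<Rightarrow> real" and lam C :: real
  assumes bounded_\<Omega>: "bounded \<Omega>" and T_pos: "T > 0" and lam_pos: "lam > 0" and C_pos: "C > 0"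
    and continuous_u_closure: "continuous_on (closure \<Omega> \<times> {0..T}) u"
    and u_frontier: "x \<in> frontier \<Omega> \<Longrightarrow> t \<in> {0..T} \<Longrightarrow> u (x, t) = 0"
    and C2_\<phi>: "Ck_on 2 \<Omega> \<phi>" and continuous_\<phi>: "continuous_on (closure \<Omega>) \<phi>"
    and \<phi>_frontier: "x \<in> frontier \<Omega> \<Longrightarrow> \<phi> x = 0"
    and laplacian_\<phi>: "x \<in> \<Omega> \<Longrightarrow> laplacian \<phi> x = - lam * \<phi> x"
    and \<phi>_pos: "x \<in> \<Omega> \<Longrightarrow> \<phi> x > 0"
    and poincare: "sobolev0 \<Omega> p v g \<Longrightarrow>
      C * \<bar>\<integral>x. v x * \<phi> x \<partial>(lebesgue_on \<Omega>)\<bar> powr p \<le> (\<integral>x. norm (g x) powr p * \<phi> x \<partial>(lebesgue_on \<Omega>))"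
begin

section \<open>Behaviour up to the boundary\<close>

lemma compact_closure_\<Omega>: "compact (closure \<Omega>)"
  using bounded_\<Omega> by (simp add: compact_closure)

lemma closure_cases: "x \<in> closure \<Omega> \<Longrightarrow> x \<in> \<Omega> \<or> x \<in> frontier \<Omega>"
  using open_\<Omega> by (auto simp: frontier_def interior_open)

text \<open>Two relatively closed pieces are glued, given by the closure and the complement of
  \<open>\<Omega>\<close>; they meet over the frontier, where \<open>f\<close> is zero. In contrast
  to \<open>continuous_on_ext\<close>, the support may reach the frontier.\<close>

lemma continuous_on_ext_closure:
  fixes f :: "'a \<Rightarrow> real \<Rightarrow> real"
  assumes f: "continuous_on (closure \<Omega> \<times> I) (\<lambda>(x, t). f x t)"
    and z: "\<And>x t. x \<in> frontier \<Omega> \<Longrightarrow> t \<in> I \<Longrightarrow> f x t = 0"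
  shows "continuous_on (I \<times> X) (\<lambda>(t, x). ext \<Omega> (\<lambda>x. f x t) x)"
proof -
  have "continuous_on (closure \<Omega> \<times> I \<union> (- \<Omega>) \<times> I) (\<lambda>z. if fst z \<in> \<Omega> then (\<lambda>(x, t). f x t) z else 0)"
  proof (rule continuous_on_cases_local)
    have eq: "closure \<Omega> \<times> I \<union> (- \<Omega>) \<times> I = UNIV \<times> I" using closure_subset[of \<Omega>] by auto
    show "closedin (top_of_set (closure \<Omega> \<times> I \<union> (- \<Omega>) \<times> I)) (closure \<Omega> \<times> I)"
      unfolding eq by (rule closedin_Times) auto
    show "closedin (top_of_set (closure \<Omega> \<times> I \<union> (- \<Omega>) \<times> I)) ((- \<Omega>) \<times> I)"
      unfolding eq using open_\<Omega> by (intro closedin_Times) auto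
  qed (use f in \<open>auto dest!: closure_cases simp: z\<close>)
  then have c: "continuous_on (UNIV \<times> I) (\<lambda>z. ext \<Omega> (\<lambda>x. f x (snd z)) (fst z))"
    by (rule continuous_on_subset[OF continuous_on_eq])
      (use closure_subset[of \<Omega>] in \<open>auto simp: ext_def\<close>)
  have "continuous_on (I \<times> X) (\<lambda>w. ext \<Omega> (\<lambda>x. f x (snd (snd w, fst w))) (fst (snd w, fst w)))"
    by (rule continuous_on_compose2[OF c]) (auto intro!: continuous_intros)
  then show ?thesis by (simp add: case_prod_beta)
qed

lemma integrable_ext_closure:
  fixes f :: "'a \<Rightarrow> real"
  assumes f: "continuous_on (closure \<Omega>) f" and z: "\<And>x. x \<in> frontier \<Omega> \<Longrightarrow> f x = 0"
  shows "continuous_on UNIV (ext \<Omega> f)" "integrable lborel (ext \<Omega> f)"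
proof -
  \<comment> \<open>A function without time dependence is read as one over the single time
    0.\<close>
  have "continuous_on ({0::real} \<times> UNIV) (\<lambda>(t, x). ext \<Omega> f x)"
  proof (rule continuous_on_ext_closure[of "{0}" "\<lambda>x t. f x"])
    show "continuous_on (closure \<Omega> \<times> {0}) (\<lambda>(x, t). f x)"
      unfolding case_prod_beta by (rule continuous_on_compose2[OF f]) (auto intro!: continuous_intros)
  qed (rule z)
  then have "continuous_on UNIV (\<lambda>x. (\<lambda>(t, x). ext \<Omega> f x) (0::real, x))"
    by (rule continuous_on_compose2) (auto intro!: continuous_intros)
  then show c: "continuous_on UNIV (ext \<Omega> f)" by simp
  show "integrable lborel (ext \<Omega> f)"
    by (rule integrable_compact_support[OF c compact_closure_\<Omega>]) (use closure_subset[of \<Omega>] in \<open>auto simp: ext_def\<close>)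
qed

lemma integrable_\<phi>: "integrable lborel (ext \<Omega> \<phi>)"
  by (rule integrable_ext_closure(2)[OF continuous_\<phi> \<phi>_frontier])

lemma continuous_u_slice: "t \<in> {0..T} \<Longrightarrow> continuous_on (closure \<Omega>) (\<lambda>x. u (x, t))"
  by (rule continuous_on_compose2[OF continuous_u_closure]) (auto intro!: continuous_intros)

lemma integrable_u\<phi>: "t \<in> {0..T} \<Longrightarrow> integrable lborel (ext \<Omega> (\<lambda>x. u (x, t) * \<phi> x))"
  by (rule integrable_ext_closure(2)) (auto intro!: continuous_intros continuous_u_slice continuous_\<phi> simp: u_frontier)

text \<open>The total weight, in multiples of which the additive errors below are measured.\<close>

definition mass :: real where "mass = (\<integral>x. ext \<Omega> \<phi> x \<partial>lborel)"

text \<open>Kaplan's function z.\<close>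

definition moment :: "real \<Rightarrow> real" where "moment t = (\<integral>x. ext \<Omega> (\<lambda>x. u (x, t) * \<phi> x) x \<partial>lborel)"

lemma mass_nonneg: "mass \<ge> 0"
  unfolding mass_def by (intro Bochner_Integration.integral_nonneg) (auto simp: ext_def less_imp_le[OF \<phi>_pos])

lemma continuous_moment: "continuous_on {0..T} moment"
proof -
  obtain a where ab: "closure \<Omega> \<subseteq> cbox (- a) a"
    using bounded_subset_cbox_symmetric[OF compact_imp_bounded[OF compact_closure_\<Omega>]] by blast
  have "continuous_on ({0..T} \<times> cbox (- a) a) (\<lambda>(t, x). ext \<Omega> (\<lambda>x. u (x, t) * \<phi> x) x)"
  proof (rule continuous_on_ext_closure)
    have "continuous_on (closure \<Omega> \<times> {0..T}) (\<lambda>z. \<phi> (fst z))"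
      by (rule continuous_on_compose2[OF continuous_\<phi>]) (auto intro!: continuous_intros)
    then show "continuous_on (closure \<Omega> \<times> {0..T}) (\<lambda>(x, t). u (x, t) * \<phi> x)"
      unfolding case_prod_beta prod.collapse by (intro continuous_intros continuous_u_closure)
  qed (simp add: u_frontier)
  then have "continuous_on {0..T} (\<lambda>t. integral (cbox (- a) a) (ext \<Omega> (\<lambda>x. u (x, t) * \<phi> x)))"
    by (rule integral_continuous_on_param)
  then show ?thesis
  proof (rule continuous_on_eq)
    fix t assume "t \<in> {0..T}"
    then show "integral (cbox (- a) a) (ext \<Omega> (\<lambda>x. u (x, t) * \<phi> x)) = moment t"
      unfolding moment_def
      by (intro integral_lborel_eq_cbox[symmetric] integrable_u\<phi>) (use ab closure_subset[of \<Omega>] in \<open>auto simp: ext_def\<close>)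
  qed
qed

lemma u_bounded: obtains M where "M \<ge> 0" "\<And>x t. x \<in> \<Omega> \<Longrightarrow> t \<in> {0..T} \<Longrightarrow> \<bar>u (x, t)\<bar> \<le> M"
proof -
  have "compact (u ` (closure \<Omega> \<times> {0..T}))"
    by (intro compact_continuous_image continuous_u_closure compact_Times compact_closure_\<Omega>) auto
  then obtain B where B: "\<And>y. y \<in> u ` (closure \<Omega> \<times> {0..T}) \<Longrightarrow> norm y \<le> B"
    using compact_imp_bounded bounded_iff by metis
  show thesis
  proof (rule that[of "max B 0"])
    fix x t assume "x \<in> \<Omega>" "t \<in> {0..T}"
    then have "u (x, t) \<in> u ` (closure \<Omega> \<times> {0..T})" using closure_subset[of \<Omega>] by auto
    from B[OF this] show "\<bar>u (x, t)\<bar> \<le> max B 0" by simp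
  qed simp
qed

text \<open>The set where \<open>\<bar>u z\<bar> \<ge> e\<close> is compact and avoids the frontier
  of \<open>\<Omega>\<close>, so \<open>\<phi>\<close> attains a positive minimum on it, and this is
  \<open>m\<close> (or 1 if the set is empty). Compactness in time makes one \<open>m\<close> serve
  all \<open>t\<close>.\<close>

lemma u_small_where_\<phi>_small:
  assumes e: "e > 0"
  obtains m where "m > 0" "\<And>x t. x \<in> \<Omega> \<Longrightarrow> t \<in> {0..T} \<Longrightarrow> \<phi> x < m \<Longrightarrow> \<bar>u (x, t)\<bar> < e"
proof -
  define S where "S = (closure \<Omega> \<times> {0..T}) \<inter> (\<lambda>z. \<bar>u z\<bar>) -` {e..}"
  have cl: "closed (closure \<Omega> \<times> {0..T})" by (intro closed_Times) auto
  have "closed S"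
    unfolding S_def by (intro continuous_closed_preimage cl continuous_intros continuous_u_closure closed_atLeast)
  moreover have "compact (closure \<Omega> \<times> {0..T})" by (intro compact_Times compact_closure_\<Omega> compact_Icc)
  ultimately have "compact ((closure \<Omega> \<times> {0..T}) \<inter> S)" by (rule compact_Int_closed[rotated])
  then have S: "compact S" by (simp add: S_def inf.absorb2)
  have pos: "\<phi> (fst z) > 0" if "z \<in> S" for z
    using that closure_cases[of "fst z"] u_frontier[of "fst z" "snd z"] e \<phi>_pos by (cases z) (auto simp: S_def)
  show thesis
  proof (cases "S = {}")
    case True
    have "\<bar>u (x, t)\<bar> < e" if "x \<in> \<Omega>" "t \<in> {0..T}" for x t
    proof (rule ccontr)
      assume "\<not> \<bar>u (x, t)\<bar> < e"
      then have "(x, t) \<in> S" using that closure_subset[of \<Omega>] by (auto simp: S_def)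
      then show False using True by simp
    qed
    then show thesis by (intro that[of 1]) auto
  next
    case False
    have "continuous_on S (\<lambda>z. \<phi> (fst z))"
      by (rule continuous_on_compose2[OF continuous_\<phi>]) (auto intro!: continuous_intros simp: S_def)
    then obtain z0 where z0: "z0 \<in> S" "\<And>z. z \<in> S \<Longrightarrow> \<phi> (fst z0) \<le> \<phi> (fst z)"
      using continuous_attains_inf[OF S False] by blast
    show thesis
    proof (rule that[OF pos[OF z0(1)]])
      fix x t assume xt: "x \<in> \<Omega>" "t \<in> {0..T}" "\<phi> x < \<phi> (fst z0)"
      show "\<bar>u (x, t)\<bar> < e"
      proof (rule ccontr)
        assume "\<not> \<bar>u (x, t)\<bar> < e"
        then have "(x, t) \<in> S" using xt closure_subset[of \<Omega>] by (auto simp: S_def)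
        from z0(2)[OF this] show False using xt by simp
      qed
    qed
  qed
qed

section \<open>The truncated eigenfunction\<close>

definition test :: "real \<Rightarrow> 'a \<Rightarrow> real" where
  "test d = ext \<Omega> (\<lambda>x. cutoff d (\<phi> x))"

definition test_grad :: "real \<Rightarrow> 'a \<Rightarrow> 'a" where
  "test_grad d = ext \<Omega> (\<lambda>x. cutoff' d (\<phi> x) *\<^sub>R grad \<phi> x)"

text \<open>Row \<open>b\<close> of the Hessian of \<open>test d\<close>, that is, the gradient of
  the component \<open>test_grad d x \<bullet> b\<close>.\<close>

definition test_grad2 :: "real \<Rightarrow> 'a \<Rightarrow> 'a \<Rightarrow> 'a" where
  "test_grad2 d b = ext \<Omega> (\<lambda>x. (cutoff'' d (\<phi> x) * partial_deriv b \<phi> x) *\<^sub>R grad \<phi> x +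
     cutoff' d (\<phi> x) *\<^sub>R grad (partial_deriv b \<phi>) x)"

definition level :: "real \<Rightarrow> 'a set" where "level d = closure \<Omega> \<inter> \<phi> -` {d..}"

text \<open>As \<open>\<phi>\<close> vanishes on the frontier, a superlevel set of positive height
  keeps away from it. Outside this set the cut-off is zero, so it serves as the compact support of
  \<open>test d\<close> and its derivatives.\<close>

lemma level:
  assumes "d > 0"
  shows "compact (level d)" "level d \<subseteq> \<Omega>" "\<And>x. x \<in> \<Omega> \<Longrightarrow> x \<notin> level d \<Longrightarrow> \<phi> x \<le> d"
proof -
  have "closed (level d)"
    unfolding level_def by (intro continuous_closed_preimage continuous_\<phi>) auto
  then have "compact (closure \<Omega> \<inter> level d)" by (rule compact_Int_closed[OF compact_closure_\<Omega>])
  then show "compact (level d)" by (simp add: level_def inf.absorb2)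
  show "level d \<subseteq> \<Omega>"
    using closure_cases \<phi>_frontier assms by (fastforce simp: level_def)
  show "\<phi> x \<le> d" if "x \<in> \<Omega>" "x \<notin> level d" for x
    using that closure_subset[of \<Omega>] by (auto simp: level_def)
qed

lemma continuous_\<phi>_\<Omega>: "continuous_on \<Omega> \<phi>"
  by (rule continuous_on_subset[OF continuous_\<phi> closure_subset])

lemma continuous_cutoff'_\<phi>:
  assumes "d > 0" shows "continuous_on \<Omega> (\<lambda>x. cutoff' d (\<phi> x))"
proof -
  have "continuous_on UNIV (cutoff' d)"
    by (intro continuous_at_imp_continuous_on ballI DERIV_isCont[OF has_real_derivative_cutoff(2)[OF assms]])
  then show ?thesis by (rule continuous_on_compose2[OF _ continuous_\<phi>_\<Omega>]) auto
qed

lemma C1c_test: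
  assumes d: "d > 0"
  shows "C1c (level d) (test d) (test_grad d)"
  unfolding test_def test_grad_def
proof (rule C1c_ext[OF open_\<Omega> level(1,2)[OF d]])
  show "((\<lambda>x. cutoff d (\<phi> x)) has_derivative (\<lambda>h. (cutoff' d (\<phi> x) *\<^sub>R grad \<phi> x) \<bullet> h)) (at x)" if "x \<in> \<Omega>" for x
    using has_derivative_compose[OF has_derivative_grad[OF Ck_on_2D(1)[OF C2_\<phi> that]]
        has_real_derivative_cutoff(1)[OF d, unfolded has_field_derivative_def]] by simp
  show "continuous_on \<Omega> (\<lambda>x. cutoff' d (\<phi> x) *\<^sub>R grad \<phi> x)"
    by (rule continuous_on_scaleR[OF continuous_cutoff'_\<phi>[OF d] Ck_on_2D(6)[OF C2_\<phi>]])
  show "cutoff d (\<phi> x) = 0" if "x \<in> \<Omega>" "x \<notin> level d" for x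
    using cutoff_bounds(7)[OF d level(3)[OF d that]] .
qed

lemma C1c_test_grad:
  assumes d: "d > 0" and b: "b \<in> Basis"
  shows "C1c (level d) (\<lambda>x. test_grad d x \<bullet> b) (test_grad2 d b)"
proof -
  have "C1c (level d) (ext \<Omega> (\<lambda>x. cutoff' d (\<phi> x) * partial_deriv b \<phi> x)) (test_grad2 d b)"
    unfolding test_grad2_def
  proof (rule C1c_ext[OF open_\<Omega> level(1,2)[OF d]])
    fix x assume x: "x \<in> \<Omega>"
    have 1: "((\<lambda>x. cutoff' d (\<phi> x)) has_derivative (\<lambda>h. cutoff'' d (\<phi> x) * (grad \<phi> x \<bullet> h))) (at x)"
      using has_derivative_compose[OF has_derivative_grad[OF Ck_on_2D(1)[OF C2_\<phi> x]]
        has_real_derivative_cutoff(2)[OF d, unfolded has_field_derivative_def]] by simp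
    have 2: "(partial_deriv b \<phi> has_derivative (\<lambda>h. grad (partial_deriv b \<phi>) x \<bullet> h)) (at x)"
      by (rule has_derivative_grad[OF Ck_on_2D(2)[OF C2_\<phi> b x]])
    show "((\<lambda>x. cutoff' d (\<phi> x) * partial_deriv b \<phi> x) has_derivative
       (\<lambda>h. ((cutoff'' d (\<phi> x) * partial_deriv b \<phi> x) *\<^sub>R grad \<phi> x + cutoff' d (\<phi> x) *\<^sub>R grad (partial_deriv b \<phi>) x) \<bullet> h)) (at x)"
      by (rule has_derivative_eq_rhs[OF has_derivative_mult[OF 1 2]]) (simp add: fun_eq_iff inner_add_left)
    show "cutoff' d (\<phi> x) * partial_deriv b \<phi> x = 0" if "x \<notin> level d"
      using cutoff_bounds(8)[OF d level(3)[OF d x that]] by simp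
  next
    have "continuous_on \<Omega> (\<lambda>x. cutoff'' d (\<phi> x))"
      by (rule continuous_on_compose2[OF continuous_cutoff''[OF d, of UNIV] continuous_\<phi>_\<Omega>]) auto
    moreover have "continuous_on \<Omega> (grad (partial_deriv b \<phi>))"
      unfolding grad_def[of "partial_deriv b \<phi>"] by (intro continuous_intros Ck_on_2D(3)[OF C2_\<phi> b])
    ultimately show "continuous_on \<Omega> (\<lambda>x. (cutoff'' d (\<phi> x) * partial_deriv b \<phi> x) *\<^sub>R grad \<phi> x +
       cutoff' d (\<phi> x) *\<^sub>R grad (partial_deriv b \<phi>) x)"
      by (intro continuous_on_add continuous_on_scaleR continuous_on_mult continuous_cutoff'_\<phi>[OF d]
          Ck_on_2D(6)[OF C2_\<phi>] Ck_on_2D(4)[OF C2_\<phi> b])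
  qed
  moreover have "ext \<Omega> (\<lambda>x. cutoff' d (\<phi> x) * partial_deriv b \<phi> x) = (\<lambda>x. test_grad d x \<bullet> b)"
    using grad_inner_Basis[OF b, of \<phi>] by (simp add: test_grad_def ext_def fun_eq_iff)
  ultimately show ?thesis by simp
qed

text \<open>The chain rule gives h''(\<phi>) |grad \<phi>|^2 plus h'(\<phi>) times the Laplacian of
  \<phi>, into which the eigenvalue equation is inserted. The first term lives in the layer where
  \<phi> is between d and 3 d.\<close>

lemma laplacian_test:
  "(\<Sum>b\<in>Basis. test_grad2 d b x \<bullet> b) =
     ext \<Omega> (\<lambda>x. cutoff'' d (\<phi> x) * (norm (grad \<phi> x))\<^sup>2) x - lam * ext \<Omega> (\<lambda>x. cutoff' d (\<phi> x) * \<phi> x) x"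
proof (cases "x \<in> \<Omega>")
  case True
  have "(\<Sum>b\<in>Basis. test_grad2 d b x \<bullet> b) =
    (\<Sum>b\<in>Basis. cutoff'' d (\<phi> x) * ((grad \<phi> x \<bullet> b) * (grad \<phi> x \<bullet> b)) + cutoff' d (\<phi> x) * partial_deriv b (partial_deriv b \<phi>) x)"
    using True by (intro sum.cong refl) (simp add: test_grad2_def inner_add_left grad_inner_Basis)
  also have "\<dots> = cutoff'' d (\<phi> x) * (grad \<phi> x \<bullet> grad \<phi> x) + cutoff' d (\<phi> x) * laplacian \<phi> x"
    by (subst euclidean_inner) (simp add: sum.distrib sum_distrib_left laplacian_def)
  also have "\<dots> = cutoff'' d (\<phi> x) * (norm (grad \<phi> x))\<^sup>2 - lam * (cutoff' d (\<phi> x) * \<phi> x)"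
    using laplacian_\<phi>[OF True] by (simp add: power2_norm_eq_inner)
  finally show ?thesis using True by simp
qed (simp add: test_grad2_def)

lemma integrable_supported:
  fixes h :: "'a \<Rightarrow> real"
  assumes "d > 0" "continuous_on \<Omega> h" "\<And>x. x \<in> \<Omega> \<Longrightarrow> x \<notin> level d \<Longrightarrow> h x = 0"
  shows "integrable lborel (ext \<Omega> h)"
proof (rule integrable_compact_support[OF continuous_on_ext[OF open_\<Omega> _ level(2)[OF assms(1)]] level(1)[OF assms(1)]])
  show "closed (level d)" using level(1)[OF assms(1)] compact_imp_closed by blast
qed (use assms in \<open>auto simp: ext_def\<close>)

lemma integrable_cutoffs:
  assumes d: "d > 0"
  shows "integrable lborel (ext \<Omega> (\<lambda>x. cutoff'' d (\<phi> x) * (norm (grad \<phi> x))\<^sup>2))"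
    "integrable lborel (ext \<Omega> (\<lambda>x. cutoff' d (\<phi> x) * \<phi> x))"
proof -
  have "continuous_on \<Omega> (\<lambda>x. cutoff'' d (\<phi> x))"
    by (rule continuous_on_compose2[OF continuous_cutoff''[OF d, of UNIV] continuous_\<phi>_\<Omega>]) auto
  then show "integrable lborel (ext \<Omega> (\<lambda>x. cutoff'' d (\<phi> x) * (norm (grad \<phi> x))\<^sup>2))"
    using cutoff_bounds(9)[OF d level(3)[OF d]]
    by (intro integrable_supported[OF d] continuous_on_mult continuous_on_power continuous_on_norm Ck_on_2D(6)[OF C2_\<phi>]) auto
  show "integrable lborel (ext \<Omega> (\<lambda>x. cutoff' d (\<phi> x) * \<phi> x))"
    using cutoff_bounds(8)[OF d level(3)[OF d]]
    by (intro integrable_supported[OF d] continuous_on_mult continuous_cutoff'_\<phi>[OF d] continuous_\<phi>_\<Omega>) auto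
qed

text \<open>The boundary layer term has bounded mass because the Laplacian of the compactly supported
  function \<open>test d\<close> integrates to zero.\<close>

lemma boundary_layer_mass:
  assumes d: "d > 0"
  shows "(\<integral>x. ext \<Omega> (\<lambda>x. cutoff'' d (\<phi> x) * (norm (grad \<phi> x))\<^sup>2) x \<partial>lborel) \<le> lam * mass"
proof -
  have i: "integrable lborel (\<lambda>x. test_grad2 d b x \<bullet> b)" if b: "b \<in> Basis" for b
  proof -
    note D = C1cD[OF C1c_test_grad[OF d b]]
    show ?thesis by (rule integrable_compact_support[OF _ D(1)]) (use D(4,7) in \<open>auto intro!: continuous_intros\<close>)
  qed
  have "(\<integral>x. (\<Sum>b\<in>Basis. test_grad2 d b x \<bullet> b) \<partial>lborel) = (\<Sum>b\<in>Basis. (\<integral>x. test_grad2 d b x \<bullet> b \<partial>lborel))"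
    by (rule Bochner_Integration.integral_sum[OF i])
  also have "\<dots> = 0"
    by (intro sum.neutral ballI integral_partial_deriv_eq_0[OF C1c_test_grad[OF d]])
  finally have "(\<integral>x. ext \<Omega> (\<lambda>x. cutoff'' d (\<phi> x) * (norm (grad \<phi> x))\<^sup>2) x \<partial>lborel)
     = lam * (\<integral>x. ext \<Omega> (\<lambda>x. cutoff' d (\<phi> x) * \<phi> x) x \<partial>lborel)"
    unfolding laplacian_test using integrable_cutoffs[OF d] by simp
  also have "\<dots> \<le> lam * mass"
    unfolding mass_def
  proof (intro mult_left_mono Bochner_Integration.integral_mono integrable_cutoffs[OF d] integrable_\<phi>)
    show "ext \<Omega> (\<lambda>x. cutoff' d (\<phi> x) * \<phi> x) x \<le> ext \<Omega> \<phi> x" for x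
      using cutoff_bounds(5)[OF d, of "\<phi> x"] \<phi>_pos[of x] by (cases "x \<in> \<Omega>") auto
  qed (use lam_pos in simp)
  finally show ?thesis .
qed

text \<open>\<open>u\<close> vanishes on the frontier, so the set where
  \<open>\<bar>u (x, t)\<bar> \<ge> e\<close> is a compact subset of \<open>\<Omega>\<close>, and
  the thresholding removes everything outside it.\<close>

lemma C1c_shrink:
  assumes t: "t \<in> {0<..<T}" and e: "e > 0"
  obtains S where "S \<subseteq> \<Omega>"
    "C1c S (ext \<Omega> (\<lambda>x. shrink e (u (x, t)))) (ext \<Omega> (\<lambda>x. shrink' e (u (x, t)) *\<^sub>R fst (G (x, t))))"
proof -
  define S where "S = closure \<Omega> \<inter> (\<lambda>x. \<bar>u (x, t)\<bar>) -` {e..}"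
  have t': "t \<in> {0..T}" using t by simp
  have "closed S"
    unfolding S_def by (intro continuous_closed_preimage continuous_intros continuous_u_slice t') auto
  then have "compact (closure \<Omega> \<inter> S)" by (rule compact_Int_closed[OF compact_closure_\<Omega>])
  then have S: "compact S" by (simp add: S_def inf.absorb2)
  have S\<Omega>: "S \<subseteq> \<Omega>"
    using closure_cases u_frontier[OF _ t'] e by (fastforce simp: S_def)
  have gc: "continuous_on \<Omega> (\<lambda>x. G (x, t))"
    by (rule continuous_on_compose2[OF continuous_G]) (use t in \<open>auto intro!: continuous_intros\<close>)
  have uc: "continuous_on \<Omega> (\<lambda>x. u (x, t))"
    by (rule continuous_on_subset[OF continuous_u_slice[OF t'] closure_subset])
  have "C1c S (ext \<Omega> (\<lambda>x. shrink e (u (x, t)))) (ext \<Omega> (\<lambda>x. shrink' e (u (x, t)) *\<^sub>R fst (G (x, t))))"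
  proof (rule C1c_ext[OF open_\<Omega> S S\<Omega>])
    fix x assume x: "x \<in> \<Omega>"
    have D: "((\<lambda>x. u (x, t)) has_derivative (\<lambda>v. fst (G (x, t)) \<bullet> v)) (at x)"
      by (intro has_derivative_slice_fst has_derivative_u) (use x t in auto)
    show "((\<lambda>x. shrink e (u (x, t))) has_derivative (\<lambda>h. (shrink' e (u (x, t)) *\<^sub>R fst (G (x, t))) \<bullet> h)) (at x)"
      using has_derivative_compose[OF D has_real_derivative_shrink[OF e, unfolded has_field_derivative_def]] by simp
    show "shrink e (u (x, t)) = 0" if "x \<notin> S"
      using that x closure_subset[of \<Omega>] by (intro shrink_bounds(1)[OF e]) (auto simp: S_def)
  next
    show "continuous_on \<Omega> (\<lambda>x. shrink' e (u (x, t)) *\<^sub>R fst (G (x, t)))"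
      by (intro continuous_on_scaleR continuous_on_shrink'[OF e uc] continuous_on_fst gc)
  qed
  then show thesis by (rule that[OF S\<Omega>])
qed

lemma ext_mult_\<phi>: "ext \<Omega> (\<lambda>x. f x * \<phi> x) x = f x * ext \<Omega> \<phi> x"
  by (simp add: ext_def)

lemma continuous_ext_\<phi>: "continuous_on UNIV (ext \<Omega> \<phi>)"
  by (rule integrable_ext_closure(1)[OF continuous_\<phi> \<phi>_frontier])

lemma ext_\<phi>_nonneg: "ext \<Omega> \<phi> x \<ge> 0"
  by (simp add: ext_def less_imp_le[OF \<phi>_pos])

lemma continuous_slices:
  assumes t: "t \<in> {0<..<T}"
  shows "continuous_on \<Omega> (\<lambda>x. G (x, t))" "continuous_on \<Omega> (\<lambda>x. u (x, t))"
    "continuous_on \<Omega> (\<lambda>x. norm (fst (G (x, t))) powr p)"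
proof -
  show gc: "continuous_on \<Omega> (\<lambda>x. G (x, t))"
    by (rule continuous_on_compose2[OF continuous_G]) (use t in \<open>auto intro!: continuous_intros\<close>)
  show "continuous_on \<Omega> (\<lambda>x. u (x, t))"
    by (rule continuous_on_subset[OF continuous_u_slice closure_subset]) (use t in auto)
  show "continuous_on \<Omega> (\<lambda>x. norm (fst (G (x, t))) powr p)"
    by (rule continuous_on_norm_powr[OF continuous_on_fst[OF gc]]) (use p_gt_1 in simp)
qed

lemma test_bounds:
  assumes "d > 0" "x \<in> \<Omega>"
  shows "test d x \<ge> 0" "test d x \<ge> \<phi> x - 2 * d" "test d x \<le> \<phi> x"
  using cutoff_bounds[OF assms(1)] less_imp_le[OF \<phi>_pos[OF assms(2)]] assms(2) by (simp_all add: test_def)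

section \<open>Error estimates that are uniform in time\<close>

definition test_moment :: "real \<Rightarrow> real \<Rightarrow> real" where
  "test_moment d t = (\<integral>x. ext \<Omega> (\<lambda>x. u (x, t) * test d x) x \<partial>lborel)"

text \<open>Two regimes, each with an error of at most \<open>e * (M + 1) * \<phi> x\<close>. Where
  \<open>\<phi> x < m\<close>, the factor \<open>u\<close> is below \<open>e\<close> and
  \<open>test d\<close> is off by at most \<open>\<phi> x\<close>. Elsewhere \<open>u\<close> is at
  most \<open>M\<close>, and \<open>test d\<close> is off by at most
  \<open>2 * d \<le> e * m \<le> e * \<phi> x\<close>.\<close>

lemma test_moment_close:
  assumes e: "e > 0" and d: "d > 0" "2 * d \<le> e * m" and t: "t \<in> {0<..<T}"
    and M: "M \<ge> 0" "\<And>x. x \<in> \<Omega> \<Longrightarrow> \<bar>u (x, t)\<bar> \<le> M"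
    and small: "\<And>x. x \<in> \<Omega> \<Longrightarrow> \<phi> x < m \<Longrightarrow> \<bar>u (x, t)\<bar> < e"
  shows "\<bar>test_moment d t - moment t\<bar> \<le> e * (M + 1) * mass"
proof -
  note D = C1cD[OF C1c_test[OF d(1)]]
  have i1: "integrable lborel (ext \<Omega> (\<lambda>x. u (x, t) * test d x))"
    by (rule integrable_supported[OF d(1)])
      (use continuous_slices(2)[OF t] continuous_on_subset[OF D(5)] D(6) in \<open>auto intro!: continuous_on_mult\<close>)
  have i2: "integrable lborel (ext \<Omega> (\<lambda>x. u (x, t) * \<phi> x))"
    using integrable_u\<phi>[of t] t by simp
  have "test_moment d t - moment t =
     (\<integral>x. ext \<Omega> (\<lambda>x. u (x, t) * test d x) x - ext \<Omega> (\<lambda>x. u (x, t) * \<phi> x) x \<partial>lborel)"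
    unfolding test_moment_def moment_def using i1 i2 by simp
  also have "\<bar>\<dots>\<bar> \<le> (\<integral>x. e * (M + 1) * ext \<Omega> \<phi> x \<partial>lborel)"
  proof (rule integral_abs_bound_integral)
    fix x
    show "\<bar>ext \<Omega> (\<lambda>x. u (x, t) * test d x) x - ext \<Omega> (\<lambda>x. u (x, t) * \<phi> x) x\<bar> \<le> e * (M + 1) * ext \<Omega> \<phi> x"
    proof (cases "x \<in> \<Omega>")
      case x: True
      note tb = test_bounds[OF d(1) x]
      have \<phi>: "\<phi> x > 0" using \<phi>_pos[OF x] .
      have "\<bar>u (x, t)\<bar> * \<bar>test d x - \<phi> x\<bar> \<le> e * (M + 1) * \<phi> x"
      proof (cases "\<phi> x < m")
        case True
        have "\<bar>u (x, t)\<bar> * \<bar>test d x - \<phi> x\<bar> \<le> e * \<phi> x"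
          by (rule mult_mono) (use small[OF x True] tb e in auto)
        also have "\<dots> \<le> e * (M + 1) * \<phi> x" using e M(1) \<phi> by (simp add: algebra_simps)
        finally show ?thesis .
      next
        case False
        have "e * m \<le> e * \<phi> x" using False e by (intro mult_left_mono) auto
        then have "2 * d \<le> e * \<phi> x" using d(2) by linarith
        then have "\<bar>u (x, t)\<bar> * \<bar>test d x - \<phi> x\<bar> \<le> M * (e * \<phi> x)"
          using tb by (intro mult_mono M x) auto
        also have "\<dots> \<le> e * (M + 1) * \<phi> x" using e \<phi> by (simp add: algebra_simps)
        finally show ?thesis .
      qed
      then show ?thesis using x by (simp add: abs_mult flip: right_diff_distrib)
    qed simp
  qed (use i1 i2 integrable_\<phi> in auto)
  also have "\<dots> = e * (M + 1) * mass" by (simp add: mass_def)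
  finally show ?thesis .
qed

text \<open>Where \<open>\<phi> x \<ge> m \<ge> 3 * d\<close>, the cut-off is exactly linear and the
  term is \<open>- lam * (u (x, t) * \<phi> x)\<close>. Where \<open>\<phi> x < m\<close>, smallness
  of \<open>u\<close> controls both the boundary layer and the defect of
  \<open>cutoff' d (\<phi> x)\<close> from 1.\<close>

lemma diffusion_term_bound:
  assumes e: "e > 0" and d: "d > 0" "3 * d \<le> m" and t: "t \<in> {0<..<T}"
    and small: "\<And>x. x \<in> \<Omega> \<Longrightarrow> \<phi> x < m \<Longrightarrow> \<bar>u (x, t)\<bar> < e"
  shows "(\<integral>x. ext \<Omega> (\<lambda>x. u (x, t) * (\<Sum>b\<in>Basis. test_grad2 d b x \<bullet> b)) x \<partial>lborel) \<ge> - lam * moment t - 2 * lam * e * mass"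
proof -
  let ?L = "\<lambda>x. cutoff'' d (\<phi> x) * (norm (grad \<phi> x))\<^sup>2"
  have i1: "integrable lborel (ext \<Omega> (\<lambda>x. u (x, t) * (\<Sum>b\<in>Basis. test_grad2 d b x \<bullet> b)))"
  proof (rule integrable_supported[OF d(1)])
    show "continuous_on \<Omega> (\<lambda>x. u (x, t) * (\<Sum>b\<in>Basis. test_grad2 d b x \<bullet> b))"
      by (intro continuous_on_mult continuous_on_sum continuous_on_inner continuous_on_const
          continuous_slices(2)[OF t] continuous_on_subset[OF C1cD(4)[OF C1c_test_grad[OF d(1)]]]) auto
    show "u (x, t) * (\<Sum>b\<in>Basis. test_grad2 d b x \<bullet> b) = 0" if "x \<notin> level d" for x
      using C1cD(7)[OF C1c_test_grad[OF d(1)] that] by simp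
  qed
  have i2: "integrable lborel (ext \<Omega> (\<lambda>x. u (x, t) * \<phi> x))" using integrable_u\<phi>[of t] t by simp
  note i3 = integrable_cutoffs(1)[OF d(1)]
  \<comment> \<open>Two errors of the same size: the first comes from
    \<open>boundary_layer_mass\<close>, the second from replacing
    \<open>cutoff' d (\<phi> x)\<close> by 1.\<close>
  have "- e * (lam * mass) - lam * moment t - lam * e * mass
     \<le> (\<integral>x. - e * ext \<Omega> ?L x - lam * ext \<Omega> (\<lambda>x. u (x, t) * \<phi> x) x - lam * e * ext \<Omega> \<phi> x \<partial>lborel)"
    using mult_left_mono[OF boundary_layer_mass[OF d(1)], of e] e i2 i3 integrable_\<phi>
    by (simp add: moment_def mass_def)
  also have "\<dots> \<le> (\<integral>x. ext \<Omega> (\<lambda>x. u (x, t) * (\<Sum>b\<in>Basis. test_grad2 d b x \<bullet> b)) x \<partial>lborel)"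
  proof (rule Bochner_Integration.integral_mono[OF _ i1])
    show "integrable lborel (\<lambda>x. - e * ext \<Omega> ?L x - lam * ext \<Omega> (\<lambda>x. u (x, t) * \<phi> x) x - lam * e * ext \<Omega> \<phi> x)"
      using i2 i3 integrable_\<phi> by simp
    fix x
    show "- e * ext \<Omega> ?L x - lam * ext \<Omega> (\<lambda>x. u (x, t) * \<phi> x) x - lam * e * ext \<Omega> \<phi> x
       \<le> ext \<Omega> (\<lambda>x. u (x, t) * (\<Sum>b\<in>Basis. test_grad2 d b x \<bullet> b)) x"
    proof (cases "x \<in> \<Omega>")
      case x: True
      have \<phi>: "\<phi> x > 0" using \<phi>_pos[OF x] .
      have L: "?L x \<ge> 0" using cutoff_bounds(6)[OF d(1)] by simp
      have "- e * ?L x - lam * (u (x, t) * \<phi> x) - lam * e * \<phi> x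
        \<le> u (x, t) * (?L x - lam * (cutoff' d (\<phi> x) * \<phi> x))"
      proof (cases "\<phi> x < m")
        case True
        have 1: "- e * ?L x \<le> u (x, t) * ?L x"
          using small[OF x True] by (intro mult_right_mono L) auto
        have "- (u (x, t) * (1 - cutoff' d (\<phi> x))) \<le> e"
        proof -
          have "\<bar>u (x, t)\<bar> * (1 - cutoff' d (\<phi> x)) \<le> e * 1"
            by (rule mult_mono) (use small[OF x True] cutoff_bounds(4,5)[OF d(1), of "\<phi> x"] e in auto)
          moreover have "- (u (x, t) * (1 - cutoff' d (\<phi> x))) \<le> \<bar>u (x, t)\<bar> * (1 - cutoff' d (\<phi> x))"
            using mult_right_mono[of "- u (x, t)" "\<bar>u (x, t)\<bar>" "1 - cutoff' d (\<phi> x)"] cutoff_bounds(5)[OF d(1), of "\<phi> x"]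
            by simp
          ultimately show ?thesis by simp
        qed
        then have "- (u (x, t) * (1 - cutoff' d (\<phi> x))) * (lam * \<phi> x) \<le> e * (lam * \<phi> x)"
          using lam_pos \<phi> by (intro mult_right_mono) auto
        then show ?thesis using 1 by (simp add: algebra_simps)
      next
        case False
        then have "cutoff'' d (\<phi> x) = 0" "cutoff' d (\<phi> x) = 1"
          using cutoff_bounds(10,11)[OF d(1), of "\<phi> x"] d(2) by auto
        moreover have "lam * e * \<phi> x \<ge> 0" using lam_pos e \<phi> by simp
        ultimately show ?thesis by simp
      qed
      then show ?thesis using x by (simp add: laplacian_test)
    qed simp
  qed
  finally show ?thesis by (simp add: algebra_simps)
qed

text \<open>\<open>y\<close> is the moment of the soft thresholding of \<open>u\<close>, which
  differs from \<open>u\<close> by at most \<open>2 * e\<close> and is admissible in the Poincare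
  type inequality. Where \<open>\<bar>u (x, t)\<bar> \<le> e\<close> its gradient vanishes;
  elsewhere \<open>\<phi> x \<ge> m\<close>, so that
  \<open>test d x \<ge> (1 - e) * \<phi> x\<close>. Hence the weight \<open>\<phi>\<close> may be
  exchanged for \<open>test d\<close> at the price of the factor \<open>1 - e\<close>.\<close>

lemma gradient_term_bound:
  assumes e: "e > 0" "e < 1" and d: "d > 0" "2 * d \<le> e * m" and t: "t \<in> {0<..<T}"
    and small: "\<And>x. x \<in> \<Omega> \<Longrightarrow> \<phi> x < m \<Longrightarrow> \<bar>u (x, t)\<bar> < e"
  obtains y where "\<bar>y - moment t\<bar> \<le> 2 * e * mass"
    "(1 - e) * (C * \<bar>y\<bar> powr p) \<le> (\<integral>x. ext \<Omega> (\<lambda>x. norm (fst (G (x, t))) powr p * test d x) x \<partial>lborel)"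
proof -
  define v where "v = ext \<Omega> (\<lambda>x. shrink e (u (x, t)))"
  define g where "g = ext \<Omega> (\<lambda>x. shrink' e (u (x, t)) *\<^sub>R fst (G (x, t)))"
  obtain S where S: "S \<subseteq> \<Omega>" "C1c S v g" unfolding v_def g_def by (rule C1c_shrink[OF t e(1)])
  note V = C1cD[OF S(2)]
  define y where "y = (\<integral>x. ext \<Omega> (\<lambda>x. v x * \<phi> x) x \<partial>lborel)"
  have v_int: "integrable lborel (ext \<Omega> (\<lambda>x. v x * \<phi> x))"
    by (rule integrable_compact_support[OF _ V(1)])
      (use V(5,6) in \<open>auto simp: ext_mult_\<phi> intro!: continuous_on_mult continuous_ext_\<phi>\<close>)
  have "continuous_on UNIV (\<lambda>x. norm (g x) powr p * ext \<Omega> \<phi> x)"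
    using p_gt_1 by (intro continuous_on_mult continuous_on_norm_powr V continuous_ext_\<phi>) simp
  then have gm: "ext \<Omega> (\<lambda>x. norm (g x) powr p * \<phi> x) \<in> borel_measurable borel"
    unfolding ext_mult_\<phi>[abs_def, symmetric] by (rule borel_measurable_continuous_onI)
  have \<Omega>b: "\<Omega> \<in> sets borel" using open_\<Omega> by simp
  have "C * \<bar>\<integral>x. v x * \<phi> x \<partial>(lebesgue_on \<Omega>)\<bar> powr p \<le> (\<integral>x. norm (g x) powr p * \<phi> x \<partial>(lebesgue_on \<Omega>))"
    by (rule poincare[OF C1c_sobolev0[OF open_\<Omega> S p_gt_1]])
  then have P: "C * \<bar>y\<bar> powr p \<le> (\<integral>x. ext \<Omega> (\<lambda>x. norm (g x) powr p * \<phi> x) x \<partial>lborel)"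
    using integral_lebesgue_on[OF \<Omega>b gm] integral_lebesgue_on[OF \<Omega>b, of "\<lambda>x. v x * \<phi> x"] borel_measurable_integrable[OF v_int]
    by (simp add: y_def)
  have i2: "integrable lborel (ext \<Omega> (\<lambda>x. u (x, t) * \<phi> x))" using integrable_u\<phi>[of t] t by simp
  have "y - moment t = (\<integral>x. ext \<Omega> (\<lambda>x. v x * \<phi> x) x - ext \<Omega> (\<lambda>x. u (x, t) * \<phi> x) x \<partial>lborel)"
    unfolding y_def moment_def using v_int i2 by simp
  also have "\<bar>\<dots>\<bar> \<le> (\<integral>x. 2 * e * ext \<Omega> \<phi> x \<partial>lborel)"
  proof (rule integral_abs_bound_integral)
    fix x
    show "\<bar>ext \<Omega> (\<lambda>x. v x * \<phi> x) x - ext \<Omega> (\<lambda>x. u (x, t) * \<phi> x) x\<bar> \<le> 2 * e * ext \<Omega> \<phi> x"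
    proof (cases "x \<in> \<Omega>")
      case True
      then have "\<bar>v x - u (x, t)\<bar> \<le> 2 * e" using shrink_bounds(3)[OF e(1)] by (simp add: v_def)
      then have "\<bar>v x - u (x, t)\<bar> * ext \<Omega> \<phi> x \<le> 2 * e * ext \<Omega> \<phi> x"
        by (rule mult_right_mono) (rule ext_\<phi>_nonneg)
      then show ?thesis
        unfolding ext_mult_\<phi> left_diff_distrib[symmetric] abs_mult abs_of_nonneg[OF ext_\<phi>_nonneg] .
    qed simp
  qed (use v_int i2 integrable_\<phi> in auto)
  also have "\<dots> = 2 * e * mass" by (simp add: mass_def)
  finally have y: "\<bar>y - moment t\<bar> \<le> 2 * e * mass" .
  note D = C1cD[OF C1c_test[OF d(1)]]
  have i3: "integrable lborel (ext \<Omega> (\<lambda>x. norm (fst (G (x, t))) powr p * test d x))"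
    by (rule integrable_supported[OF d(1)])
      (use continuous_slices(3)[OF t] continuous_on_subset[OF D(5)] D(6) in \<open>auto intro!: continuous_on_mult\<close>)
  have "(1 - e) * (C * \<bar>y\<bar> powr p) \<le> (1 - e) * (\<integral>x. ext \<Omega> (\<lambda>x. norm (g x) powr p * \<phi> x) x \<partial>lborel)"
    using e P by (intro mult_left_mono) auto
  also have "\<dots> = (\<integral>x. (1 - e) * ext \<Omega> (\<lambda>x. norm (g x) powr p * \<phi> x) x \<partial>lborel)"
    by simp
  also have "\<dots> \<le> (\<integral>x. ext \<Omega> (\<lambda>x. norm (fst (G (x, t))) powr p * test d x) x \<partial>lborel)"
  proof (rule integral_mono'[OF i3])
    fix x
    show "0 \<le> ext \<Omega> (\<lambda>x. norm (fst (G (x, t))) powr p * test d x) x"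
      using test_bounds(1)[OF d(1)] by (simp add: ext_def)
    show "(1 - e) * ext \<Omega> (\<lambda>x. norm (g x) powr p * \<phi> x) x \<le> ext \<Omega> (\<lambda>x. norm (fst (G (x, t))) powr p * test d x) x"
    proof (cases "x \<in> \<Omega>")
      case x: True
      show ?thesis
      proof (cases "\<bar>u (x, t)\<bar> \<le> e")
        case True
        then have "g x = 0" using shrink_bounds(2)[OF e(1)] x by (simp add: g_def)
        then show ?thesis using x test_bounds(1)[OF d(1) x] p_gt_1 by simp
      next
        case False
        then have m: "\<phi> x \<ge> m" using small[OF x] by force
        have "e * m \<le> e * \<phi> x" using m e by (intro mult_left_mono) auto
        then have "2 * d \<le> e * \<phi> x" using d(2) by linarith
        then have "(1 - e) * \<phi> x \<le> test d x" using test_bounds(2)[OF d(1) x] by (simp add: algebra_simps)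
        moreover have "norm (g x) powr p \<le> norm (fst (G (x, t))) powr p"
        proof (rule powr_mono2)
          have "\<bar>shrink' e (u (x, t))\<bar> * norm (fst (G (x, t))) \<le> 1 * norm (fst (G (x, t)))"
            using shrink_bounds(4,5)[OF e(1), of "u (x, t)"] by (intro mult_right_mono) auto
          then show "norm (g x) \<le> norm (fst (G (x, t)))" using x by (simp add: g_def)
        qed (use p_gt_1 in auto)
        ultimately have "norm (g x) powr p * ((1 - e) * \<phi> x) \<le> norm (fst (G (x, t))) powr p * test d x"
          using e \<phi>_pos[OF x] by (intro mult_mono) auto
        then show ?thesis using x by (simp add: mult_ac)
      qed
    qed simp
  qed
  finally show thesis by (rule that[OF y])
qed

text \<open>All parameters are chosen independently of \<open>t\<close>, so that the single function
  \<open>test_moment d\<close> serves the whole time interval, as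
  \<open>approximate_differential_inequality\<close> demands. The level \<open>m\<close> depends on
  \<open>e\<close>, and \<open>d\<close> on both.\<close>

lemma approximate_moment_inequality:
  assumes \<kappa>: "\<kappa> > 0"
  shows "\<exists>w. \<forall>t\<in>{0<..<T}. \<bar>w t - moment t\<bar> \<le> \<kappa> \<and>
    (\<exists>D. (w has_real_derivative D) (at t) \<and> D \<ge> (C * \<bar>moment t\<bar> powr p - lam * moment t) - \<kappa>)"
proof -
  obtain M where M: "M \<ge> 0" "\<And>x t. x \<in> \<Omega> \<Longrightarrow> t \<in> {0..T} \<Longrightarrow> \<bar>u (x, t)\<bar> \<le> M"
    by (rule u_bounded) blast
  have "bounded (moment ` {0..T})"
    by (intro compact_imp_bounded compact_continuous_image continuous_moment compact_Icc)
  then obtain R where "\<forall>y\<in>moment ` {0..T}. norm y \<le> R"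
    unfolding bounded_iff by (elim exE)
  then have R: "\<bar>moment t\<bar> \<le> R" if "t \<in> {0..T}" for t
    using that by simp
  define h where "h s = C * \<bar>s\<bar> powr p" for s
  \<comment> \<open>The margin 1 beyond the range of the moment accommodates \<open>y\<close>, which
    will be within \<open>q \<le> 1\<close> of it.\<close>
  have hc: "continuous_on {-(R+1)..R+1} h"
    unfolding h_def using continuous_on_norm_powr[of _ "\<lambda>s::real. s" p] p_gt_1
    by (intro continuous_on_mult continuous_on_const) auto
  have "uniformly_continuous_on {-(R+1)..R+1} h" by (rule compact_uniformly_continuous[OF hc]) simp
  moreover have "\<kappa> / 4 > 0" using \<kappa> by simp
  ultimately have "\<exists>\<delta>>0. \<forall>r\<in>{-(R+1)..R+1}. \<forall>s\<in>{-(R+1)..R+1}. dist s r < \<delta> \<longrightarrow> dist (h s) (h r) < \<kappa> / 4"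
    unfolding uniformly_continuous_on_def by (elim allE[where x = "\<kappa> / 4"] impE) assumption+
  then obtain \<delta> where \<delta>: "\<delta> > 0"
    "\<forall>r\<in>{-(R+1)..R+1}. \<forall>s\<in>{-(R+1)..R+1}. dist s r < \<delta> \<longrightarrow> dist (h s) (h r) < \<kappa> / 4"
    by (elim exE conjE)
  define B where "B = C * (R + 1) powr p"
  have B: "B \<ge> 0" using C_pos by (simp add: B_def)
  \<comment> \<open>The three entries serve the uniform continuity of \<open>h\<close>, the margin
    1, and a quarter of \<open>\<kappa>\<close> for an additive error.\<close>
  define q where "q = Min {\<delta> / 2, 1, \<kappa> / 4}"
  have q: "q > 0" "q < \<delta>" "q \<le> 1" "q \<le> \<kappa> / 4" using \<delta>(1) \<kappa> by (auto simp: q_def)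
  \<comment> \<open>\<open>Z\<close> dominates the coefficient of \<open>e\<close> in every error
    term and is at least 1, so \<open>e \<le> q / Z\<close> makes each of these terms at most
    \<open>q\<close>.\<close>
  define Z where "Z = 1 + 2 * mass + 2 * lam * mass + B + (M + 1) * mass"
  have parts: "2 * mass \<ge> 0" "2 * lam * mass \<ge> 0" "(M + 1) * mass \<ge> 0"
    using mass_nonneg lam_pos M(1) by auto
  have Z: "Z \<ge> 1" using parts B by (simp add: Z_def)
  define e where "e = min (1/2) (q / Z)"
  have e: "e > 0" "e < 1" using q Z by (auto simp: e_def)
  have "e * Z \<le> q / Z * Z" unfolding e_def using Z by (intro mult_right_mono) auto
  then have eZ: "e * Z \<le> q" using Z by simp
  have small_parts: "2 * e * mass \<le> q" "2 * lam * e * mass \<le> q" "e * B \<le> q" "e * (M + 1) * mass \<le> q"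
  proof -
    have X: "e * X \<le> q" if "X \<le> Z" for X
    proof -
      have "e * X \<le> e * Z" using that e by (intro mult_left_mono) auto
      then show ?thesis using eZ by linarith
    qed
    have "2 * mass \<le> Z" "2 * lam * mass \<le> Z" "B \<le> Z" "(M + 1) * mass \<le> Z"
      unfolding Z_def using parts B by linarith+
    from this[THEN X] show "2 * e * mass \<le> q" "2 * lam * e * mass \<le> q" "e * B \<le> q" "e * (M + 1) * mass \<le> q"
      by (simp_all only: mult.assoc mult.left_commute[of e])
  qed
  obtain m where m: "m > 0" "\<And>x t. x \<in> \<Omega> \<Longrightarrow> t \<in> {0..T} \<Longrightarrow> \<phi> x < m \<Longrightarrow> \<bar>u (x, t)\<bar> < e"
    by (rule u_small_where_\<phi>_small[OF e(1)]) blast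
  \<comment> \<open>Meets both smallness conditions: \<open>3 * d = e * m\<close>, and
    \<open>e < 1\<close>.\<close>
  define d where "d = e * m / 3"
  have d: "d > 0" "2 * d \<le> e * m" "3 * d \<le> m" using e m(1) by (auto simp: d_def)
  show ?thesis
  proof (intro exI[of _ "test_moment d"] ballI conjI)
    fix t assume t: "t \<in> {0<..<T}"
    then have t': "t \<in> {0..T}" by simp
    note small = m(2)[OF _ t']
    have "\<bar>test_moment d t - moment t\<bar> \<le> e * (M + 1) * mass"
      by (rule test_moment_close[OF e(1) d(1,2) t M(1) M(2)[OF _ t'] small])
    then show "\<bar>test_moment d t - moment t\<bar> \<le> \<kappa>" using small_parts(4) q(4) \<kappa> by simp
    let ?D = "(\<integral>x. ext \<Omega> (\<lambda>x. u (x, t) * (\<Sum>b\<in>Basis. test_grad2 d b x \<bullet> b)) x \<partial>lborel) +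
      (\<integral>x. ext \<Omega> (\<lambda>x. norm (fst (G (x, t))) powr p * test d x) x \<partial>lborel)"
    have D: "(test_moment d has_real_derivative ?D) (at t)"
      unfolding test_moment_def[abs_def]
      by (rule has_derivative_weighted_integral[OF C1c_test[OF d(1)] level(2)[OF d(1)] t C1c_test_grad[OF d(1)]])
    obtain y where y: "\<bar>y - moment t\<bar> \<le> 2 * e * mass"
      "(1 - e) * (C * \<bar>y\<bar> powr p) \<le> (\<integral>x. ext \<Omega> (\<lambda>x. norm (fst (G (x, t))) powr p * test d x) x \<partial>lborel)"
      by (rule gradient_term_bound[OF e d(1,2) t small]) blast
    have diff: "(\<integral>x. ext \<Omega> (\<lambda>x. u (x, t) * (\<Sum>b\<in>Basis. test_grad2 d b x \<bullet> b)) x \<partial>lborel) \<ge> - lam * moment t - 2 * lam * e * mass"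
      by (rule diffusion_term_bound[OF e(1) d(1,3) t small])
    have zR: "\<bar>moment t\<bar> \<le> R" using R[OF t'] .
    have yz: "\<bar>y - moment t\<bar> \<le> q" using y(1) small_parts(1) by simp
    then have yR: "\<bar>y\<bar> \<le> R + 1" using zR q(3) by linarith
    have "dist (h y) (h (moment t)) < \<kappa> / 4"
      by (rule \<delta>(2)[rule_format]) (use yz zR yR q in \<open>auto simp: dist_real_def\<close>)
    then have hy: "h y \<ge> h (moment t) - \<kappa> / 4" unfolding dist_real_def by linarith
    have "h y \<le> B"
      unfolding h_def B_def using C_pos yR p_gt_1 by (intro mult_left_mono powr_mono2) auto
    then have "e * h y \<le> e * B" using e by (intro mult_left_mono) auto
    then have "e * h y \<le> q" using small_parts(3) by linarith
    then have "(1 - e) * h y \<ge> h y - q" by (simp add: algebra_simps)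
    \<comment> \<open>The losses are \<open>\<kappa> / 4\<close> from moving \<open>y\<close> to the
      moment, \<open>q\<close> from the factor \<open>1 - e\<close> and \<open>q\<close> from the
      diffusion term, together at most \<open>3 * \<kappa> / 4\<close>.\<close>
    then have "?D \<ge> h (moment t) - lam * moment t - \<kappa>"
      using y(2) diff hy small_parts(2) q(4) \<kappa> unfolding h_def by linarith
    then show "\<exists>D. (test_moment d has_real_derivative D) (at t) \<and> D \<ge> (C * \<bar>moment t\<bar> powr p - lam * moment t) - \<kappa>"
      using D unfolding h_def by (intro exI conjI)
  qed
qed

lemma existence_time_bound:
  assumes K: "K = (2 * lam / C) powr (1 / (p - 1))" and m0: "moment 0 \<ge> K"
  shows "T \<le> 2 * K powr (1 - p) / ((p - 1) * C)"
proof (rule blow_up_time_bound[OF p_gt_1 C_pos lam_pos K continuous_moment m0 T_pos])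
  fix r s :: real assume rs: "0 \<le> r" "r \<le> s" "s \<le> T"
  have "continuous_on UNIV (\<lambda>s. C * \<bar>s\<bar> powr p - lam * s)"
    using continuous_on_norm_powr[of _ "\<lambda>s::real. s" p] p_gt_1
    by (intro continuous_on_diff continuous_on_mult continuous_on_const continuous_on_id) auto
  from approximate_differential_inequality[OF continuous_moment this approximate_moment_inequality rs]
  show "moment r - integral {0..r} (\<lambda>t. C * \<bar>moment t\<bar> powr p - lam * moment t)
     \<le> moment s - integral {0..s} (\<lambda>t. C * \<bar>moment t\<bar> powr p - lam * moment t)" .
qed

end

text \<open>On an open subset the derivative within \<open>S\<close> is a full derivative, and the
  Hoelder estimate on a closed ball around each point makes \<open>G\<close> continuous
  there.\<close>

lemma C1_holder_on_interior:
  fixes f :: "'b::euclidean_space \<Rightarrow> real"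
  assumes "C1_holder_on \<alpha> S f" "\<alpha> > 0" "open U" "U \<subseteq> S"
  obtains G where "\<And>z. z \<in> U \<Longrightarrow> (f has_derivative (\<lambda>h. G z \<bullet> h)) (at z)" "continuous_on U G"
proof -
  obtain G where G: "(\<forall>z\<in>S. (f has_derivative (\<lambda>h. G z \<bullet> h)) (at z within S)) \<and>
      (\<forall>K. compact K \<and> K \<subseteq> S \<longrightarrow> (\<exists>M. \<forall>z\<in>K. \<forall>w\<in>K. norm (G z - G w) \<le> M * dist z w powr \<alpha>))"
    using assms(1) unfolding C1_holder_on_def by (elim exE)
  show thesis
  proof (rule that[of G])
    show "(f has_derivative (\<lambda>h. G z \<bullet> h)) (at z)" if "z \<in> U" for z
      using has_derivative_subset[OF bspec[OF conjunct1[OF G]] assms(4), of z] that assms(4) at_within_open[OF that assms(3)] by auto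
    have "isCont G z" if z: "z \<in> U" for z
    proof -
      obtain r where r: "r > 0" "cball z r \<subseteq> U" using assms(3) z open_contains_cball by blast
      have "compact (cball z r) \<and> cball z r \<subseteq> S" using r(2) assms(4) by auto
      from conjunct2[OF G, rule_format, OF this] obtain M where
        M: "\<forall>w\<in>cball z r. \<forall>w'\<in>cball z r. norm (G w - G w') \<le> M * dist w w' powr \<alpha>" by (elim exE)
      have "((\<lambda>w. dist w z) \<longlongrightarrow> 0) (at z)"
        using tendsto_dist[OF tendsto_ident_at tendsto_const, of z z UNIV] by simp
      then have "((\<lambda>w. dist w z powr \<alpha>) \<longlongrightarrow> 0) (at z)"
        using tendsto_zero_powrI[of "\<lambda>w. dist w z" "at z" "\<lambda>_. \<alpha>" \<alpha>] assms(2) by simp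
      then have "((\<lambda>w. M * dist w z powr \<alpha>) \<longlongrightarrow> 0) (at z)" by (rule tendsto_mult_right_zero)
      moreover have "\<forall>\<^sub>F w in at z. norm (G w - G z) \<le> M * dist w z powr \<alpha>"
        unfolding eventually_at using r(1) M by (intro exI[of _ r]) (simp add: dist_commute)
      ultimately have "((\<lambda>w. G w - G z) \<longlongrightarrow> 0) (at z)" by (rule Lim_null_comparison[rotated])
      then show ?thesis unfolding isCont_def by (simp add: LIM_zero_iff)
    qed
    then show "continuous_on U G" by (rule continuous_at_imp_continuous_on[OF ballI])
  qed
qed

theorem theorem3p8:
  fixes \<Omega> :: "'a::euclidean_space set"
    and p lambda1 C K :: real
    and u0 \<phi>1 :: "'a \<Rightarrow> real"
  assumes "bounded_C2_domain \<Omega>"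
    and "p > 2"
    and "Ck_on 2 \<Omega> u0" and "L_infinity \<Omega> u0"
    and "lambda1 > 0" and "first_dirichlet_eigenpair \<Omega> lambda1 \<phi>1"
    and "C > 0"
    and "\<And>v g. sobolev0 \<Omega> p v g \<Longrightarrow>
           C * \<bar>\<integral>x. v x * \<phi>1 x \<partial>(lebesgue_on \<Omega>)\<bar> powr p
             \<le> (\<integral>x. norm (g x) powr p * \<phi>1 x \<partial>(lebesgue_on \<Omega>))"
    and "K = (2 * lambda1 / C) powr (1 / (p - 1))"
    and "(\<integral>x. u0 x * \<phi>1 x \<partial>(lebesgue_on \<Omega>)) \<ge> K"
  shows "maximal_existence_time \<Omega> p u0 < \<infinity>"
proof -
  have \<Omega>: "open \<Omega>" "bounded \<Omega>" using assms(1) by (auto simp: bounded_C2_domain_def)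
  have ef: "Ck_on 2 \<Omega> \<phi>1" "continuous_on (closure \<Omega>) \<phi>1" "\<And>x. x \<in> \<Omega> \<Longrightarrow> - laplacian \<phi>1 x = lambda1 * \<phi>1 x"
    "\<And>x. x \<in> frontier \<Omega> \<Longrightarrow> \<phi>1 x = 0" "\<And>x. x \<in> \<Omega> \<Longrightarrow> \<phi>1 x > 0"
    using assms(6) by (auto simp: first_dirichlet_eigenpair_def dirichlet_eigenfunction_def)
  \<comment> \<open>The bound involves no solution, so it applies to the supremum over all of them,
    also when there is none.\<close>
  define B where "B = 2 * K powr (1 - p) / ((p - 1) * C)"
  have "T \<le> B" if T: "T > 0" and sol: "vhj_solution \<Omega> p u0 T u" for T u
  proof -
    obtain \<alpha> where \<alpha>: "\<alpha> > 0" "C1_holder_on \<alpha> (\<Omega> \<times> {0..T}) u"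
      using sol by (auto simp: vhj_solution_def)
    \<comment> \<open>Passing to the open cylinder discards the one-sided time derivatives at its
      two ends.\<close>
    obtain G where G: "\<And>z. z \<in> \<Omega> \<times> {0<..<T} \<Longrightarrow> (u has_derivative (\<lambda>h. G z \<bullet> h)) (at z)"
      "continuous_on (\<Omega> \<times> {0<..<T}) G"
      by (rule C1_holder_on_interior[OF \<alpha>(2,1), of "\<Omega> \<times> {0<..<T}"]) (use \<Omega>(1) in \<open>auto intro: open_Times\<close>)
    interpret vhj_eigenfunction_test \<Omega> p T u G \<phi>1 lambda1 C
    proof
      show "laplacian \<phi>1 x = - lambda1 * \<phi>1 x" if "x \<in> \<Omega>" for x using ef(3)[OF that] by simp
      show "u (x, t) = 0" if "x \<in> frontier \<Omega>" "t \<in> {0..T}" for x t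
        using sol that by (auto simp: vhj_solution_def)
    qed (use assms(2,5,7,8) \<Omega> ef G T sol in \<open>simp_all add: vhj_solution_def\<close>)
    \<comment> \<open>The initial values are prescribed on \<open>\<Omega>\<close> only, and the
      extension by zero ignores all others.\<close>
    have 0: "ext \<Omega> (\<lambda>x. u0 x * \<phi>1 x) = ext \<Omega> (\<lambda>x. u (x, 0) * \<phi>1 x)"
      using sol by (auto simp: vhj_solution_def ext_def)
    have "integrable lborel (ext \<Omega> (\<lambda>x. u (x, 0) * \<phi>1 x))" using T by (intro integrable_u\<phi>) simp
    then have "moment 0 = (\<integral>x. u0 x * \<phi>1 x \<partial>(lebesgue_on \<Omega>))"
      using \<Omega>(1) borel_measurable_integrable by (subst integral_lebesgue_on) (auto simp: moment_def 0)
    then have "moment 0 \<ge> K" using assms(10) by simp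
    then show "T \<le> B" unfolding B_def by (rule existence_time_bound[OF assms(9)])
  qed
  then have "maximal_existence_time \<Omega> p u0 \<le> ereal B"
    unfolding maximal_existence_time_def by (intro SUP_least) auto
  then show ?thesis by (rule le_less_trans) simp
qed

end
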